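(* Let $R$ be a non-local Dedekind domain with quotient field $K$, and let $M$ be an $R$-module. Then the following are equivalent: (i) $M$ is a dual self-CS-Baer module; (ii) $M=T(M)\oplus L$ such that $T(M)$ is a dual self-CS-Baer module and $L\cong K^{(I)}$ for some index set $I$; (iii) $M=\left(\bigoplus_{\mathfrak{p}\in\mathbf{P}}T_{\mathfrak{p}}(M)\right)\oplus L$ such that each $T_{\mathfrak{p}}(M)$ ($\mathfrak{p}\in\mathbf{P}$) is a dual self-CS-Baer $R_{\mathfrak{p}}$-module and $L\cong K^{(I)}$ for some index set $I$.
   Context: A module $M$ is dual self-CS-Baer if for every family $(f_i)_{i\in I}$ of endomorphisms of $M$, the submodule $\sum_{i\in I}\mathrm{Im}(f_i)$ lies above a direct summand of $M$, i.e. contains a direct summand $D$ of $M$ such that $\left(\sum_{i\in I}\mathrm{Im}(f_i)\right)/D$ is superfluous in $M/D$ (a submodule $A$ of $B$ is superfluous if $A+X=B$ implies $X=B$ for every submodule $X$ of $B$). $\mathbf{P}$ is the set of non-zero prime ideals of $R$; $T(M)=\{x\in M\mid \mathrm{Ann}_R(x)\neq 0\}$; for $\mathfrak{p}\in\mathbf{P}$, $T_{\mathfrak{p}}(M)=\{x\in M\mid \mathfrak{p}^n x=0\text{ for some integer }n\geq 0\}$, which is naturally a module over the localization $R_{\mathfrak{p}}$. $K^{(I)}$ is the direct sum of $I$ copies of $K$. *)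

theory Defs
  imports "HOL-Algebra.Algebra"
begin

section \<open>Localizations of commutative rings\<close>

definition fraction_rel :: "('a, 'c) ring_scheme \<Rightarrow> 'a set \<Rightarrow> (('a \<times> 'a) \<times> ('a \<times> 'a)) set" where
  "fraction_rel R S = {((a, s), (b, t)). a \<in> carrier R \<and> b \<in> carrier R \<and> s \<in> S \<and> t \<in> S \<and>
     (\<exists>u\<in>S. u \<otimes>\<^bsub>R\<^esub> (t \<otimes>\<^bsub>R\<^esub> a) = u \<otimes>\<^bsub>R\<^esub> (s \<otimes>\<^bsub>R\<^esub> b))}"

definition fraction :: "('a, 'c) ring_scheme \<Rightarrow> 'a set \<Rightarrow> 'a \<Rightarrow> 'a \<Rightarrow> ('a \<times> 'a) set" where
  "fraction R S a s = fraction_rel R S `` {(a, s)}"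

text \<open>The operations are given on representatives; each union below ranges over equal classes.\<close>

definition localization :: "('a, 'c) ring_scheme \<Rightarrow> 'a set \<Rightarrow> ('a \<times> 'a) set ring" where
  "localization R S =
     \<lparr> carrier = (carrier R \<times> S) // fraction_rel R S,
       monoid.mult = (\<lambda>U V. \<Union>x\<in>U. \<Union>y\<in>V. fraction R S (fst x \<otimes>\<^bsub>R\<^esub> fst y) (snd x \<otimes>\<^bsub>R\<^esub> snd y)),
       monoid.one = fraction R S \<one>\<^bsub>R\<^esub> \<one>\<^bsub>R\<^esub>,
       ring.zero = fraction R S \<zero>\<^bsub>R\<^esub> \<one>\<^bsub>R\<^esub>,
       ring.add = (\<lambda>U V. \<Union>x\<in>U. \<Union>y\<in>V.
                fraction R S ((fst x \<otimes>\<^bsub>R\<^esub> snd y) \<oplus>\<^bsub>R\<^esub> (fst y \<otimes>\<^bsub>R\<^esub> snd x)) (snd x \<otimes>\<^bsub>R\<^esub> snd y)) \<rparr>"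

definition quotient_field :: "('a, 'c) ring_scheme \<Rightarrow> ('a \<times> 'a) set ring" where
  "quotient_field R = localization R (carrier R - {\<zero>\<^bsub>R\<^esub>})"

definition to_quotient_field :: "('a, 'c) ring_scheme \<Rightarrow> 'a \<Rightarrow> ('a \<times> 'a) set" where
  "to_quotient_field R r = fraction R (carrier R - {\<zero>\<^bsub>R\<^esub>}) r \<one>\<^bsub>R\<^esub>"

definition localization_at :: "('a, 'c) ring_scheme \<Rightarrow> 'a set \<Rightarrow> ('a \<times> 'a) set ring" where
  "localization_at R p = localization R (carrier R - p)"


section \<open>Dedekind domains\<close>

definition integral_over :: "('k, 'c) ring_scheme \<Rightarrow> 'k set \<Rightarrow> 'k \<Rightarrow> bool" where
  "integral_over K A x \<longleftrightarrow>
     (\<exists>f \<in> carrier (A [X]\<^bsub>K\<^esub>). f \<noteq> [] \<and> lead_coeff f = \<one>\<^bsub>K\<^esub> \<and> ring.eval K f x = \<zero>\<^bsub>K\<^esub>)"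

text \<open>Fields are admitted, as usual in module theory; they are local rings.\<close>

locale dedekind_domain = noetherian_domain +
  assumes integrally_closed:
      "\<lbrakk> x \<in> carrier (quotient_field R);
         integral_over (quotient_field R) (to_quotient_field R ` carrier R) x \<rbrakk>
       \<Longrightarrow> x \<in> to_quotient_field R ` carrier R"
    and nonzero_prime_maximal: "\<lbrakk> primeideal p R; p \<noteq> {\<zero>} \<rbrakk> \<Longrightarrow> maximalideal p R"

definition local_ring :: "('a, 'c) ring_scheme \<Rightarrow> bool" where
  "local_ring R \<longleftrightarrow> cring R \<and> (\<exists>!m. maximalideal m R)"

definition nonzero_primes :: "('a, 'c) ring_scheme \<Rightarrow> 'a set set" where
  "nonzero_primes R = {p. primeideal p R \<and> p \<noteq> {\<zero>\<^bsub>R\<^esub>}}"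


section \<open>Modules\<close>

text \<open>A homomorphism is a total function of which only the values on the carrier matter.\<close>

definition module_hom ::
    "('a, 'c) ring_scheme \<Rightarrow> ('a, 'm, 'd) module_scheme \<Rightarrow> ('a, 'n, 'e) module_scheme \<Rightarrow> ('m \<Rightarrow> 'n) set" where
  "module_hom R M N = {f \<in> hom (add_monoid M) (add_monoid N).
     \<forall>r\<in>carrier R. \<forall>x\<in>carrier M. f (r \<odot>\<^bsub>M\<^esub> x) = r \<odot>\<^bsub>N\<^esub> f x}"

definition module_isomorphic ::
    "('a, 'c) ring_scheme \<Rightarrow> ('a, 'm, 'd) module_scheme \<Rightarrow> ('a, 'n, 'e) module_scheme \<Rightarrow> bool" where
  "module_isomorphic R M N \<longleftrightarrow> (\<exists>f \<in> module_hom R M N. bij_betw f (carrier M) (carrier N))"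

definition direct_sum_decomposition ::
    "('a, 'c) ring_scheme \<Rightarrow> ('a, 'm, 'd) module_scheme \<Rightarrow> 'm set \<Rightarrow> 'm set \<Rightarrow> bool" where
  "direct_sum_decomposition R M A B \<longleftrightarrow>
     submodule A R M \<and> submodule B R M \<and> A \<inter> B = {\<zero>\<^bsub>M\<^esub>} \<and> (A <+>\<^bsub>M\<^esub> B) = carrier M"

definition direct_summand ::
    "('a, 'c) ring_scheme \<Rightarrow> ('a, 'm, 'd) module_scheme \<Rightarrow> 'm set \<Rightarrow> bool" where
  "direct_summand R M D \<longleftrightarrow> (\<exists>E. direct_sum_decomposition R M D E)"

definition module_sum ::
    "('a, 'm, 'd) module_scheme \<Rightarrow> 'i set \<Rightarrow> ('i \<Rightarrow> 'm set) \<Rightarrow> 'm set" where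
  "module_sum M I N = {finsum M x J | x J. finite J \<and> J \<subseteq> I \<and> x \<in> Pi J N}"

definition independent_family ::
    "('a, 'c) ring_scheme \<Rightarrow> ('a, 'm, 'd) module_scheme \<Rightarrow> 'i set \<Rightarrow> ('i \<Rightarrow> 'm set) \<Rightarrow> bool" where
  "independent_family R M I N \<longleftrightarrow> (\<forall>i\<in>I. submodule (N i) R M) \<and>
     (\<forall>i\<in>I. N i \<inter> module_sum M (I - {i}) N = {\<zero>\<^bsub>M\<^esub>})"

text \<open>The multiplicative fields of a module record carry no meaning.\<close>

definition quotient_module ::
    "('a, 'm, 'd) module_scheme \<Rightarrow> 'm set \<Rightarrow> ('a, 'm set) module" where
  "quotient_module M D =
     \<lparr> carrier = a_rcosets\<^bsub>M\<^esub> D, monoid.mult = undefined, monoid.one = undefined,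
       ring.zero = D, ring.add = set_add M,
       smult = (\<lambda>r U. \<Union>x\<in>U. D +>\<^bsub>M\<^esub> (r \<odot>\<^bsub>M\<^esub> x)) \<rparr>"

definition quotient_submodule :: "('a, 'm, 'd) module_scheme \<Rightarrow> 'm set \<Rightarrow> 'm set \<Rightarrow> 'm set set" where
  "quotient_submodule M N D = (\<lambda>x. D +>\<^bsub>M\<^esub> x) ` N"

definition superfluous ::
    "('a, 'c) ring_scheme \<Rightarrow> ('a, 'm, 'd) module_scheme \<Rightarrow> 'm set \<Rightarrow> bool" where
  "superfluous R B A \<longleftrightarrow> submodule A R B \<and>
     (\<forall>U. submodule U R B \<and> (A <+>\<^bsub>B\<^esub> U) = carrier B \<longrightarrow> U = carrier B)"

definition lies_above_direct_summand ::
    "('a, 'c) ring_scheme \<Rightarrow> ('a, 'm, 'd) module_scheme \<Rightarrow> 'm set \<Rightarrow> bool" where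
  "lies_above_direct_summand R M N \<longleftrightarrow> (\<exists>D. direct_summand R M D \<and> D \<subseteq> N \<and>
     superfluous R (quotient_module M D) (quotient_submodule M N D))"

text \<open>Index sets are taken in the type of the endomorphisms themselves. This covers families
  over arbitrary index sets, because the sum of the images depends only on the set of
  endomorphisms that occur in the family.\<close>

locale dual_self_CS_Baer = module R M for R (structure) and M :: "('a, 'm, 'd) module_scheme" (structure) +
  assumes sum_of_images_lies_above:
    "\<And>(I :: ('m \<Rightarrow> 'm) set) f. f \<in> I \<rightarrow> module_hom R M M \<Longrightarrow>
       lies_above_direct_summand R M (module_sum M I (\<lambda>i. f i ` carrier M))"

definition torsion :: "('a, 'c) ring_scheme \<Rightarrow> ('a, 'm, 'd) module_scheme \<Rightarrow> 'm set" where
  "torsion R M = {x \<in> carrier M. {r \<in> carrier R. r \<odot>\<^bsub>M\<^esub> x = \<zero>\<^bsub>M\<^esub>} \<noteq> {\<zero>\<^bsub>R\<^esub>}}"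

definition primary_part ::
    "('a, 'c) ring_scheme \<Rightarrow> ('a, 'm, 'd) module_scheme \<Rightarrow> 'a set \<Rightarrow> 'm set" where
  "primary_part R M p =
     {x \<in> carrier M. \<exists>n::nat. \<forall>r \<in> p [^]\<^bsub>ideals_set R\<^esub> n. r \<odot>\<^bsub>M\<^esub> x = \<zero>\<^bsub>M\<^esub>}"

text \<open>Elements outside \<open>p\<close> act bijectively on the \<open>p\<close>-primary part when \<open>p\<close> is maximal, so
  \<open>(r / s) x\<close> is the unique \<open>y\<close> in it with \<open>s y = r x\<close>, for any representative \<open>(r, s)\<close>.\<close>

definition primary_part_module ::
    "('a, 'c) ring_scheme \<Rightarrow> ('a, 'm, 'd) module_scheme \<Rightarrow> 'a set \<Rightarrow> (('a \<times> 'a) set, 'm) module" where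
  "primary_part_module R M p =
     \<lparr> carrier = primary_part R M p, monoid.mult = undefined, monoid.one = undefined,
       ring.zero = \<zero>\<^bsub>M\<^esub>, ring.add = add M,
       smult = (\<lambda>U x. THE y. y \<in> primary_part R M p \<and> (\<forall>(r, s)\<in>U. s \<odot>\<^bsub>M\<^esub> y = r \<odot>\<^bsub>M\<^esub> x)) \<rparr>"

definition quotient_field_module :: "('a, 'c) ring_scheme \<Rightarrow> ('a, ('a \<times> 'a) set) module" where
  "quotient_field_module R =
     \<lparr> carrier = carrier (quotient_field R), monoid.mult = undefined, monoid.one = undefined,
       ring.zero = \<zero>\<^bsub>quotient_field R\<^esub>, ring.add = add (quotient_field R),
       smult = (\<lambda>r U. to_quotient_field R r \<otimes>\<^bsub>quotient_field R\<^esub> U) \<rparr>"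

definition direct_sum_copies ::
    "'i set \<Rightarrow> ('a, 'n, 'd) module_scheme \<Rightarrow> ('a, 'i \<Rightarrow> 'n) module" where
  "direct_sum_copies I N =
     \<lparr> carrier = {f \<in> I \<rightarrow>\<^sub>E carrier N. finite {i \<in> I. f i \<noteq> \<zero>\<^bsub>N\<^esub>}}, monoid.mult = undefined, monoid.one = undefined,
       ring.zero = (\<lambda>i\<in>I. \<zero>\<^bsub>N\<^esub>), ring.add = (\<lambda>f g. \<lambda>i\<in>I. f i \<oplus>\<^bsub>N\<^esub> g i),
       smult = (\<lambda>r f. \<lambda>i\<in>I. r \<odot>\<^bsub>N\<^esub> f i) \<rparr>"

end

theory Submission
  imports Defs
begin

text \<open>
  For a prime \<open>p\<close>, the submodule \<open>p M\<close> lies above a summand \<open>D\<close> of \<open>M\<close>, and because \<open>R\<close> has a second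
  maximal ideal every complement of \<open>D\<close> is torsion. Applying the hypothesis to the sum of all torsion
  images of endomorphisms then splits off the torsion part with a divisible complement \<open>L\<close>, and a
  torsion-free divisible module is a vector space over \<open>K\<close>.

  Conversely, if \<open>M = T(M) \<oplus> L\<close>, a sum of images of endomorphisms of \<open>M\<close> is the sum of a torsion-free
  divisible module, which is a summand because divisible modules are injective, and a sum of images of
  endomorphisms of \<open>T(M)\<close>.

  The reduction from \<open>T(M)\<close> to its primary parts is local: an element lies in a submodule iff for each
  prime \<open>p\<close> some multiple by an \<open>s \<notin> p\<close> does, and every torsion element has such a multiple in
  \<open>T\<^sub>p(M)\<close>, on which elements outside \<open>p\<close> act bijectively; so \<open>R\<close> and \<open>R\<^sub>p\<close> give the same
  submodules and homomorphisms.
\<close>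


section \<open>Submodules\<close>

text \<open>Non-locality acts as follows. Taking \<open>t\<close> in a second maximal ideal
  \<open>q\<close>, a \<open>y\<close> from the complement satisfies \<open>(1 - r t) y = 0\<close>,
  and \<open>1 - r t\<close> is nonzero because \<open>r t\<close> lies in \<open>q\<close>.

  Integral closedness enters at one point only, the uniformizer at a nonzero prime. Ideals are never
  factored into primes: the chain condition yields ideals maximal with some property, and these turn
  out to be prime. Statements at a prime \<open>p\<close> are phrased through multiples by elements
  outside \<open>p\<close>.

  In the converse direction the obstacle is that the divisible part of a sum of images may itself
  contain torsion. It has to be split: its torsion part is handed over to \<open>T(M)\<close>, and
  its torsion-free part needs a complement that contains \<open>T(M)\<close>. For this reason
  complements of divisible submodules are built above a prescribed submodule.\<close>

context module begin

abbreviation sub :: "'c set \<Rightarrow> bool" where "sub U \<equiv> submodule U R M"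

lemma sub_carrier: "sub U \<Longrightarrow> x \<in> U \<Longrightarrow> x \<in> carrier M"
  using submoduleE(1) by blast

lemma sub_zero: "sub U \<Longrightarrow> \<zero>\<^bsub>M\<^esub> \<in> U"
  using submodule.axioms(1) subgroup.one_closed by fastforce

lemmas sub_add = submoduleE(5) and sub_smult = submoduleE(4) and sub_neg = submoduleE(3)

lemma sub_cancel:
  assumes "sub U" "u \<in> U" "x \<in> carrier M" "u \<oplus>\<^bsub>M\<^esub> x \<in> U"
  shows "x \<in> U"
proof -
  have "\<ominus>\<^bsub>M\<^esub> u \<oplus>\<^bsub>M\<^esub> (u \<oplus>\<^bsub>M\<^esub> x) = x"
    using assms sub_carrier by (simp add: M.r_neg1)
  then show ?thesis using assms sub_add sub_neg by metis
qed

lemma sub_zero_singleton: "sub {\<zero>\<^bsub>M\<^esub>}"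
  by (rule submoduleI) auto

lemma mem_set_add: "x \<in> A <+>\<^bsub>M\<^esub> B \<longleftrightarrow> (\<exists>a\<in>A. \<exists>b\<in>B. x = a \<oplus>\<^bsub>M\<^esub> b)"
  unfolding set_add_def' by auto

lemma sub_sum: assumes "sub A" "sub B" shows "sub (A <+>\<^bsub>M\<^esub> B)"
proof (rule submoduleI)
  note c = sub_carrier[OF assms(1)] sub_carrier[OF assms(2)]
  show "A <+>\<^bsub>M\<^esub> B \<subseteq> carrier M" using c by (auto simp: mem_set_add)
  show "\<zero>\<^bsub>M\<^esub> \<in> A <+>\<^bsub>M\<^esub> B" unfolding mem_set_add
    using sub_zero assms by (metis M.l_zero M.zero_closed)
  fix x assume "x \<in> A <+>\<^bsub>M\<^esub> B"
  then obtain a b where x: "a \<in> A" "b \<in> B" "x = a \<oplus>\<^bsub>M\<^esub> b" unfolding mem_set_add by auto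
  then have "\<ominus>\<^bsub>M\<^esub> x = \<ominus>\<^bsub>M\<^esub> a \<oplus>\<^bsub>M\<^esub> \<ominus>\<^bsub>M\<^esub> b" using c by (simp add: M.minus_add)
  then show "\<ominus>\<^bsub>M\<^esub> x \<in> A <+>\<^bsub>M\<^esub> B" unfolding mem_set_add using x sub_neg assms by blast
  { fix r assume "r \<in> carrier R"
    then have "r \<odot>\<^bsub>M\<^esub> x = r \<odot>\<^bsub>M\<^esub> a \<oplus>\<^bsub>M\<^esub> r \<odot>\<^bsub>M\<^esub> b" using x c by (simp add: smult_r_distr)
    then show "r \<odot>\<^bsub>M\<^esub> x \<in> A <+>\<^bsub>M\<^esub> B" unfolding mem_set_add
      using x sub_smult assms \<open>r \<in> carrier R\<close> by blast }
  fix y assume "y \<in> A <+>\<^bsub>M\<^esub> B"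
  then obtain a' b' where y: "a' \<in> A" "b' \<in> B" "y = a' \<oplus>\<^bsub>M\<^esub> b'" unfolding mem_set_add by auto
  have "x \<oplus>\<^bsub>M\<^esub> y = (a \<oplus>\<^bsub>M\<^esub> a') \<oplus>\<^bsub>M\<^esub> (b \<oplus>\<^bsub>M\<^esub> b')"
    using x y c by (simp add: M.a_ac)
  then show "x \<oplus>\<^bsub>M\<^esub> y \<in> A <+>\<^bsub>M\<^esub> B" unfolding mem_set_add using x y sub_add assms by blast
qed

lemma sum_upper1: "sub A \<Longrightarrow> sub B \<Longrightarrow> A \<subseteq> A <+>\<^bsub>M\<^esub> B"
  unfolding mem_set_add subset_eq by (metis sub_zero sub_carrier M.r_zero)

lemma sum_upper2: "sub A \<Longrightarrow> sub B \<Longrightarrow> B \<subseteq> A <+>\<^bsub>M\<^esub> B"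
  unfolding mem_set_add subset_eq by (metis sub_zero sub_carrier M.l_zero)

lemma sum_least: "sub C \<Longrightarrow> A \<subseteq> C \<Longrightarrow> B \<subseteq> C \<Longrightarrow> A <+>\<^bsub>M\<^esub> B \<subseteq> C"
  by (auto simp: mem_set_add sub_add subset_eq)

lemma sum_mono: "A \<subseteq> A' \<Longrightarrow> B \<subseteq> B' \<Longrightarrow> A <+>\<^bsub>M\<^esub> B \<subseteq> A' <+>\<^bsub>M\<^esub> B'"
  by (rule subsetI, simp add: mem_set_add) blast

lemma sub_inter: "sub A \<Longrightarrow> sub B \<Longrightarrow> sub (A \<inter> B)"
  by (rule submoduleI) (auto simp: sub_zero sub_add sub_smult sub_neg sub_carrier)

text \<open>Half of the modular law. If an element of \<open>C\<close> splits along \<open>A\<close>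
  and \<open>B\<close>, its \<open>B\<close>-part lies in \<open>C\<close> because its
  \<open>A\<close>-part does. This cuts a complement in \<open>M\<close> down to one inside
  \<open>C\<close>.\<close>

lemma sum_modular:
  assumes "sub A" "sub B" "sub C" "A \<subseteq> C"
  shows "C \<inter> (A <+>\<^bsub>M\<^esub> B) \<subseteq> A <+>\<^bsub>M\<^esub> (C \<inter> B)"
proof
  fix x assume x: "x \<in> C \<inter> (A <+>\<^bsub>M\<^esub> B)"
  then obtain a b where ab: "a \<in> A" "b \<in> B" "x = a \<oplus>\<^bsub>M\<^esub> b" by (auto simp: mem_set_add)
  then have "b \<in> C" using sub_cancel[OF assms(3)] x assms sub_carrier by blast
  then show "x \<in> A <+>\<^bsub>M\<^esub> (C \<inter> B)" unfolding mem_set_add using ab by blast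
qed

lemma sub_cyclic: assumes "x \<in> carrier M" shows "sub ((\<lambda>r. r \<odot>\<^bsub>M\<^esub> x) ` carrier R)"
proof (rule submoduleI)
  show "\<zero>\<^bsub>M\<^esub> \<in> (\<lambda>r. r \<odot>\<^bsub>M\<^esub> x) ` carrier R"
    using assms smult_l_null R.zero_closed by (metis imageI)
next
  fix a assume "a \<in> (\<lambda>r. r \<odot>\<^bsub>M\<^esub> x) ` carrier R"
  then show "\<ominus>\<^bsub>M\<^esub> a \<in> (\<lambda>r. r \<odot>\<^bsub>M\<^esub> x) ` carrier R"
    using assms smult_l_minus R.a_inv_closed by (smt (verit) image_iff)
next
  fix a b assume "a \<in> (\<lambda>r. r \<odot>\<^bsub>M\<^esub> x) ` carrier R" "b \<in> (\<lambda>r. r \<odot>\<^bsub>M\<^esub> x) ` carrier R"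
  then show "a \<oplus>\<^bsub>M\<^esub> b \<in> (\<lambda>r. r \<odot>\<^bsub>M\<^esub> x) ` carrier R"
    using assms smult_l_distr R.a_closed by (smt (verit) image_iff)
next
  fix a b assume "a \<in> carrier R" "b \<in> (\<lambda>r. r \<odot>\<^bsub>M\<^esub> x) ` carrier R"
  then show "a \<odot>\<^bsub>M\<^esub> b \<in> (\<lambda>r. r \<odot>\<^bsub>M\<^esub> x) ` carrier R"
    using assms smult_assoc1 R.m_closed by (smt (verit) image_iff)
qed (use assms in auto)

lemma mem_cyclic: "x \<in> carrier M \<Longrightarrow> x \<in> (\<lambda>r. r \<odot>\<^bsub>M\<^esub> x) ` carrier R"
  by (metis R.one_closed image_eqI smult_one)

lemma sub_scale: assumes "sub U" "r \<in> carrier R" shows "sub ((\<lambda>x. r \<odot>\<^bsub>M\<^esub> x) ` U)"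
proof (rule submoduleI)
  note c = sub_carrier[OF assms(1)]
  show "\<zero>\<^bsub>M\<^esub> \<in> (\<lambda>x. r \<odot>\<^bsub>M\<^esub> x) ` U"
    using assms smult_r_null sub_zero by (metis imageI)
  fix a assume a: "a \<in> (\<lambda>x. r \<odot>\<^bsub>M\<^esub> x) ` U"
  then obtain a' where a': "a' \<in> U" "a = r \<odot>\<^bsub>M\<^esub> a'" by auto
  show "\<ominus>\<^bsub>M\<^esub> a \<in> (\<lambda>x. r \<odot>\<^bsub>M\<^esub> x) ` U"
    using a' assms smult_r_minus c sub_neg by (metis imageI)
  { fix b assume "b \<in> (\<lambda>x. r \<odot>\<^bsub>M\<^esub> x) ` U"
    then obtain b' where "b' \<in> U" "b = r \<odot>\<^bsub>M\<^esub> b'" by auto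
    then show "a \<oplus>\<^bsub>M\<^esub> b \<in> (\<lambda>x. r \<odot>\<^bsub>M\<^esub> x) ` U"
      using a' assms smult_r_distr c sub_add by (metis imageI) }
  fix s assume s: "s \<in> carrier R"
  have "s \<odot>\<^bsub>M\<^esub> a = r \<odot>\<^bsub>M\<^esub> (s \<odot>\<^bsub>M\<^esub> a')"
    using a' assms s c by (metis R.m_comm smult_assoc1)
  then show "s \<odot>\<^bsub>M\<^esub> a \<in> (\<lambda>x. r \<odot>\<^bsub>M\<^esub> x) ` U"
    using a' assms s sub_smult by (metis imageI)
qed (use assms sub_carrier in auto)

text \<open>An intersection instead of linear combinations: inclusions of a span are checked on
  generators, without handling coefficients.\<close>

definition spanned :: "'c set \<Rightarrow> 'c set" where
  "spanned G = \<Inter> {U. sub U \<and> G \<subseteq> U}"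

lemma spanned_sub: assumes "G \<subseteq> carrier M" shows "sub (spanned G)"
proof -
  have "spanned G \<subseteq> carrier M" unfolding spanned_def using assms carrier_is_submodule by blast
  then show ?thesis
    by (intro submoduleI) (auto simp: spanned_def sub_zero sub_add sub_smult sub_neg)
qed

lemma spanned_upper: "G \<subseteq> spanned G" unfolding spanned_def by auto

lemma spanned_least: "sub U \<Longrightarrow> G \<subseteq> U \<Longrightarrow> spanned G \<subseteq> U" unfolding spanned_def by auto

text \<open>Membership of the multiples of \<open>x\<close> in \<open>U\<close> becomes a question
  about an ideal, so that maximal ideals, primes and the chain condition of \<open>R\<close> can be
  applied to \<open>M\<close>.\<close>

lemma colon_ideal: assumes "sub U" "x \<in> carrier M"
  shows "ideal {r \<in> carrier R. r \<odot>\<^bsub>M\<^esub> x \<in> U} R"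
proof (rule idealI)
  show "ring R" by (rule R.ring_axioms)
  have *: "\<ominus> r \<in> carrier R \<and> (\<ominus> r) \<odot>\<^bsub>M\<^esub> x \<in> U" if "r \<in> carrier R" "r \<odot>\<^bsub>M\<^esub> x \<in> U" for r
    using that assms by (simp add: smult_l_minus sub_neg)
  show "subgroup {r \<in> carrier R. r \<odot>\<^bsub>M\<^esub> x \<in> U} (add_monoid R)"
    using assms * by unfold_locales
      (auto simp: smult_l_distr sub_zero sub_add R.minus_minus a_inv_def[symmetric] intro: R.a_assoc)
  fix a b assume "a \<in> {r \<in> carrier R. r \<odot>\<^bsub>M\<^esub> x \<in> U}" "b \<in> carrier R"
  then show "b \<otimes> a \<in> {r \<in> carrier R. r \<odot>\<^bsub>M\<^esub> x \<in> U}" 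
    using assms by (auto simp: smult_assoc1 sub_smult)
  then show "a \<otimes> b \<in> {r \<in> carrier R. r \<odot>\<^bsub>M\<^esub> x \<in> U}" 
    using \<open>a \<in> _\<close> \<open>b \<in> _\<close> R.m_comm[of a b] by simp
qed

lemma sub_Union_chain:
  assumes "C \<noteq> {}" "\<And>U. U \<in> C \<Longrightarrow> sub U" "\<And>U V. U \<in> C \<Longrightarrow> V \<in> C \<Longrightarrow> U \<subseteq> V \<or> V \<subseteq> U"
  shows "sub (\<Union>C)"
proof (rule submoduleI)
  show "\<Union>C \<subseteq> carrier M" using assms(2) sub_carrier by blast
  show "\<zero>\<^bsub>M\<^esub> \<in> \<Union>C" using assms sub_zero by blast
  show "\<ominus>\<^bsub>M\<^esub> a \<in> \<Union>C" if "a \<in> \<Union>C" for a using that assms(2) sub_neg by blast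
  show "a \<oplus>\<^bsub>M\<^esub> b \<in> \<Union>C" if "a \<in> \<Union>C" "b \<in> \<Union>C" for a b
  proof -
    from that obtain U V where UV: "U \<in> C" "V \<in> C" "a \<in> U" "b \<in> V" by blast
    then consider "U \<subseteq> V" | "V \<subseteq> U" using assms(3) by blast
    then show ?thesis using UV assms(2) sub_add by cases (blast intro: UnionI)+
  qed
  show "r \<odot>\<^bsub>M\<^esub> b \<in> \<Union>C" if "r \<in> carrier R" "b \<in> \<Union>C" for r b using that assms(2) sub_smult by blast
qed

text \<open>Zorn's lemma for submodules. With \<open>G\<close> the nonzero part of a submodule it
  yields a candidate for a complement; with \<open>G = {y}\<close> it yields a submodule maximal
  without \<open>y\<close>.\<close>

lemma maximal_avoiding:
  assumes "sub Y" "Y \<inter> G = {}"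
  shows "\<exists>W. sub W \<and> Y \<subseteq> W \<and> W \<inter> G = {} \<and> (\<forall>W'. sub W' \<and> W \<subseteq> W' \<and> W' \<inter> G = {} \<longrightarrow> W' = W)"
proof -
  let ?A = "{W. sub W \<and> Y \<subseteq> W \<and> W \<inter> G = {}}"
  have "\<exists>W\<in>?A. \<forall>W'\<in>?A. W \<subseteq> W' \<longrightarrow> W' = W"
  proof (rule subset_Zorn_nonempty)
    show "?A \<noteq> {}" using assms by blast
    fix C assume C: "C \<noteq> {}" "subset.chain ?A C"
    have "sub (\<Union>C)"
      using C by (intro sub_Union_chain) (auto simp: subset_chain_def)
    moreover have "Y \<subseteq> \<Union>C \<and> \<Union>C \<inter> G = {}"
    proof -
      have "Y \<subseteq> U \<and> U \<inter> G = {}" if "U \<in> C" for U using C(2) that unfolding subset_chain_def by blast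
      then show ?thesis using C(1) by blast
    qed
    ultimately show "\<Union>C \<in> ?A" by blast
  qed
  then obtain W where W: "W \<in> ?A" "\<forall>W'\<in>?A. W \<subseteq> W' \<longrightarrow> W' = W" by (elim bexE)
  then have *: "W' = W" if "sub W'" "W \<subseteq> W'" "W' \<inter> G = {}" for W'
    using that by (metis (mono_tags, lifting) mem_Collect_eq order_trans)
  show ?thesis by (rule exI[of _ W]) (use W(1) * in simp)
qed

subsection \<open>Direct sums and endomorphisms\<close>

abbreviation dsum :: "'c set \<Rightarrow> 'c set \<Rightarrow> bool" where "dsum \<equiv> direct_sum_decomposition R M"

lemma dsumD:
  assumes "dsum A B"
  shows "sub A" "sub B" "A \<inter> B = {\<zero>\<^bsub>M\<^esub>}" "A <+>\<^bsub>M\<^esub> B = carrier M"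
  using assms unfolding direct_sum_decomposition_def by auto

lemma dsumI:
  assumes "sub A" "sub B" "\<And>x. x \<in> A \<Longrightarrow> x \<in> B \<Longrightarrow> x = \<zero>\<^bsub>M\<^esub>" "\<And>x. x \<in> carrier M \<Longrightarrow> x \<in> A <+>\<^bsub>M\<^esub> B"
  shows "dsum A B"
  unfolding direct_sum_decomposition_def
  using assms sub_zero submoduleE(1)[OF sub_sum] by blast

lemma sum_comm: "sub A \<Longrightarrow> sub B \<Longrightarrow> A <+>\<^bsub>M\<^esub> B = B <+>\<^bsub>M\<^esub> A"
  unfolding set_eq_iff mem_set_add by (metis M.a_comm sub_carrier)

lemma dsum_sym: "dsum A B \<Longrightarrow> dsum B A"
  unfolding direct_sum_decomposition_def using sum_comm by auto

lemma decomposition_unique: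
  assumes "sub A" "sub B" "A \<inter> B = {\<zero>\<^bsub>M\<^esub>}" "a \<in> A" "a' \<in> A" "b \<in> B" "b' \<in> B" "a \<oplus>\<^bsub>M\<^esub> b = a' \<oplus>\<^bsub>M\<^esub> b'"
  shows "a = a'" "b = b'"
proof -
  note c = sub_carrier[OF assms(1)] sub_carrier[OF assms(2)]
  have "\<ominus>\<^bsub>M\<^esub> a' \<oplus>\<^bsub>M\<^esub> a = b' \<oplus>\<^bsub>M\<^esub> \<ominus>\<^bsub>M\<^esub> b"
  proof -
    have "b' = \<ominus>\<^bsub>M\<^esub> a' \<oplus>\<^bsub>M\<^esub> (a' \<oplus>\<^bsub>M\<^esub> b')" using assms(4-7) c by (simp add: M.r_neg1)
    also have "\<dots> = \<ominus>\<^bsub>M\<^esub> a' \<oplus>\<^bsub>M\<^esub> a \<oplus>\<^bsub>M\<^esub> b"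
      unfolding assms(8)[symmetric] using assms(4-7) c by (simp add: M.a_assoc)
    finally have "b' \<oplus>\<^bsub>M\<^esub> \<ominus>\<^bsub>M\<^esub> b = (\<ominus>\<^bsub>M\<^esub> a' \<oplus>\<^bsub>M\<^esub> a \<oplus>\<^bsub>M\<^esub> b) \<oplus>\<^bsub>M\<^esub> \<ominus>\<^bsub>M\<^esub> b" by simp
    also have "\<dots> = \<ominus>\<^bsub>M\<^esub> a' \<oplus>\<^bsub>M\<^esub> a" using assms(4-7) c by (simp add: M.a_assoc M.r_neg)
    finally show ?thesis ..
  qed
  moreover have "\<ominus>\<^bsub>M\<^esub> a' \<oplus>\<^bsub>M\<^esub> a \<in> A" "b' \<oplus>\<^bsub>M\<^esub> \<ominus>\<^bsub>M\<^esub> b \<in> B"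
    using assms sub_add sub_neg by auto
  ultimately have "\<ominus>\<^bsub>M\<^esub> a' \<oplus>\<^bsub>M\<^esub> a = \<zero>\<^bsub>M\<^esub>" using assms(3) by auto
  then have "\<ominus>\<^bsub>M\<^esub> a = \<ominus>\<^bsub>M\<^esub> a'" using assms(4,5) c by (simp add: M.minus_equality)
  then show "a = a'" using assms(4,5) c M.minus_minus by metis
  then show "b = b'" using assms c by (metis M.add.l_cancel)
qed

abbreviation End :: "('c \<Rightarrow> 'c) set" where "End \<equiv> module_hom R M M"

lemma module_homD:
  assumes "f \<in> module_hom R M N"
  shows "x \<in> carrier M \<Longrightarrow> f x \<in> carrier N"
    "x \<in> carrier M \<Longrightarrow> y \<in> carrier M \<Longrightarrow> f (x \<oplus>\<^bsub>M\<^esub> y) = f x \<oplus>\<^bsub>N\<^esub> f y"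
    "r \<in> carrier R \<Longrightarrow> x \<in> carrier M \<Longrightarrow> f (r \<odot>\<^bsub>M\<^esub> x) = r \<odot>\<^bsub>N\<^esub> f x"
  using assms unfolding module_hom_def hom_def by auto

lemma module_homI:
  assumes "\<And>x. x \<in> carrier M \<Longrightarrow> f x \<in> carrier N"
    "\<And>x y. x \<in> carrier M \<Longrightarrow> y \<in> carrier M \<Longrightarrow> f (x \<oplus>\<^bsub>M\<^esub> y) = f x \<oplus>\<^bsub>N\<^esub> f y"
    "\<And>r x. r \<in> carrier R \<Longrightarrow> x \<in> carrier M \<Longrightarrow> f (r \<odot>\<^bsub>M\<^esub> x) = r \<odot>\<^bsub>N\<^esub> f x"
  shows "f \<in> module_hom R M N"
  using assms unfolding module_hom_def hom_def by auto

lemma hom_zero: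
  assumes "module R N" "f \<in> module_hom R M N" shows "f \<zero>\<^bsub>M\<^esub> = \<zero>\<^bsub>N\<^esub>"
proof -
  interpret N: module R N by fact
  have "f (\<zero> \<odot>\<^bsub>M\<^esub> \<zero>\<^bsub>M\<^esub>) = \<zero> \<odot>\<^bsub>N\<^esub> f \<zero>\<^bsub>M\<^esub>" by (rule module_homD(3)[OF assms(2)]) simp_all
  then show ?thesis using module_homD(1)[OF assms(2)] by simp
qed

lemma hom_neg:
  assumes "module R N" "f \<in> module_hom R M N" "x \<in> carrier M"
  shows "f (\<ominus>\<^bsub>M\<^esub> x) = \<ominus>\<^bsub>N\<^esub> f x"
proof -
  interpret N: module R N by fact
  have "f ((\<ominus> \<one>) \<odot>\<^bsub>M\<^esub> x) = (\<ominus> \<one>) \<odot>\<^bsub>N\<^esub> f x" by (rule module_homD(3)[OF assms(2)]) (simp_all add: assms(3))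
  then show ?thesis
    using module_homD(1)[OF assms(2,3)] assms(3) by (simp add: smult_l_minus N.smult_l_minus)
qed

lemma hom_image_sub:
  assumes N: "module R N" and f: "f \<in> module_hom R M N" and U: "sub U"
  shows "submodule (f ` U) R N"
proof -
  interpret N: module R N by fact
  note c = sub_carrier[OF U] and h = module_homD[OF f]
  show ?thesis
  proof (rule N.submoduleI)
    show "f ` U \<subseteq> carrier N" using c h by auto
    show "\<zero>\<^bsub>N\<^esub> \<in> f ` U" using imageI[OF sub_zero[OF U], of f] hom_zero[OF N f] by simp
    fix a assume a: "a \<in> f ` U"
    then obtain a' where a': "a' \<in> U" "a = f a'" by auto
    show "\<ominus>\<^bsub>N\<^esub> a \<in> f ` U" using imageI[OF sub_neg[OF U a'(1)], of f] hom_neg[OF N f c[OF a'(1)]] a'(2) by simp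
    { fix b assume "b \<in> f ` U"
      then obtain b' where b': "b' \<in> U" "b = f b'" by auto
      show "a \<oplus>\<^bsub>N\<^esub> b \<in> f ` U"
        using imageI[OF sub_add[OF U a'(1) b'(1)], of f] h(2)[OF c[OF a'(1)] c[OF b'(1)]] a'(2) b'(2) by simp }
    fix s assume s: "s \<in> carrier R"
    show "s \<odot>\<^bsub>N\<^esub> a \<in> f ` U" using imageI[OF sub_smult[OF U s a'(1)], of f] h(3)[OF s c[OF a'(1)]] a'(2) by simp
  qed
qed

lemma hom_preimage_sub:
  assumes N: "module R N" and f: "f \<in> module_hom R M N" and U: "submodule U R N"
  shows "sub {x \<in> carrier M. f x \<in> U}"
proof -
  interpret N: module R N by fact
  show ?thesis
    by (rule submoduleI)
      (auto simp: hom_zero[OF N f] hom_neg[OF N f] module_homD[OF f]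
        N.sub_zero[OF U] N.sub_add[OF U] N.sub_smult[OF U] N.sub_neg[OF U])
qed

lemmas End_zero = hom_zero[OF module_axioms] and End_neg = hom_neg[OF module_axioms]
  and image_sub = hom_image_sub[OF module_axioms] and preimage_sub = hom_preimage_sub[OF module_axioms]

lemma scale_End: "r \<in> carrier R \<Longrightarrow> (\<lambda>x. r \<odot>\<^bsub>M\<^esub> x) \<in> End"
proof (rule module_homI)
  fix s x assume "r \<in> carrier R" "s \<in> carrier R" "x \<in> carrier M"
  then show "r \<odot>\<^bsub>M\<^esub> (s \<odot>\<^bsub>M\<^esub> x) = s \<odot>\<^bsub>M\<^esub> (r \<odot>\<^bsub>M\<^esub> x)" by (metis R.m_comm smult_assoc1)
qed (auto simp: smult_r_distr)

text \<open>This makes every summand the image of an endomorphism, the link between direct summands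
  and sums of images.\<close>

lemma projection:
  assumes "dsum A B"
  obtains p where "p \<in> End" "\<And>x. x \<in> A \<Longrightarrow> p x = x" "\<And>x. x \<in> B \<Longrightarrow> p x = \<zero>\<^bsub>M\<^esub>"
    "\<And>x. x \<in> carrier M \<Longrightarrow> p x \<in> A" "p ` carrier M = A"
proof -
  note d = dsumD[OF assms]
  note c = sub_carrier[OF d(1)] sub_carrier[OF d(2)]
  define p where "p x = (THE a. a \<in> A \<and> (\<exists>b\<in>B. x = a \<oplus>\<^bsub>M\<^esub> b))" for x
  have p: "p (a \<oplus>\<^bsub>M\<^esub> b) = a" if "a \<in> A" "b \<in> B" for a b
    unfolding p_def using that decomposition_unique[OF d(1-3)] by (intro the_equality) blast+
  have ex: "\<exists>a\<in>A. \<exists>b\<in>B. x = a \<oplus>\<^bsub>M\<^esub> b" if "x \<in> carrier M" for x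
    using that d(4) mem_set_add by blast
  have pA: "p x = x" if "x \<in> A" for x using p[OF that sub_zero[OF d(2)]] c that by simp
  have pB: "p x = \<zero>\<^bsub>M\<^esub>" if "x \<in> B" for x using p[OF sub_zero[OF d(1)] that] c that by simp
  have pc: "p x \<in> A" if "x \<in> carrier M" for x using ex[OF that] p by auto
  have "p \<in> End"
  proof (rule module_homI)
    show "p x \<in> carrier M" if "x \<in> carrier M" for x using pc[OF that] c by auto
    fix x assume "x \<in> carrier M"
    then obtain a b where x: "a \<in> A" "b \<in> B" "x = a \<oplus>\<^bsub>M\<^esub> b" using ex by blast
    { fix y assume "y \<in> carrier M"
      then obtain a' b' where y: "a' \<in> A" "b' \<in> B" "y = a' \<oplus>\<^bsub>M\<^esub> b'" using ex by blast
      have "x \<oplus>\<^bsub>M\<^esub> y = (a \<oplus>\<^bsub>M\<^esub> a') \<oplus>\<^bsub>M\<^esub> (b \<oplus>\<^bsub>M\<^esub> b')" using x y c by (simp add: M.a_ac)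
      then show "p (x \<oplus>\<^bsub>M\<^esub> y) = p x \<oplus>\<^bsub>M\<^esub> p y"
        using x y p[OF sub_add[OF d(1)] sub_add[OF d(2)]] p by simp }
    fix r assume r: "r \<in> carrier R"
    then have "r \<odot>\<^bsub>M\<^esub> x = r \<odot>\<^bsub>M\<^esub> a \<oplus>\<^bsub>M\<^esub> r \<odot>\<^bsub>M\<^esub> b" using x c by (simp add: smult_r_distr)
    then show "p (r \<odot>\<^bsub>M\<^esub> x) = r \<odot>\<^bsub>M\<^esub> p x"
      using x r p[OF sub_smult[OF d(1)] sub_smult[OF d(2)]] p by simp
  qed
  moreover have "p ` carrier M = A" using pc pA c by force
  ultimately show thesis using that pA pB pc by blast
qed

end

lemma submodule_restrict:
  assumes "module R M" "submodule T R M"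
  shows "submodule A R (M\<lparr>carrier := T\<rparr>) \<longleftrightarrow> submodule A R M \<and> A \<subseteq> T"
proof -
  interpret module R M by fact
  interpret T: module R "M\<lparr>carrier := T\<rparr>"
    using submodule.submodule_is_module[OF assms(2,1)] .
  \<comment> \<open>\<open>a_inv\<close> is described through the carrier, so restricting the
    carrier might change it; both versions are negatives for the same addition and agree on
    \<open>T\<close>.\<close>
  have n: "a_inv (M\<lparr>carrier := T\<rparr>) x = \<ominus>\<^bsub>M\<^esub> x" if "x \<in> T" for x
    using that assms(2) T.sub_carrier T.M.l_neg[of x] T.M.a_inv_closed[of x]
    by (auto intro!: M.minus_equality[symmetric] dest: sub_carrier)
  show ?thesis
  proof (intro iffI conjI)
    assume A: "submodule A R (M\<lparr>carrier := T\<rparr>)"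
    show AT: "A \<subseteq> T" using T.submoduleE(1)[OF A] by simp
    show "submodule A R M"
      using AT T.sub_zero[OF A] T.sub_neg[OF A] T.sub_add[OF A] T.sub_smult[OF A] n sub_carrier[OF assms(2)]
      by (intro submoduleI) (auto simp: subset_eq)
  next
    assume A: "submodule A R M \<and> A \<subseteq> T"
    then show "submodule A R (M\<lparr>carrier := T\<rparr>)"
      using A sub_zero sub_neg sub_add sub_smult n
      by (intro T.submoduleI) (auto simp: subset_eq)
  qed
qed


section \<open>Localizations of a domain\<close>

text \<open>One setting for the quotient field and for the localization at a prime. In a domain the
  elements of \<open>S\<close> can be cancelled, so the extra factor in \<open>fraction_rel\<close>
  disappears and equality of fractions is cross-multiplication.\<close>

locale domain_localization = domain R for R (structure) +
  fixes S
  assumes S_carrier: "S \<subseteq> carrier R" and S_nonzero: "\<zero> \<notin> S" and S_one: "\<one> \<in> S"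
    and S_mult: "s \<in> S \<Longrightarrow> t \<in> S \<Longrightarrow> s \<otimes> t \<in> S"
begin

abbreviation "Q \<equiv> localization R S"
abbreviation "frc \<equiv> fraction R S"

lemma S_in_carrier: "s \<in> S \<Longrightarrow> s \<in> carrier R" using S_carrier by auto

lemma cancel_S: "s \<in> S \<Longrightarrow> a \<in> carrier R \<Longrightarrow> b \<in> carrier R \<Longrightarrow> s \<otimes> a = s \<otimes> b \<longleftrightarrow> a = b"
  using m_lcancel S_nonzero S_in_carrier by metis

lemma mem_fraction_rel: "((a, s), (b, t)) \<in> fraction_rel R S \<longleftrightarrow>
   a \<in> carrier R \<and> b \<in> carrier R \<and> s \<in> S \<and> t \<in> S \<and> t \<otimes> a = s \<otimes> b"
  unfolding fraction_rel_def using S_one cancel_S[of _ "t \<otimes> a" "s \<otimes> b"] by (auto simp: S_in_carrier)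

lemma mem_fraction: "(b, t) \<in> frc a s \<longleftrightarrow>
   a \<in> carrier R \<and> b \<in> carrier R \<and> s \<in> S \<and> t \<in> S \<and> t \<otimes> a = s \<otimes> b"
  unfolding fraction_def using mem_fraction_rel by auto

lemma fraction_cross_trans:
  assumes "a \<in> carrier R" "b \<in> carrier R" "c \<in> carrier R" "s \<in> S" "t \<in> S" "u \<in> S"
    "t \<otimes> a = s \<otimes> b" "u \<otimes> b = t \<otimes> c"
  shows "u \<otimes> a = s \<otimes> c"
proof -
  have "t \<otimes> (u \<otimes> a) = u \<otimes> (t \<otimes> a)" using assms(1-6) S_in_carrier by (simp add: m_ac)
  also have "\<dots> = s \<otimes> (u \<otimes> b)" unfolding assms(7) using assms(1-6) S_in_carrier by (simp add: m_ac)
  also have "\<dots> = t \<otimes> (s \<otimes> c)" unfolding assms(8) using assms(1-6) S_in_carrier by (simp add: m_ac)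
  finally show ?thesis using cancel_S assms(1-6) S_in_carrier by auto
qed

lemma fraction_eq:
  assumes "a \<in> carrier R" "s \<in> S" "b \<in> carrier R" "t \<in> S"
  shows "frc a s = frc b t \<longleftrightarrow> t \<otimes> a = s \<otimes> b"
proof
  assume "frc a s = frc b t"
  moreover have "(b, t) \<in> frc b t" using assms mem_fraction by auto
  ultimately have "(b, t) \<in> frc a s" by simp
  then show "t \<otimes> a = s \<otimes> b" unfolding mem_fraction by simp
next
  assume e: "t \<otimes> a = s \<otimes> b"
  have "(c, u) \<in> frc a s \<longleftrightarrow> (c, u) \<in> frc b t" for c u
    unfolding mem_fraction
    using e assms fraction_cross_trans[of b a c t s u] fraction_cross_trans[of a b c s t u] by metis
  then show "frc a s = frc b t" by auto
qed

lemma carrier_Q: "carrier Q = {frc a s | a s. a \<in> carrier R \<and> s \<in> S}"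
  unfolding localization_def quotient_def fraction_def by auto

lemma frac_closed: "a \<in> carrier R \<Longrightarrow> s \<in> S \<Longrightarrow> frc a s \<in> carrier Q"
  unfolding carrier_Q by blast

lemma fracE:
  assumes "x \<in> carrier Q"
  obtains a s where "a \<in> carrier R" "s \<in> S" "x = frc a s"
  using assms unfolding carrier_Q by auto

lemma frac_mult:
  assumes "a \<in> carrier R" "s \<in> S" "b \<in> carrier R" "t \<in> S"
  shows "frc a s \<otimes>\<^bsub>Q\<^esub> frc b t = frc (a \<otimes> b) (s \<otimes> t)"
proof -
  have *: "frc (fst x \<otimes> fst y) (snd x \<otimes> snd y) = frc (a \<otimes> b) (s \<otimes> t)"
    if x: "x \<in> frc a s" and y: "y \<in> frc b t" for x y
  proof -
    obtain c u d v where xy: "x = (c, u)" "y = (d, v)" by fastforce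
    have h: "c \<in> carrier R" "u \<in> S" "d \<in> carrier R" "v \<in> S" "u \<otimes> a = s \<otimes> c" "v \<otimes> b = t \<otimes> d"
      using x y xy mem_fraction by auto
    have "(s \<otimes> t) \<otimes> (c \<otimes> d) = (s \<otimes> c) \<otimes> (t \<otimes> d)" using h(1-4) assms S_in_carrier by (simp add: m_ac)
    also have "\<dots> = (u \<otimes> v) \<otimes> (a \<otimes> b)" unfolding h(5,6)[symmetric]
      using h(1-4) assms S_in_carrier by (simp add: m_ac)
    finally show ?thesis using fraction_eq h(1-4) assms S_mult by (simp add: xy)
  qed
  have "(a, s) \<in> frc a s" "(b, t) \<in> frc b t" using assms mem_fraction by auto
  then show ?thesis unfolding localization_def using * by auto
qed

lemma frac_add:
  assumes "a \<in> carrier R" "s \<in> S" "b \<in> carrier R" "t \<in> S"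
  shows "frc a s \<oplus>\<^bsub>Q\<^esub> frc b t = frc (a \<otimes> t \<oplus> b \<otimes> s) (s \<otimes> t)"
proof -
  have *: "frc (fst x \<otimes> snd y \<oplus> fst y \<otimes> snd x) (snd x \<otimes> snd y) = frc (a \<otimes> t \<oplus> b \<otimes> s) (s \<otimes> t)"
    if x: "x \<in> frc a s" and y: "y \<in> frc b t" for x y
  proof -
    obtain c u d v where xy: "x = (c, u)" "y = (d, v)" by fastforce
    have h: "c \<in> carrier R" "u \<in> S" "d \<in> carrier R" "v \<in> S" "u \<otimes> a = s \<otimes> c" "v \<otimes> b = t \<otimes> d"
      using x y xy mem_fraction by auto
    have "(s \<otimes> t) \<otimes> (c \<otimes> v \<oplus> d \<otimes> u) = (s \<otimes> c) \<otimes> (t \<otimes> v) \<oplus> (t \<otimes> d) \<otimes> (s \<otimes> u)"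
      using h(1-4) assms S_in_carrier by (simp add: m_ac r_distr)
    also have "\<dots> = (u \<otimes> v) \<otimes> (a \<otimes> t \<oplus> b \<otimes> s)" unfolding h(5,6)[symmetric]
      using h(1-4) assms S_in_carrier by (simp add: m_ac r_distr)
    finally show ?thesis using fraction_eq h(1-4) assms S_mult S_in_carrier by (simp add: xy)
  qed
  have "(a, s) \<in> frc a s" "(b, t) \<in> frc b t" using assms mem_fraction by auto
  then show ?thesis unfolding localization_def using * by auto
qed

lemma Q_zero: "\<zero>\<^bsub>Q\<^esub> = frc \<zero> \<one>" and Q_one: "\<one>\<^bsub>Q\<^esub> = frc \<one> \<one>"
  unfolding localization_def by auto

lemma cring_Q: "cring Q"
proof (rule cringI)
  note [simp] = S_in_carrier S_mult S_one frac_add frac_mult frac_closed fraction_eq Q_zero Q_one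
  show "abelian_group Q"
  proof (rule abelian_groupI)
    fix x y z assume "x \<in> carrier Q" "y \<in> carrier Q" "z \<in> carrier Q"
    then obtain a s b t c u where "a \<in> carrier R" "s \<in> S" "x = frc a s"
      "b \<in> carrier R" "t \<in> S" "y = frc b t" "c \<in> carrier R" "u \<in> S" "z = frc c u"
      by (metis fracE)
    then show "x \<oplus>\<^bsub>Q\<^esub> y \<oplus>\<^bsub>Q\<^esub> z = x \<oplus>\<^bsub>Q\<^esub> (y \<oplus>\<^bsub>Q\<^esub> z)"
      by (simp add: m_ac l_distr r_distr a_ac)
  next
    fix x assume "x \<in> carrier Q"
    then obtain a s where x: "a \<in> carrier R" "s \<in> S" "x = frc a s" by (metis fracE)
    then show "\<zero>\<^bsub>Q\<^esub> \<oplus>\<^bsub>Q\<^esub> x = x" by (simp add: m_ac)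
    show "\<exists>y\<in>carrier Q. y \<oplus>\<^bsub>Q\<^esub> x = \<zero>\<^bsub>Q\<^esub>"
      by (rule bexI[of _ "frc (\<ominus> a) s"]) (use x in \<open>simp_all add: l_minus l_neg\<close>)
  qed (auto elim!: fracE simp: m_ac a_ac)
  show "comm_monoid Q"
  proof (rule comm_monoidI)
    fix x y z assume "x \<in> carrier Q" "y \<in> carrier Q" "z \<in> carrier Q"
    then obtain a s b t c u where "a \<in> carrier R" "s \<in> S" "x = frc a s"
      "b \<in> carrier R" "t \<in> S" "y = frc b t" "c \<in> carrier R" "u \<in> S" "z = frc c u"
      by (metis fracE)
    then show "x \<otimes>\<^bsub>Q\<^esub> y \<otimes>\<^bsub>Q\<^esub> z = x \<otimes>\<^bsub>Q\<^esub> (y \<otimes>\<^bsub>Q\<^esub> z)"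
      by (simp add: m_ac)
  qed (auto elim!: fracE simp: m_ac)
  fix x y z assume "x \<in> carrier Q" "y \<in> carrier Q" "z \<in> carrier Q"
  then obtain a s b t c u where "a \<in> carrier R" "s \<in> S" "x = frc a s"
    "b \<in> carrier R" "t \<in> S" "y = frc b t" "c \<in> carrier R" "u \<in> S" "z = frc c u"
    by (metis fracE)
  then show "(x \<oplus>\<^bsub>Q\<^esub> y) \<otimes>\<^bsub>Q\<^esub> z = x \<otimes>\<^bsub>Q\<^esub> z \<oplus>\<^bsub>Q\<^esub> y \<otimes>\<^bsub>Q\<^esub> z"
    by (simp add: m_ac l_distr r_distr)
qed

end

lemma (in domain) localization_quotient_field:
  "domain_localization R (carrier R - {\<zero>})"
  by unfold_locales (auto dest: integral)

lemma (in domain) localization_prime: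
  assumes "primeideal p R"
  shows "domain_localization R (carrier R - p)"
proof -
  interpret p: primeideal p R by fact
  show ?thesis
    by unfold_locales (use p.I_prime p.I_notcarr p.one_imp_carrier p.zero_closed in auto)
qed

section \<open>Noetherian rings\<close>

lemma (in noetherian_ring) ideal_maximal_element:
  assumes "A \<noteq> {}" "\<And>I. I \<in> A \<Longrightarrow> ideal I R"
  shows "\<exists>J\<in>A. \<forall>I\<in>A. J \<subseteq> I \<longrightarrow> I = J"
proof (rule subset_Zorn_nonempty[OF assms(1)])
  fix C assume C: "C \<noteq> {}" "subset.chain A C"
  then have "subset.chain {I. ideal I R} C" using assms(2) unfolding subset_chain_def by blast
  then have "\<Union>C \<in> C" using ideal_chain_is_trivial C(1) by blast
  then show "\<Union>C \<in> A" using C(2) unfolding subset_chain_def by blast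
qed

text \<open>The set of all \<open>J n\<close> has a maximal member, beyond which the chain cannot
  grow. A single repetition is all that the applications ask for.\<close>

lemma (in noetherian_ring) ideal_sequence_stationary:
  assumes "\<And>n::nat. ideal (J n) R" "\<And>n. J n \<subseteq> J (Suc n)"
  shows "\<exists>n. J (Suc n) = J n"
proof -
  have "\<exists>I\<in>range J. \<forall>I'\<in>range J. I \<subseteq> I' \<longrightarrow> I' = I"
    by (rule ideal_maximal_element) (use assms(1) in auto)
  then obtain n where "\<forall>I'\<in>range J. J n \<subseteq> I' \<longrightarrow> I' = J n" by blast
  then have "J (Suc n) = J n" using assms(2) by blast
  then show ?thesis ..
qed

context cring begin

lemma ring_colon_ideal: assumes "ideal H R" "z \<in> carrier R"
  shows "ideal {r \<in> carrier R. r \<otimes> z \<in> H} R"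
proof (rule idealI)
  interpret H: ideal H R by fact
  show "ring R" by (rule ring_axioms)
  have *: "\<ominus> r \<otimes> z \<in> H" if "r \<in> carrier R" "r \<otimes> z \<in> H" for r
    using that assms H.a_inv_closed by (simp add: l_minus)
  show "subgroup {r \<in> carrier R. r \<otimes> z \<in> H} (add_monoid R)"
    using assms * by unfold_locales
      (auto simp: l_distr a_inv_def[symmetric] a_assoc)
  fix a b assume "a \<in> {r \<in> carrier R. r \<otimes> z \<in> H}" "b \<in> carrier R"
  then show "b \<otimes> a \<in> {r \<in> carrier R. r \<otimes> z \<in> H}"
    using assms H.I_l_closed by (auto simp: m_assoc)
  then show "a \<otimes> b \<in> {r \<in> carrier R. r \<otimes> z \<in> H}"
    using \<open>a \<in> _\<close> \<open>b \<in> _\<close> m_comm[of a b] by simp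
qed

text \<open>As \<open>p\<close> is maximal and \<open>J\<close> is not inside it,
  \<open>p + J\<close> is the whole ring and contains one.\<close>

lemma coprime_split:
  assumes "maximalideal p R" "ideal J R" "\<not> J \<subseteq> p"
  obtains a b where "a \<in> p" "b \<in> J" "a \<oplus> b = \<one>"
proof -
  interpret p: maximalideal p R by fact
  interpret J: ideal J R by fact
  have "ideal (set_add R p J) R" using add_ideals p.ideal_axioms assms(2) by auto
  moreover have "x \<in> set_add R p J" if "x \<in> p" for x
    unfolding set_add_def' using that J.zero_closed r_zero[OF p.Icarr[OF that]] by (metis UN_I insertI1)
  moreover have "x \<in> set_add R p J" if "x \<in> J" for x
    unfolding set_add_def' using that p.zero_closed l_zero[OF J.Icarr[OF that]] by (metis UN_I insertI1)
  ultimately have "set_add R p J = carrier R"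
    using p.I_maximal[of "set_add R p J"] assms(3) ideal.Icarr[of "set_add R p J" R] by auto
  then have "\<one> \<in> set_add R p J" by auto
  then show thesis using that unfolding set_add_def' by auto
qed

end

text \<open>An associated prime of \<open>R / H\<close> below \<open>p\<close>. Among the
  annihilators \<open>c z\<close> of elements modulo \<open>H\<close> that lie in \<open>p\<close>,
  a maximal one is prime: whenever multiplying \<open>z\<close> by some \<open>x\<close> keeps the
  annihilator inside \<open>p\<close>, the annihilator does not change.\<close>

lemma (in noetherian_domain) prime_colon:
  assumes H: "ideal H R" "H \<subseteq> p" and p: "primeideal p R"
  obtains z where "z \<in> carrier R" "primeideal {r \<in> carrier R. r \<otimes> z \<in> H} R"
    "{r \<in> carrier R. r \<otimes> z \<in> H} \<subseteq> p"
proof -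
  interpret p: primeideal p R by fact
  interpret H: ideal H R by fact
  define c where "c z = {r \<in> carrier R. r \<otimes> z \<in> H}" for z
  let ?A = "{I. \<exists>z\<in>carrier R. I = c z \<and> c z \<subseteq> p}"
  have "c \<one> \<subseteq> p" unfolding c_def using H by auto
  then have "?A \<noteq> {}" by auto
  moreover have idl: "ideal (c z) R" if "z \<in> carrier R" for z
    unfolding c_def using ring_colon_ideal H that by auto
  ultimately have "\<exists>J\<in>?A. \<forall>I\<in>?A. J \<subseteq> I \<longrightarrow> I = J"
    by (intro ideal_maximal_element) auto
  then obtain J where J: "J \<in> ?A" "\<forall>I\<in>?A. J \<subseteq> I \<longrightarrow> I = J" by (elim bexE)
  from J(1) obtain z where z: "z \<in> carrier R" "J = c z" "c z \<subseteq> p" by auto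
  have up: "c z \<subseteq> c (x \<otimes> z)" if "x \<in> carrier R" for x
  proof
    fix r assume "r \<in> c z"
    then have r: "r \<in> carrier R" "r \<otimes> z \<in> H" unfolding c_def by auto
    have "x \<otimes> (r \<otimes> z) \<in> H" using H.I_l_closed r that by auto
    also have "x \<otimes> (r \<otimes> z) = r \<otimes> (x \<otimes> z)" using r that z by (simp add: m_lcomm)
    finally show "r \<in> c (x \<otimes> z)" unfolding c_def using r by auto
  qed
  have eq: "c (x \<otimes> z) = c z" if "x \<in> carrier R" "c (x \<otimes> z) \<subseteq> p" for x
    using J(2)[rule_format, of "c (x \<otimes> z)"] up[OF that(1)] that z by blast
  have "primeideal (c z) R"
  proof (rule primeidealI)
    show "ideal (c z) R" using idl z by auto
    show "cring R" by (rule is_cring)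
    show "carrier R \<noteq> c z" using z p.I_notcarr p.Icarr by blast
    fix a b assume ab: "a \<in> carrier R" "b \<in> carrier R" "a \<otimes> b \<in> c z"
    then have abz: "a \<otimes> b \<otimes> z \<in> H" unfolding c_def by auto
    show "a \<in> c z \<or> b \<in> c z"
    proof (cases "c (a \<otimes> z) \<subseteq> p")
      case True
      then have "b \<in> c z" using eq[OF ab(1) True] abz ab z unfolding c_def by (auto simp: m_ac)
      then show ?thesis ..
    next
      case False
      then obtain s where s: "s \<in> carrier R" "s \<otimes> (a \<otimes> z) \<in> H" "s \<notin> p" unfolding c_def by auto
      \<comment> \<open>If \<open>a z\<close> has too large an annihilator, some \<open>s\<close>
        outside \<open>p\<close> kills it. Since \<open>p\<close> is prime, multiplying
        \<open>z\<close> by \<open>s\<close> does not leave \<open>p\<close>, so \<open>a\<close>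
        already kills \<open>z\<close>.\<close>
      have "c (s \<otimes> z) \<subseteq> p"
      proof
        fix x assume "x \<in> c (s \<otimes> z)"
        then have "x \<otimes> s \<in> c z" "x \<in> carrier R" unfolding c_def using s z by (auto simp: m_assoc)
        then show "x \<in> p" using p.I_prime[of x s] s z by auto
      qed
      then have "c (s \<otimes> z) = c z" using eq s by auto
      moreover have "a \<in> c (s \<otimes> z)" unfolding c_def using s ab z by (auto simp: m_ac)
      ultimately show ?thesis by auto
    qed
  qed
  then show thesis using that z unfolding c_def by auto
qed

lemma (in noetherian_ring) proper_ideal_in_maximal:
  assumes "ideal H R" "H \<noteq> carrier R"
  obtains m where "maximalideal m R" "H \<subseteq> m"
proof -
  let ?A = "{I. ideal I R \<and> I \<noteq> carrier R \<and> H \<subseteq> I}"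
  have "\<exists>J\<in>?A. \<forall>I\<in>?A. J \<subseteq> I \<longrightarrow> I = J"
    by (rule ideal_maximal_element) (use assms in auto)
  then obtain J where J: "J \<in> ?A" "\<forall>I\<in>?A. J \<subseteq> I \<longrightarrow> I = J" by (elim bexE)
  have "maximalideal J R"
  proof (rule maximalidealI)
    show "ideal J R" "carrier R \<noteq> J" using J by auto
    fix I assume "ideal I R" "J \<subseteq> I" "I \<subseteq> carrier R"
    then show "I = J \<or> I = carrier R" using J(1) J(2)[rule_format, of I] by blast
  qed
  then show thesis using that J by auto
qed


section \<open>Dedekind domains\<close>

text \<open>Coefficients are listed from the highest index down, the head belonging to the index
  \<open>length xs\<close>. This is the layout of polynomial lists, so evaluating a polynomial and
  forming a combination follow the same recursion.\<close>

primrec (in ring) combination :: "(nat \<Rightarrow> 'a) \<Rightarrow> 'a list \<Rightarrow> 'a" where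
  "combination a [] = \<zero>"
| "combination a (x # xs) = x \<otimes> a (length xs) \<oplus> combination a xs"

lemma (in ring) combination_closed:
  "range a \<subseteq> carrier R \<Longrightarrow> set xs \<subseteq> carrier R \<Longrightarrow> combination a xs \<in> carrier R"
  by (induction xs) (auto intro!: a_closed m_closed)

text \<open>By induction: one more term adds the principal ideal of \<open>a n\<close>, and a sum of
  ideals is an ideal.\<close>

lemma (in cring) combination_ideal:
  assumes "range a \<subseteq> carrier R"
  shows "ideal {combination a xs | xs. length xs = n \<and> set xs \<subseteq> carrier R} R"
proof (induction n)
  case 0
  have "{combination a xs | xs. length xs = 0 \<and> set xs \<subseteq> carrier R} = {\<zero>}" by auto
  then show ?case using zeroideal by simp
next
  case (Suc n)
  let ?J = "\<lambda>n. {combination a xs | xs. length xs = n \<and> set xs \<subseteq> carrier R}"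
  have "?J (Suc n) = set_add R (PIdl (a n)) (?J n)"
  proof
    show "?J (Suc n) \<subseteq> set_add R (PIdl (a n)) (?J n)"
    proof
      fix y assume "y \<in> ?J (Suc n)"
      then obtain ys where ys: "length ys = Suc n" "set ys \<subseteq> carrier R" "y = combination a ys" by auto
      then obtain x xs where "ys = x # xs" by (cases ys) auto
      then show "y \<in> set_add R (PIdl (a n)) (?J n)"
        unfolding set_add_def' cgenideal_def using ys by auto
    qed
    show "set_add R (PIdl (a n)) (?J n) \<subseteq> ?J (Suc n)"
    proof
      fix y assume "y \<in> set_add R (PIdl (a n)) (?J n)"
      then obtain x xs where "x \<in> carrier R" "length xs = n" "set xs \<subseteq> carrier R"
        "y = x \<otimes> a n \<oplus> combination a xs"
        unfolding set_add_def' cgenideal_def by auto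
      then show "y \<in> ?J (Suc n)" by (intro CollectI exI[of _ "x # xs"]) auto
    qed
  qed
  moreover have "a n \<in> carrier R" using assms by auto
  ultimately show ?case using add_ideals[OF cgenideal_ideal Suc] by simp
qed

lemma (in cring) combination_minus:
  "range a \<subseteq> carrier R \<Longrightarrow> set xs \<subseteq> carrier R \<Longrightarrow>
   combination a (map (\<lambda>x. \<ominus> x) xs) = \<ominus> combination a xs"
proof (induction xs)
  case (Cons x xs)
  then have "x \<in> carrier R" "a (length xs) \<in> carrier R" "combination a xs \<in> carrier R"
    using combination_closed by auto
  with Cons show ?case by (simp add: l_minus minus_add)
qed simp

text \<open>If \<open>z p \<subseteq> b p\<close> for a nonzero ideal \<open>p\<close> then \<open>z / b\<close> is integral: iterating multiplication by
  \<open>z / b\<close> on an element of \<open>p\<close> gives a sequence in \<open>R\<close>, and by the chain condition one of its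
  terms is a combination of the previous ones.\<close>

lemma (in dedekind_domain) integral_quotient:
  assumes b: "b \<in> carrier R" "b \<noteq> \<zero>" and z: "z \<in> carrier R"
    and p: "p \<subseteq> carrier R" "a0 \<in> p" "a0 \<noteq> \<zero>"
    and step: "\<And>x. x \<in> p \<Longrightarrow> \<exists>y\<in>p. z \<otimes> x = b \<otimes> y"
  shows "\<exists>c\<in>carrier R. z = b \<otimes> c"
proof -
  interpret K: domain_localization R "carrier R - {\<zero>}" by (rule localization_quotient_field)
  let ?K = "localization R (carrier R - {\<zero>})"
  let ?fr = "fraction R (carrier R - {\<zero>})"
  interpret K: cring ?K by (rule K.cring_Q)
  obtain nx where nx: "\<And>x. x \<in> p \<Longrightarrow> nx x \<in> p \<and> z \<otimes> x = b \<otimes> nx x" using step by metis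
  \<comment> \<open>\<open>a n\<close> stands for \<open>(z / b)^n a0\<close>; the assumption
    \<open>step\<close> keeps all these elements in \<open>p\<close>.\<close>
  define a where "a n = (nx ^^ n) a0" for n
  have ap: "a n \<in> p" for n unfolding a_def by (induction n) (use p nx in auto)
  then have ac: "a n \<in> carrier R" for n using p by auto
  then have ar: "range a \<subseteq> carrier R" by auto
  have aS: "z \<otimes> a n = b \<otimes> a (Suc n)" for n using nx[OF ap[of n]] by (simp add: a_def)
  define J where "J n = {combination a xs | xs. length xs = n \<and> set xs \<subseteq> carrier R}" for n
  have J: "ideal (J n) R" for n unfolding J_def by (rule combination_ideal[OF ar])
  have "J n \<subseteq> J (Suc n)" for n
  proof
    fix y assume "y \<in> J n"
    then obtain xs where "length xs = n" "set xs \<subseteq> carrier R" "y = combination a xs" unfolding J_def by auto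
    then have "y = combination a (\<zero> # xs)" using ac combination_closed[OF ar] by simp
    then show "y \<in> J (Suc n)" unfolding J_def using \<open>length xs = n\<close> \<open>set xs \<subseteq> _\<close>
      by (intro CollectI exI[of _ "\<zero> # xs"]) auto
  qed
  then obtain n where n: "J (Suc n) = J n" using ideal_sequence_stationary[of J] J by blast
  have "\<zero> \<in> J n" using J by (meson additive_subgroup.zero_closed ideal.axioms(1))
  then obtain ys where ys: "length ys = n" "set ys \<subseteq> carrier R" "\<zero> = combination a ys" unfolding J_def by auto
  \<comment> \<open>The list \<open>ys\<close> represents zero, so prefixing the coefficient one for
    the index \<open>n\<close> represents \<open>a n\<close> in \<open>J (Suc n)\<close>. As
    \<open>J (Suc n) = J n\<close>, it is also a combination of the earlier terms.\<close>
  then have "a n = combination a (\<one> # ys)" using ac by (metis combination.simps(2) l_one r_zero)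
  then have "a n \<in> J (Suc n)" unfolding J_def using ys by (intro CollectI exI[of _ "\<one> # ys"]) auto
  then obtain xs where xs: "length xs = n" "set xs \<subseteq> carrier R" "a n = combination a xs"
    using n unfolding J_def by auto
  \<comment> \<open>The monic polynomial that will vanish at \<open>z / b\<close>: one on top, then
    the negated coefficients of \<open>a n\<close> in terms of its predecessors.\<close>
  define f where "f = \<one> # map (\<lambda>x. \<ominus> x) xs"
  have f0: "combination a f = \<zero>"
  proof -
    have "combination a f = \<one> \<otimes> a n \<oplus> combination a (map (\<lambda>x. \<ominus> x) xs)"
      unfolding f_def by (simp add: xs(1))
    also have "\<dots> = \<zero>"
      using ac[of n] combination_minus[OF ar xs(2)] xs(3)[symmetric] by (simp add: r_neg)
    finally show ?thesis .
  qed
  have fc: "set f \<subseteq> carrier R" unfolding f_def using xs by auto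
  define \<phi> where "\<phi> r = ?fr r \<one>" for r
  define q where "q = ?fr z b"
  have \<phi>c: "r \<in> carrier R \<Longrightarrow> \<phi> r \<in> carrier ?K" for r unfolding \<phi>_def by (simp add: K.frac_closed)
  have \<phi>add: "\<phi> (r \<oplus> s) = \<phi> r \<oplus>\<^bsub>?K\<^esub> \<phi> s" and \<phi>mult: "\<phi> (r \<otimes> s) = \<phi> r \<otimes>\<^bsub>?K\<^esub> \<phi> s"
    if "r \<in> carrier R" "s \<in> carrier R" for r s
    unfolding \<phi>_def using that by (simp_all add: K.frac_add K.frac_mult)
  have qc: "q \<in> carrier ?K" unfolding q_def using b z by (simp add: K.frac_closed)
  have qa: "q \<otimes>\<^bsub>?K\<^esub> \<phi> (a n) = \<phi> (a (Suc n))" for n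
    unfolding q_def \<phi>_def using b z ac[of n] ac[of "Suc n"] aS[of n]
    by (simp add: K.frac_mult K.fraction_eq)
  have pow: "q [^]\<^bsub>?K\<^esub> n \<otimes>\<^bsub>?K\<^esub> \<phi> (a 0) = \<phi> (a n)" for n :: nat
  proof (induction n)
    case 0
    then show ?case using \<phi>c[OF ac] by simp
  next
    case (Suc n)
    have "q [^]\<^bsub>?K\<^esub> Suc n \<otimes>\<^bsub>?K\<^esub> \<phi> (a 0) = q \<otimes>\<^bsub>?K\<^esub> (q [^]\<^bsub>?K\<^esub> n \<otimes>\<^bsub>?K\<^esub> \<phi> (a 0))"
      using qc \<phi>c[OF ac] by (simp add: K.m_ac)
    then show ?case unfolding Suc qa .
  qed
  \<comment> \<open>Multiplying the value at \<open>q\<close> by \<open>a 0\<close> turns it into a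
    combination, because \<open>q^i a 0 = a i\<close>.\<close>
  have eval: "K.eval (map \<phi> g) q \<in> carrier ?K \<and> K.eval (map \<phi> g) q \<otimes>\<^bsub>?K\<^esub> \<phi> (a 0) = \<phi> (combination a g)"
    if "set g \<subseteq> carrier R" for g
    using that
  proof (induction g)
    case Nil
    have "\<phi> \<zero> = \<zero>\<^bsub>?K\<^esub>" unfolding \<phi>_def K.Q_zero ..
    then show ?case using \<phi>c[OF ac] by simp
  next
    case (Cons x g)
    have c: "x \<in> carrier R" "combination a g \<in> carrier R" using Cons combination_closed[OF ar] by auto
    have "K.eval (map \<phi> (x # g)) q = \<phi> x \<otimes>\<^bsub>?K\<^esub> q [^]\<^bsub>?K\<^esub> length g \<oplus>\<^bsub>?K\<^esub> K.eval (map \<phi> g) q" by simp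
    moreover have "(\<phi> x \<otimes>\<^bsub>?K\<^esub> q [^]\<^bsub>?K\<^esub> length g \<oplus>\<^bsub>?K\<^esub> K.eval (map \<phi> g) q) \<otimes>\<^bsub>?K\<^esub> \<phi> (a 0)
      = \<phi> x \<otimes>\<^bsub>?K\<^esub> (q [^]\<^bsub>?K\<^esub> length g \<otimes>\<^bsub>?K\<^esub> \<phi> (a 0)) \<oplus>\<^bsub>?K\<^esub> K.eval (map \<phi> g) q \<otimes>\<^bsub>?K\<^esub> \<phi> (a 0)"
      using Cons \<phi>c[OF ac] \<phi>c[OF c(1)] qc by (simp add: K.l_distr K.m_assoc)
    ultimately show ?case using Cons \<phi>c[OF ac] \<phi>c[OF c(1)] qc c ac by (simp add: pow \<phi>add \<phi>mult)
  qed
  define e where "e = K.eval (map \<phi> f) q"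
  have e0: "e = \<zero>\<^bsub>?K\<^esub>"
  proof -
    have e: "e \<in> carrier ?K" "e \<otimes>\<^bsub>?K\<^esub> \<phi> (a 0) = \<phi> \<zero>" using eval[OF fc] f0 by (simp_all add: e_def)
    \<comment> \<open>The factor \<open>a0\<close> is cancelled on a representative, in the domain
      \<open>R\<close>.\<close>
    from e(1) obtain c s where cs: "c \<in> carrier R" "s \<in> carrier R - {\<zero>}" "e = ?fr c s" by (rule K.fracE)
    have "a 0 = a0" by (simp add: a_def)
    then have "c \<otimes> a0 = \<zero>"
      using e(2) cs p unfolding \<phi>_def
      by (auto simp: K.frac_mult K.fraction_eq subset_eq integral_iff)
    then have "c = \<zero>" using cs p integral by blast
    then show ?thesis using cs by (simp add: K.Q_zero K.fraction_eq)
  qed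
  have one: "\<phi> \<one> = \<one>\<^bsub>?K\<^esub>" unfolding \<phi>_def K.Q_one ..
  have "\<one>\<^bsub>?K\<^esub> \<noteq> \<zero>\<^bsub>?K\<^esub>" by (simp add: K.Q_one K.Q_zero K.fraction_eq)
  moreover have hd: "lead_coeff (map \<phi> f) = \<phi> \<one>" "map \<phi> f \<noteq> []" by (simp_all add: f_def)
  \<comment> \<open>A nonempty polynomial list must have a nonzero leading coefficient, which is why
    one and zero of the quotient field were separated.\<close>
  ultimately have "map \<phi> f \<in> carrier ((\<phi> ` carrier R) [X]\<^bsub>?K\<^esub>)"
    unfolding univ_poly_def polynomial_def using fc one by auto
  then have "integral_over ?K (\<phi> ` carrier R) q"
    unfolding integral_over_def using hd one e0 e_def by (intro bexI[of _ "map \<phi> f"]) auto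
  moreover have "\<phi> = to_quotient_field R" unfolding \<phi>_def to_quotient_field_def ..
  ultimately have "q \<in> \<phi> ` carrier R"
    using integrally_closed[of q] qc unfolding quotient_field_def by simp
  then obtain c where "c \<in> carrier R" "q = \<phi> c" by auto
  then have "z = b \<otimes> c" unfolding q_def \<phi>_def using b z by (simp add: K.fraction_eq)
  then show ?thesis using \<open>c \<in> _\<close> by auto
qed

lemma (in dedekind_domain) nonzero_prime_eq:
  assumes "primeideal q R" "q \<noteq> {\<zero>}" "primeideal p R" "q \<subseteq> p"
  shows "q = p"
proof -
  have "maximalideal q R" using nonzero_prime_maximal assms by auto
  then interpret q: maximalideal q R .
  interpret p: primeideal p R by fact
  show ?thesis using q.I_maximal[OF p.ideal_axioms assms(4)] p.I_notcarr p.Icarr by blast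
qed

text \<open>The localization at a nonzero prime is a discrete valuation ring, with uniformizer \<open>a\<close>.\<close>

lemma (in dedekind_domain) local_uniformizer:
  assumes p: "primeideal p R" "p \<noteq> {\<zero>}"
  obtains a s where "a \<in> p" "a \<noteq> \<zero>" "s \<in> carrier R" "s \<notin> p" "\<And>x. x \<in> p \<Longrightarrow> \<exists>r\<in>carrier R. s \<otimes> x = r \<otimes> a"
proof -
  interpret p: primeideal p R by fact
  obtain b where b: "b \<in> p" "b \<noteq> \<zero>" using p p.zero_closed by blast
  have bc: "b \<in> carrier R" using b p.Icarr by auto
  interpret H: ideal "PIdl b" R using cgenideal_ideal bc by auto
  have H: "PIdl b \<subseteq> p" unfolding cgenideal_def using b p.I_l_closed by auto
  \<comment> \<open>The annihilator of \<open>z\<close> modulo \<open>b\<close> is a nonzero prime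
    inside \<open>p\<close>, hence equal to \<open>p\<close>. So \<open>z / b\<close> is an element
    outside \<open>R\<close> that multiplies \<open>p\<close> into \<open>R\<close>.\<close>
  obtain z where z: "z \<in> carrier R" "primeideal {r \<in> carrier R. r \<otimes> z \<in> PIdl b} R"
    "{r \<in> carrier R. r \<otimes> z \<in> PIdl b} \<subseteq> p"
    using prime_colon[OF H.ideal_axioms H p(1)] by blast
  let ?c = "{r \<in> carrier R. r \<otimes> z \<in> PIdl b}"
  have "b \<otimes> z \<in> PIdl b" using H.I_r_closed cgenideal_self[OF bc] z by auto
  then have "b \<in> ?c" using bc by blast
  then have "?c \<noteq> {\<zero>}" using b(2) by blast
  then have c: "?c = p" using nonzero_prime_eq z p by auto
  have ex: "\<exists>y\<in>carrier R. z \<otimes> x = b \<otimes> y" if "x \<in> p" for x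
  proof -
    have "x \<otimes> z \<in> PIdl b" using that c by auto
    then obtain y where "y \<in> carrier R" "x \<otimes> z = y \<otimes> b" unfolding cgenideal_def by auto
    then show ?thesis using that bc z p.Icarr by (metis m_comm)
  qed
  \<comment> \<open>If \<open>z / b\<close> mapped \<open>p\<close> into itself it would be
    integral, hence in \<open>R\<close>, and one would annihilate \<open>z\<close> modulo
    \<open>b\<close>. So it sends some \<open>a\<close> of \<open>p\<close> to an \<open>s\<close>
    outside \<open>p\<close>; this \<open>a\<close> is the uniformizer.\<close>
  have "\<exists>a\<in>p. \<exists>s\<in>carrier R. s \<notin> p \<and> z \<otimes> a = b \<otimes> s"
  proof (rule ccontr)
    assume "\<not> ?thesis"
    then have *: "\<exists>y\<in>p. z \<otimes> x = b \<otimes> y" if "x \<in> p" for x using ex that by blast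
    have "p \<subseteq> carrier R" using p.Icarr by auto
    then obtain c where "c \<in> carrier R" "z = b \<otimes> c"
      using integral_quotient[OF bc b(2) z(1) _ b(1,2) *] by blast
    then have "z \<in> PIdl b" unfolding cgenideal_def using bc m_comm by blast
    then have "\<one> \<in> ?c" using z by auto
    then show False unfolding c using p.one_imp_carrier p.I_notcarr by auto
  qed
  then obtain a s where as: "a \<in> p" "s \<in> carrier R" "s \<notin> p" "z \<otimes> a = b \<otimes> s" by auto
  have ac: "a \<in> carrier R" using as p.Icarr by auto
  show thesis
  proof (rule that[of a s])
    show "a \<in> p" "s \<in> carrier R" "s \<notin> p" using as by auto
    show "a \<noteq> \<zero>"
    proof
      assume "a = \<zero>"
      then have "b \<otimes> s = \<zero>" using as z by simp
      then show False using b bc as integral p.zero_closed by blast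
    qed
    fix x assume x: "x \<in> p"
    then have xc: "x \<in> carrier R" using p.Icarr by auto
    obtain y where y: "y \<in> carrier R" "z \<otimes> x = b \<otimes> y" using ex x by auto
    \<comment> \<open>From \<open>z a = b s\<close> and \<open>z x = b y\<close>, both
      \<open>b s x\<close> and \<open>b y a\<close> equal \<open>z a x\<close>, and \<open>b\<close>
      can be cancelled.\<close>
    have "b \<otimes> (s \<otimes> x) = (b \<otimes> s) \<otimes> x" using bc as(2) xc by (simp add: m_assoc)
    also have "\<dots> = a \<otimes> (z \<otimes> x)" unfolding as(4)[symmetric] using z ac xc by (simp add: m_ac)
    also have "\<dots> = b \<otimes> (y \<otimes> a)" unfolding y(2) using y(1) bc ac by (simp add: m_ac)
    finally have "s \<otimes> x = y \<otimes> a" using m_lcancel[OF b(2) bc] as xc y ac by auto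
    then show "\<exists>r\<in>carrier R. s \<otimes> x = r \<otimes> a" using y by auto
  qed
qed

section \<open>Modules over a non-local Dedekind domain\<close>

locale dedekind_module = R?: dedekind_domain R + module R M for R (structure) and M (structure) +
  assumes nonlocal: "\<not> local_ring R"
begin

abbreviation "P \<equiv> nonzero_primes R"

lemma primeD:
  assumes "p \<in> P"
  shows "primeideal p R" "p \<noteq> {\<zero>}" "maximalideal p R" "p \<subseteq> carrier R" "\<zero> \<in> p" "\<one> \<notin> p"
proof -
  show p: "primeideal p R" and "p \<noteq> {\<zero>}" using assms unfolding nonzero_primes_def by auto
  then show "maximalideal p R" using nonzero_prime_maximal by auto
  interpret primeideal p R by fact
  show "p \<subseteq> carrier R" "\<zero> \<in> p" "\<one> \<notin> p" using Icarr one_imp_carrier I_notcarr by auto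
qed

lemma prime_mult_notin: "p \<in> P \<Longrightarrow> s \<in> carrier R - p \<Longrightarrow> t \<in> carrier R - p \<Longrightarrow> s \<otimes> t \<in> carrier R - p"
  using primeideal.I_prime[OF primeD(1)] by blast

text \<open>If the zero ideal were maximal, it would equal every maximal ideal, containing none
  strictly below it and being contained in all of them; then \<open>R\<close> would be local. This
  excludes fields.\<close>

lemma maximal_in_P:
  assumes "maximalideal m R" shows "m \<in> P"
proof -
  interpret m: maximalideal m R by fact
  have "m \<noteq> {\<zero>}"
  proof
    assume m0: "m = {\<zero>}"
    have "n = m" if "maximalideal n R" for n
    proof -
      interpret n: maximalideal n R by fact
      show ?thesis using m.I_maximal[OF n.ideal_axioms] n.I_notcarr n.zero_closed n.Icarr m0 by blast
    qed
    then have "local_ring R" unfolding local_ring_def using assms is_cring by auto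
    then show False using nonlocal by simp
  qed
  then show ?thesis unfolding nonzero_primes_def using maximalideal_prime[OF assms] by auto
qed

lemma exists_prime: "\<exists>p. p \<in> P"
proof -
  have "{\<zero>} \<noteq> carrier R" using one_not_zero by blast
  then obtain m where "maximalideal m R" using proper_ideal_in_maximal[OF zeroideal] by blast
  then show ?thesis using maximal_in_P by auto
qed

lemma exists_other_prime: assumes "p \<in> P" shows "\<exists>q\<in>P. q \<noteq> p"
proof (rule ccontr)
  assume "\<not> ?thesis"
  then have "m = p" if "maximalideal m R" for m using that maximal_in_P by auto
  then have "local_ring R" unfolding local_ring_def using assms is_cring primeD(3) by blast
  then show False using nonlocal by simp
qed

lemma prime_not_subset: assumes "p \<in> P" "q \<in> P" "q \<noteq> p" shows "\<exists>t\<in>q. t \<in> carrier R - p"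
  using nonzero_prime_eq[of q p] primeD assms by blast

text \<open>The multipliers that send \<open>x\<close> into \<open>U\<close> form an ideal contained
  in no maximal ideal, so one is among them. This local-global principle carries the reduction to
  primary parts.\<close>

lemma local_membership:
  assumes "sub U" "x \<in> carrier M" "\<And>p. p \<in> P \<Longrightarrow> \<exists>s\<in>carrier R - p. s \<odot>\<^bsub>M\<^esub> x \<in> U"
  shows "x \<in> U"
proof -
  let ?H = "{r \<in> carrier R. r \<odot>\<^bsub>M\<^esub> x \<in> U}"
  have H: "ideal ?H R" by (rule colon_ideal) fact+
  have "?H = carrier R"
  proof (rule ccontr)
    assume "\<not> ?thesis"
    then obtain m where m: "maximalideal m R" "?H \<subseteq> m" using proper_ideal_in_maximal[OF H] by blast
    show False using assms(3)[OF maximal_in_P[OF m(1)]] m(2) by blast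
  qed
  then have "\<one> \<in> ?H" by auto
  then show ?thesis using assms by simp
qed

section \<open>Divisible submodules, products with ideals, and complements of divisible
  submodules\<close>

definition divisible :: "'c set \<Rightarrow> bool" where
  "divisible U \<longleftrightarrow> (\<forall>r\<in>carrier R. r \<noteq> \<zero> \<longrightarrow> (\<forall>x\<in>U. \<exists>y\<in>U. x = r \<odot>\<^bsub>M\<^esub> y))"

definition ideal_smult :: "'a set \<Rightarrow> 'c set \<Rightarrow> 'c set" where
  "ideal_smult J U = spanned (\<Union>r\<in>J. (\<lambda>x. r \<odot>\<^bsub>M\<^esub> x) ` U)"

lemma ideal_smult_sub: assumes "J \<subseteq> carrier R" "sub U" shows "sub (ideal_smult J U)"
  unfolding ideal_smult_def
  by (rule spanned_sub) (use assms sub_carrier[OF assms(2)] in blast)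

lemma ideal_smult_mem: "r \<in> J \<Longrightarrow> x \<in> U \<Longrightarrow> r \<odot>\<^bsub>M\<^esub> x \<in> ideal_smult J U"
  unfolding ideal_smult_def by (rule subsetD[OF spanned_upper]) blast

lemma ideal_smult_least:
  assumes "sub N" "\<And>r x. r \<in> J \<Longrightarrow> x \<in> U \<Longrightarrow> r \<odot>\<^bsub>M\<^esub> x \<in> N" shows "ideal_smult J U \<subseteq> N"
  unfolding ideal_smult_def using assms by (intro spanned_least) auto

text \<open>An argument in the style of Cohen's theorem. If division by \<open>r\<close> fails in
  \<open>B\<close>, then \<open>R r\<close> is an ideal \<open>J\<close> with \<open>B\<close> not
  inside \<open>J B\<close>, since \<open>(R r) B = r B\<close>. A maximal ideal of this kind
  containing \<open>r\<close> is prime, and it is nonzero because \<open>r\<close> is.\<close>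

lemma divisibleI:
  assumes B: "sub B" and pB: "\<And>p. p \<in> P \<Longrightarrow> B \<subseteq> ideal_smult p B"
  shows "divisible B"
  unfolding divisible_def
proof (intro ballI impI, rule ccontr)
  fix r x assume r: "r \<in> carrier R" "r \<noteq> \<zero>" and x: "x \<in> B" and nx: "\<not> (\<exists>y\<in>B. x = r \<odot>\<^bsub>M\<^esub> y)"
  note c = sub_carrier[OF B]
  let ?A = "{J. ideal J R \<and> r \<in> J \<and> \<not> B \<subseteq> ideal_smult J B}"
  have "ideal_smult (PIdl r) B \<subseteq> (\<lambda>y. r \<odot>\<^bsub>M\<^esub> y) ` B"
  proof (rule ideal_smult_least)
    show "sub ((\<lambda>y. r \<odot>\<^bsub>M\<^esub> y) ` B)" using sub_scale B r by auto
    fix j y assume "j \<in> PIdl r" "y \<in> B"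
    then obtain k where "k \<in> carrier R" "j = k \<otimes> r" unfolding cgenideal_def by auto
    then have "j \<odot>\<^bsub>M\<^esub> y = r \<odot>\<^bsub>M\<^esub> (k \<odot>\<^bsub>M\<^esub> y)" "k \<odot>\<^bsub>M\<^esub> y \<in> B"
      using r \<open>y \<in> B\<close> c sub_smult[OF B] by (simp_all add: smult_assoc1[symmetric] m_comm)
    then show "j \<odot>\<^bsub>M\<^esub> y \<in> (\<lambda>y. r \<odot>\<^bsub>M\<^esub> y) ` B" by auto
  qed
  then have "PIdl r \<in> ?A" using cgenideal_ideal[OF r(1)] cgenideal_self[OF r(1)] x nx by auto
  then have "\<exists>J\<in>?A. \<forall>I\<in>?A. J \<subseteq> I \<longrightarrow> I = J" by (intro ideal_maximal_element) auto
  then obtain J where J: "J \<in> ?A" "\<forall>I\<in>?A. J \<subseteq> I \<longrightarrow> I = J" by (elim bexE)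
  interpret J: ideal J R using J(1) by auto
  have Jc: "J \<subseteq> carrier R" using J.Icarr by auto
  have N: "sub (ideal_smult J B)" using ideal_smult_sub[OF Jc B] .
  \<comment> \<open>The ideal \<open>J + R a\<close> is strictly larger than \<open>J\<close>, so
    maximality puts \<open>B\<close> inside \<open>(J + R a) B\<close>, which is at most
    \<open>J B + a B\<close>.\<close>
  have key: "B \<subseteq> ideal_smult J B <+>\<^bsub>M\<^esub> (\<lambda>x. a \<odot>\<^bsub>M\<^esub> x) ` B" if a: "a \<in> carrier R" "a \<notin> J" for a
  proof -
    let ?I = "set_add R J (PIdl a)"
    have I: "ideal ?I R" using add_ideals J.ideal_axioms cgenideal_ideal[OF a(1)] by auto
    have JI: "J \<subseteq> ?I"
    proof
      fix j assume "j \<in> J"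
      moreover have "\<zero> \<in> PIdl a" unfolding cgenideal_def using R.l_null[OF a(1)] R.zero_closed by (metis (mono_tags, lifting) mem_Collect_eq)
      ultimately show "j \<in> ?I" unfolding set_add_def' using R.r_zero[OF J.Icarr[of j]] by (metis UN_I insertI1)
    qed
    have "a \<in> ?I" unfolding set_add_def'
      using J.zero_closed cgenideal_self[OF a(1)] R.l_zero[OF a(1)] by (metis UN_I insertI1)
    then have "?I \<noteq> J" using a by auto
    then have "B \<subseteq> ideal_smult ?I B" using J JI I by blast
    also have "\<dots> \<subseteq> ideal_smult J B <+>\<^bsub>M\<^esub> (\<lambda>x. a \<odot>\<^bsub>M\<^esub> x) ` B"
    proof (rule ideal_smult_least)
      show "sub (ideal_smult J B <+>\<^bsub>M\<^esub> (\<lambda>x. a \<odot>\<^bsub>M\<^esub> x) ` B)" using sub_sum N sub_scale[OF B a(1)] by auto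
      fix i y assume "i \<in> ?I" and y: "y \<in> B"
      then obtain j k where jk: "j \<in> J" "k \<in> carrier R" "i = j \<oplus> k \<otimes> a"
        unfolding set_add_def' cgenideal_def by auto
      then have "i \<odot>\<^bsub>M\<^esub> y = j \<odot>\<^bsub>M\<^esub> y \<oplus>\<^bsub>M\<^esub> a \<odot>\<^bsub>M\<^esub> (k \<odot>\<^bsub>M\<^esub> y)"
        using y c a J.Icarr by (simp add: smult_l_distr smult_assoc1[symmetric] m_comm)
      moreover have "j \<odot>\<^bsub>M\<^esub> y \<in> ideal_smult J B" using ideal_smult_mem jk y by auto
      moreover have "k \<odot>\<^bsub>M\<^esub> y \<in> B" using sub_smult[OF B] jk y by auto
      ultimately show "i \<odot>\<^bsub>M\<^esub> y \<in> ideal_smult J B <+>\<^bsub>M\<^esub> (\<lambda>x. a \<odot>\<^bsub>M\<^esub> x) ` B" unfolding mem_set_add by blast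
    qed
    finally show ?thesis .
  qed
  have "primeideal J R"
  proof (rule primeidealI[OF J.ideal_axioms is_cring])
    show "carrier R \<noteq> J"
    proof
      assume "carrier R = J"
      then have "\<one> \<in> J" by auto
      then have "B \<subseteq> ideal_smult J B" using ideal_smult_mem[of \<one> J _ B] c by fastforce
      then show False using J(1) by auto
    qed
    fix a b assume ab: "a \<in> carrier R" "b \<in> carrier R" "a \<otimes> b \<in> J"
    show "a \<in> J \<or> b \<in> J"
    proof (rule ccontr)
      \<comment> \<open>Multiplying \<open>key\<close> for \<open>b\<close> by \<open>a\<close> puts
        \<open>a B\<close> into \<open>J B + a b B\<close>, hence into \<open>J B\<close>; then
        \<open>key\<close> for \<open>a\<close> puts \<open>B\<close> into \<open>J B\<close>, a
        contradiction.\<close>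
      assume n: "\<not> ?thesis"
      have "(\<lambda>x. a \<odot>\<^bsub>M\<^esub> x) ` B \<subseteq> ideal_smult J B"
      proof
        fix w assume "w \<in> (\<lambda>x. a \<odot>\<^bsub>M\<^esub> x) ` B"
        then obtain y where y: "y \<in> B" "w = a \<odot>\<^bsub>M\<^esub> y" by auto
        have "B \<subseteq> ideal_smult J B <+>\<^bsub>M\<^esub> (\<lambda>x. b \<odot>\<^bsub>M\<^esub> x) ` B" using key[of b] ab n by blast
        then have "y \<in> ideal_smult J B <+>\<^bsub>M\<^esub> (\<lambda>x. b \<odot>\<^bsub>M\<^esub> x) ` B" using y(1) by (rule subsetD)
        then obtain u v where uv: "u \<in> ideal_smult J B" "v \<in> B" "y = u \<oplus>\<^bsub>M\<^esub> b \<odot>\<^bsub>M\<^esub> v"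
          unfolding mem_set_add by auto
        have "w = a \<odot>\<^bsub>M\<^esub> u \<oplus>\<^bsub>M\<^esub> (a \<otimes> b) \<odot>\<^bsub>M\<^esub> v"
          using uv y ab sub_carrier[OF N] c by (simp add: smult_r_distr smult_assoc1)
        then show "w \<in> ideal_smult J B"
          using sub_add[OF N] sub_smult[OF N] uv ab ideal_smult_mem by auto
      qed
      then have "ideal_smult J B <+>\<^bsub>M\<^esub> (\<lambda>x. a \<odot>\<^bsub>M\<^esub> x) ` B \<subseteq> ideal_smult J B"
        using sum_least[OF N] by auto
      moreover have "B \<subseteq> ideal_smult J B <+>\<^bsub>M\<^esub> (\<lambda>x. a \<odot>\<^bsub>M\<^esub> x) ` B" using key[of a] ab n by blast
      ultimately have "B \<subseteq> ideal_smult J B" by (rule subset_trans[rotated])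
      then show False using J(1) by simp
    qed
  qed
  then have "J \<in> P" unfolding nonzero_primes_def using J(1) r by blast
  then show False using pB J(1) by blast
qed

text \<open>Injectivity of divisible modules. A submodule \<open>W\<close> maximal with \<open>W \<inter> V = 0\<close> satisfies
  \<open>V + W = M\<close>: otherwise some \<open>x\<close> has a prime \<open>p\<close> as its annihilator modulo \<open>V + W\<close>, and correcting
  \<open>x\<close> by an element of \<open>V\<close> with the help of a uniformizer at \<open>p\<close> gives \<open>x'\<close> and \<open>s \<notin> p\<close> with
  \<open>p s x' \<subseteq> W\<close>, so that \<open>W + R s x'\<close> still meets \<open>V\<close> trivially.\<close>

lemma divisible_complement:
  assumes V: "sub V" "divisible V" and Y: "sub Y" "V \<inter> Y = {\<zero>\<^bsub>M\<^esub>}"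
  obtains W where "Y \<subseteq> W" "dsum V W"
proof -
  have "Y \<inter> (V - {\<zero>\<^bsub>M\<^esub>}) = {}" using Y by auto
  then obtain W where W: "sub W" "Y \<subseteq> W" "W \<inter> (V - {\<zero>\<^bsub>M\<^esub>}) = {}"
    "\<forall>W'. sub W' \<and> W \<subseteq> W' \<and> W' \<inter> (V - {\<zero>\<^bsub>M\<^esub>}) = {} \<longrightarrow> W' = W"
    using maximal_avoiding[OF Y(1)] by blast
  note VW = sub_sum[OF V(1) W(1)]
  note c = sub_carrier[OF V(1)] sub_carrier[OF W(1)]
  have inV: "V \<subseteq> V <+>\<^bsub>M\<^esub> W" and inW: "W \<subseteq> V <+>\<^bsub>M\<^esub> W"
    using sum_upper1[OF V(1) W(1)] sum_upper2[OF V(1) W(1)] .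
  have "x0 \<in> V <+>\<^bsub>M\<^esub> W" if x0: "x0 \<in> carrier M" for x0
  proof (rule ccontr)
    assume nx: "x0 \<notin> V <+>\<^bsub>M\<^esub> W"
    let ?H = "{r \<in> carrier R. r \<odot>\<^bsub>M\<^esub> x0 \<in> V <+>\<^bsub>M\<^esub> W}"
    have H: "ideal ?H R" using colon_ideal[OF VW x0] .
    have "?H \<noteq> carrier R" using nx x0 by (metis (mono_tags, lifting) mem_Collect_eq one_closed smult_one)
    then obtain m where m: "maximalideal m R" "?H \<subseteq> m" using proper_ideal_in_maximal[OF H] by blast
    \<comment> \<open>Passing to the multiple \<open>x = z x0\<close> makes the annihilator modulo
      \<open>V + W\<close> a prime. A prime is proper, so \<open>x\<close> is still outside
      \<open>V + W\<close>.\<close>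
    obtain z where z: "z \<in> carrier R" "primeideal {r \<in> carrier R. r \<otimes> z \<in> ?H} R"
      using prime_colon[OF H m(2) maximalideal_prime[OF m(1)]] by blast
    define x where "x = z \<odot>\<^bsub>M\<^esub> x0"
    define p where "p = {r \<in> carrier R. r \<odot>\<^bsub>M\<^esub> x \<in> V <+>\<^bsub>M\<^esub> W}"
    have xc: "x \<in> carrier M" unfolding x_def using z x0 by auto
    have "p = {r \<in> carrier R. r \<otimes> z \<in> ?H}"
      unfolding p_def x_def using z x0 by (auto simp: smult_assoc1)
    then have pp: "primeideal p R" using z by simp
    interpret p: primeideal p R by fact
    obtain s x' v where s: "s \<in> carrier R" "s \<notin> p" and x': "x' \<in> carrier M" "v \<in> V" "x = x' \<oplus>\<^bsub>M\<^esub> v"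
      and sx': "\<And>r. r \<in> p \<Longrightarrow> r \<odot>\<^bsub>M\<^esub> (s \<odot>\<^bsub>M\<^esub> x') \<in> W"
    proof (cases "p = {\<zero>}")
      \<comment> \<open>For the zero prime only multiplication by zero has to land in
        \<open>W\<close>, so nothing is corrected: \<open>s\<close> is one and \<open>v\<close> is
        zero.\<close>
      case True
      show thesis
        by (rule that[of \<one> x "\<zero>\<^bsub>M\<^esub>"])
          (use True p.one_imp_carrier p.I_notcarr xc sub_zero[OF V(1)] sub_zero[OF W(1)] in auto)
    next
      case False
      obtain a s where as: "a \<in> p" "a \<noteq> \<zero>" "s \<in> carrier R" "s \<notin> p"
        "\<And>x. x \<in> p \<Longrightarrow> \<exists>r\<in>carrier R. s \<otimes> x = r \<otimes> a"
        using local_uniformizer[OF pp False] by blast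
      have ac: "a \<in> carrier R" using as p.Icarr by auto
      have "a \<odot>\<^bsub>M\<^esub> x \<in> V <+>\<^bsub>M\<^esub> W" using as(1) unfolding p_def by auto
      then obtain u w where uw: "u \<in> V" "w \<in> W" "a \<odot>\<^bsub>M\<^esub> x = u \<oplus>\<^bsub>M\<^esub> w" unfolding mem_set_add by auto
      \<comment> \<open>Divisibility lets the \<open>V\<close>-part of \<open>a x\<close> be divided
        by \<open>a\<close>; subtracting the quotient \<open>v\<close> from \<open>x\<close> leaves
        an \<open>x'\<close> with \<open>a x'\<close> in \<open>W\<close>.\<close>
      obtain v where v: "v \<in> V" "u = a \<odot>\<^bsub>M\<^esub> v" using V(2) uw ac as unfolding divisible_def by blast
      define x' where "x' = x \<oplus>\<^bsub>M\<^esub> \<ominus>\<^bsub>M\<^esub> v"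
      have x'c: "x' \<in> carrier M" unfolding x'_def using xc v c by auto
      have "a \<odot>\<^bsub>M\<^esub> x' = (u \<oplus>\<^bsub>M\<^esub> w) \<oplus>\<^bsub>M\<^esub> \<ominus>\<^bsub>M\<^esub> u"
        unfolding x'_def using xc v c ac uw by (simp add: smult_r_distr smult_r_minus)
      also have "\<dots> = w" 
        using uw(1,2) c M.a_comm[of u w] by (simp add: M.a_assoc M.r_neg)
      finally have ax': "a \<odot>\<^bsub>M\<^esub> x' = w" .
      show thesis
      proof (rule that[of s x' v])
        show "x = x' \<oplus>\<^bsub>M\<^esub> v" unfolding x'_def using xc v c by (simp add: M.a_assoc M.l_neg)
        fix r assume "r \<in> p"
        then obtain k where k: "k \<in> carrier R" "s \<otimes> r = k \<otimes> a" using as by blast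
        have "r \<odot>\<^bsub>M\<^esub> (s \<odot>\<^bsub>M\<^esub> x') = (s \<otimes> r) \<odot>\<^bsub>M\<^esub> x'"
          using \<open>r \<in> p\<close> p.Icarr as x'c by (simp add: smult_assoc1[symmetric] m_comm)
        also have "\<dots> = k \<odot>\<^bsub>M\<^esub> w" unfolding k(2) using k(1) ac x'c ax' by (simp add: smult_assoc1)
        finally show "r \<odot>\<^bsub>M\<^esub> (s \<odot>\<^bsub>M\<^esub> x') \<in> W" using sub_smult[OF W(1)] k uw by simp
      qed (use as x'c v in auto)
    qed
    \<comment> \<open>Since \<open>x\<close> and \<open>x'\<close> differ by an element of
      \<open>V\<close>, any \<open>r\<close> that moves \<open>s x'\<close> into
      \<open>V + W\<close> makes \<open>r s\<close> annihilate \<open>x\<close> modulo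
      \<open>V + W\<close>.\<close>
    have in_colon: "r \<otimes> s \<in> p" if "r \<in> carrier R" "r \<odot>\<^bsub>M\<^esub> (s \<odot>\<^bsub>M\<^esub> x') \<in> V <+>\<^bsub>M\<^esub> W" for r
    proof -
      have "(r \<otimes> s) \<odot>\<^bsub>M\<^esub> x = r \<odot>\<^bsub>M\<^esub> (s \<odot>\<^bsub>M\<^esub> x') \<oplus>\<^bsub>M\<^esub> (r \<otimes> s) \<odot>\<^bsub>M\<^esub> v"
        using x' s that c by (simp add: smult_r_distr smult_assoc1)
      moreover have "(r \<otimes> s) \<odot>\<^bsub>M\<^esub> v \<in> V <+>\<^bsub>M\<^esub> W"
        using sub_smult[OF V(1)] that s x' inV by blast
      ultimately show ?thesis unfolding p_def using sub_add[OF VW] that s by simp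
    qed
    have sxc: "s \<odot>\<^bsub>M\<^esub> x' \<in> carrier M" using s x' by auto
    let ?C = "(\<lambda>r. r \<odot>\<^bsub>M\<^esub> (s \<odot>\<^bsub>M\<^esub> x')) ` carrier R"
    have C: "sub ?C" using sub_cyclic[OF sxc] .
    have "(W <+>\<^bsub>M\<^esub> ?C) \<inter> (V - {\<zero>\<^bsub>M\<^esub>}) = {}"
    proof (rule ccontr)
      assume "\<not> ?thesis"
      then obtain y where y: "y \<in> W <+>\<^bsub>M\<^esub> ?C" "y \<in> V" "y \<noteq> \<zero>\<^bsub>M\<^esub>" by auto
      then obtain w r where wr: "w \<in> W" "r \<in> carrier R" "y = w \<oplus>\<^bsub>M\<^esub> r \<odot>\<^bsub>M\<^esub> (s \<odot>\<^bsub>M\<^esub> x')"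
        unfolding mem_set_add by blast
      have "r \<odot>\<^bsub>M\<^esub> (s \<odot>\<^bsub>M\<^esub> x') \<in> V <+>\<^bsub>M\<^esub> W"
        using sub_cancel[OF VW, of w "r \<odot>\<^bsub>M\<^esub> (s \<odot>\<^bsub>M\<^esub> x')"] wr y inV inW sxc by auto
      then have "r \<in> p" using in_colon[OF wr(2)] p.I_prime[OF wr(2) s(1)] s by auto
      then have "y \<in> W" using wr sx' sub_add[OF W(1)] by auto
      then show False using W(3) y by auto
    qed
    \<comment> \<open>Maximality of \<open>W\<close> now forces \<open>s x'\<close> into
      \<open>W\<close>, hence \<open>s\<close> into \<open>p\<close>, which was excluded.\<close>
    then have "W <+>\<^bsub>M\<^esub> ?C = W"
      using W(4) sub_sum[OF W(1) C] sum_upper1[OF W(1) C] by blast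
    then have "s \<odot>\<^bsub>M\<^esub> x' \<in> W" using sum_upper2[OF W(1) C] mem_cyclic[OF sxc] by auto
    then have "\<one> \<otimes> s \<in> p" using in_colon[of \<one>] inW sxc by auto
    then show False using s by auto
  qed
  then have "dsum V W" using V W by (intro dsumI) auto
  then show thesis using that W by auto
qed

end


section \<open>An internal description of dual self-CS-Baer modules\<close>

text \<open>A submodule is a sum of images of endomorphisms iff it is the sum of all the images that it
  contains; this avoids index sets and finite sums.\<close>

definition image_generated :: "('a, 'c) ring_scheme \<Rightarrow> ('a, 'm, 'd) module_scheme \<Rightarrow> 'm set \<Rightarrow> bool" where
  "image_generated R M N \<longleftrightarrow> submodule N R M \<and>
     (\<forall>U. submodule U R M \<and> (\<forall>f \<in> module_hom R M M. f ` carrier M \<subseteq> N \<longrightarrow> f ` carrier M \<subseteq> U) \<longrightarrow> N \<subseteq> U)"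

text \<open>Superfluity of \<open>N / D\<close> in \<open>M / D\<close>, pulled back along the
  quotient map: submodules of \<open>M / D\<close> correspond to the submodules \<open>U\<close>
  above \<open>D\<close>, so cosets do not occur.\<close>

definition above_summand :: "('a, 'c) ring_scheme \<Rightarrow> ('a, 'm, 'd) module_scheme \<Rightarrow> 'm set \<Rightarrow> bool" where
  "above_summand R M N \<longleftrightarrow> (\<exists>D E. direct_sum_decomposition R M D E \<and> D \<subseteq> N \<and>
     (\<forall>U. submodule U R M \<and> D \<subseteq> U \<and> N <+>\<^bsub>M\<^esub> U = carrier M \<longrightarrow> U = carrier M))"

definition CS_Baer :: "('a, 'c) ring_scheme \<Rightarrow> ('a, 'm, 'd) module_scheme \<Rightarrow> bool" where
  "CS_Baer R M \<longleftrightarrow> (\<forall>N. image_generated R M N \<longrightarrow> above_summand R M N)"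

section \<open>Sums of families, quotient modules, and agreement with the definition by
  families\<close>

context module begin

lemma module_sum_add:
  assumes N: "\<And>i. i \<in> I \<Longrightarrow> sub (N i)" and m: "m \<in> module_sum M I N" and j: "j \<in> I" "a \<in> N j"
  shows "a \<oplus>\<^bsub>M\<^esub> m \<in> module_sum M I N"
proof -
  have c: "i \<in> I \<Longrightarrow> x \<in> N i \<Longrightarrow> x \<in> carrier M" for i x using N sub_carrier by blast
  obtain J x where J: "finite J" "J \<subseteq> I" "x \<in> Pi J N" "m = finsum M x J"
    using m unfolding module_sum_def by auto
  \<comment> \<open>The previous summand at \<open>j\<close>, with zero as the default when
    \<open>j\<close> is a new index; replacing it by \<open>a + b\<close> treats both cases
    alike.\<close>
  define b where "b = (if j \<in> J then x j else \<zero>\<^bsub>M\<^esub>)"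
  have b: "b \<in> N j" unfolding b_def using J j sub_zero[OF N] by auto
  have xc: "x \<in> (J - {j}) \<rightarrow> carrier M" using J c by (auto simp: Pi_iff subset_eq)
  have m: "m = b \<oplus>\<^bsub>M\<^esub> finsum M x (J - {j})"
  proof (cases "j \<in> J")
    case True
    then have "insert j (J - {j}) = J" by auto
    then have "m = x j \<oplus>\<^bsub>M\<^esub> finsum M x (J - {j})"
      using J(4) M.finsum_insert[of "J - {j}" j x] J(1) xc b c[OF j(1)] True by (simp add: b_def)
    then show ?thesis unfolding b_def using True by simp
  next
    case False
    then show ?thesis unfolding b_def using J(4) M.finsum_closed[OF xc] by simp
  qed
  let ?x = "x(j := a \<oplus>\<^bsub>M\<^esub> b)"
  have eq: "finsum M ?x (J - {j}) = finsum M x (J - {j})"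
    by (rule M.finsum_cong') (use xc in auto)
  have "?x \<in> (J - {j}) \<rightarrow> carrier M" using xc by auto
  then have "finsum M ?x (insert j (J - {j})) = (a \<oplus>\<^bsub>M\<^esub> b) \<oplus>\<^bsub>M\<^esub> finsum M x (J - {j})"
    using J(1) M.finsum_insert[of "J - {j}" j ?x] eq c[OF j(1)] j b by simp
  also have "\<dots> = a \<oplus>\<^bsub>M\<^esub> m"
    unfolding m using M.finsum_closed[OF xc] c[OF j(1)] j b by (simp add: M.a_assoc)
  finally have "a \<oplus>\<^bsub>M\<^esub> m = finsum M ?x (insert j (J - {j}))" ..
  moreover have "?x \<in> Pi (insert j (J - {j})) N" using J j b sub_add[OF N] by auto
  ultimately show ?thesis unfolding module_sum_def using J j
    by (intro CollectI exI[of _ ?x] exI[of _ "insert j (J - {j})"]) auto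
qed

lemma module_sum_sub:
  assumes N: "\<And>i. i \<in> I \<Longrightarrow> sub (N i)"
  shows "sub (module_sum M I N)"
proof -
  have c: "i \<in> I \<Longrightarrow> x \<in> N i \<Longrightarrow> x \<in> carrier M" for i x using N sub_carrier by blast
  have smult: "r \<odot>\<^bsub>M\<^esub> m \<in> module_sum M I N" if m: "m \<in> module_sum M I N" and r: "r \<in> carrier R" for m r
  proof -
    obtain J x where J: "finite J" "J \<subseteq> I" "x \<in> Pi J N" "m = finsum M x J"
      using m unfolding module_sum_def by auto
    have "x \<in> J \<rightarrow> carrier M" using J c by (auto simp: Pi_iff subset_eq)
    then have "r \<odot>\<^bsub>M\<^esub> m = finsum M (\<lambda>i. r \<odot>\<^bsub>M\<^esub> x i) J" using finsum_smult_ldistr[OF J(1) r] J(4) by simp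
    moreover have "(\<lambda>i. r \<odot>\<^bsub>M\<^esub> x i) \<in> Pi J N" using J sub_smult[OF N r] by auto
    ultimately show ?thesis unfolding module_sum_def using J(1,2)
      by (intro CollectI exI[of _ "\<lambda>i. r \<odot>\<^bsub>M\<^esub> x i"] exI[of _ J]) auto
  qed
  have carr: "m \<in> carrier M" if "m \<in> module_sum M I N" for m
    using that c unfolding module_sum_def by (auto intro!: M.finsum_closed simp: Pi_iff subset_eq)
  show ?thesis
  proof (rule submoduleI)
    show "module_sum M I N \<subseteq> carrier M" using carr by auto
    show "\<zero>\<^bsub>M\<^esub> \<in> module_sum M I N" unfolding module_sum_def
      by (intro CollectI exI[of _ "\<lambda>_. \<zero>\<^bsub>M\<^esub>"] exI[of _ "{}"]) auto
    fix a assume a: "a \<in> module_sum M I N"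
    show "\<ominus>\<^bsub>M\<^esub> a \<in> module_sum M I N" using smult[OF a, of "\<ominus> \<one>"] carr[OF a] by (simp add: smult_l_minus)
    fix b assume b: "b \<in> module_sum M I N"
    obtain J x where J: "finite J" "J \<subseteq> I" "x \<in> Pi J N" "a = finsum M x J"
      using a unfolding module_sum_def by auto
    have "finsum M x J \<oplus>\<^bsub>M\<^esub> b \<in> module_sum M I N" using J(1-3)
    proof (induction J)
      case empty
      then show ?case using b carr by simp
    next
      case (insert j J)
      then have x: "x j \<in> N j" "x j \<in> carrier M" "x \<in> J \<rightarrow> carrier M" "j \<in> I"
        using c by (auto simp: Pi_iff subset_eq)
      then have "finsum M x (insert j J) \<oplus>\<^bsub>M\<^esub> b = x j \<oplus>\<^bsub>M\<^esub> (finsum M x J \<oplus>\<^bsub>M\<^esub> b)"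
        using insert carr[OF b] M.finsum_closed[OF x(3)] by (simp add: M.a_assoc)
      moreover have "finsum M x J \<oplus>\<^bsub>M\<^esub> b \<in> module_sum M I N" using insert by auto
      ultimately show ?case using module_sum_add[where N = N, OF N _ x(4,1)] by simp
    qed
    then show "a \<oplus>\<^bsub>M\<^esub> b \<in> module_sum M I N" unfolding J(4) .
  qed (use smult in blast)
qed

lemma module_sum_upper:
  assumes "\<And>i. i \<in> I \<Longrightarrow> sub (N i)" "i \<in> I"
  shows "N i \<subseteq> module_sum M I N"
proof
  fix a assume a: "a \<in> N i"
  have "\<zero>\<^bsub>M\<^esub> \<in> module_sum M I N" by (rule sub_zero[OF module_sum_sub]) (rule assms(1))
  then have "a \<oplus>\<^bsub>M\<^esub> \<zero>\<^bsub>M\<^esub> \<in> module_sum M I N"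
    using module_sum_add[where N = N, OF assms(1) _ assms(2) a] by simp
  then show "a \<in> module_sum M I N" using sub_carrier[OF assms(1)[OF assms(2)] a] by simp
qed

lemma module_sum_least:
  assumes U: "sub U" and N: "\<And>i. i \<in> I \<Longrightarrow> N i \<subseteq> U"
  shows "module_sum M I N \<subseteq> U"
proof
  fix a assume "a \<in> module_sum M I N"
  then obtain J x where J: "finite J" "J \<subseteq> I" "x \<in> Pi J N" "a = finsum M x J"
    unfolding module_sum_def by auto
  have "finsum M x J \<in> U" using J(1-3)
  proof (induction J)
    case empty
    then show ?case using sub_zero[OF U] by simp
  next
    case (insert j J)
    then have x: "x j \<in> U" "x \<in> J \<rightarrow> U" using N by (auto simp: Pi_iff subset_eq)
    then have "x \<in> J \<rightarrow> carrier M" "x j \<in> carrier M" using sub_carrier[OF U] by auto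
    then show ?case using insert x sub_add[OF U] by (simp add: M.finsum_insert)
  qed
  then show "a \<in> U" using J by simp
qed

text \<open>The quotient operations are given by unions over representatives. These formulas
  evaluate them on cosets of elements, and later computations in the quotient go through
  them.\<close>

lemma quotient_props:
  assumes D: "sub D"
  shows quotient_carrier: "carrier (quotient_module M D) = (\<lambda>x. D +>\<^bsub>M\<^esub> x) ` carrier M"
    and quotient_eq: "x \<in> carrier M \<Longrightarrow> y \<in> carrier M \<Longrightarrow> D +>\<^bsub>M\<^esub> x = D +>\<^bsub>M\<^esub> y \<longleftrightarrow> (\<exists>d\<in>D. x = d \<oplus>\<^bsub>M\<^esub> y)"
    and quotient_add: "x \<in> carrier M \<Longrightarrow> y \<in> carrier M \<Longrightarrow>
      (D +>\<^bsub>M\<^esub> x) \<oplus>\<^bsub>quotient_module M D\<^esub> (D +>\<^bsub>M\<^esub> y) = D +>\<^bsub>M\<^esub> (x \<oplus>\<^bsub>M\<^esub> y)"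
    and quotient_smult: "r \<in> carrier R \<Longrightarrow> x \<in> carrier M \<Longrightarrow>
      r \<odot>\<^bsub>quotient_module M D\<^esub> (D +>\<^bsub>M\<^esub> x) = D +>\<^bsub>M\<^esub> (r \<odot>\<^bsub>M\<^esub> x)"
    and quotient_zero: "\<zero>\<^bsub>quotient_module M D\<^esub> = D +>\<^bsub>M\<^esub> \<zero>\<^bsub>M\<^esub>"
proof -
  have "additive_subgroup D M" using submodule.axioms(1)[OF D] by (rule additive_subgroupI)
  then interpret D: abelian_subgroup D M by (rule abelian_subgroupI3) (rule M.abelian_group_axioms)
  show "carrier (quotient_module M D) = (\<lambda>x. D +>\<^bsub>M\<^esub> x) ` carrier M"
    unfolding quotient_module_def A_RCOSETS_def' by auto
  show eq: "D +>\<^bsub>M\<^esub> x = D +>\<^bsub>M\<^esub> y \<longleftrightarrow> (\<exists>d\<in>D. x = d \<oplus>\<^bsub>M\<^esub> y)" if "x \<in> carrier M" "y \<in> carrier M" for x y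
  proof
    assume "D +>\<^bsub>M\<^esub> x = D +>\<^bsub>M\<^esub> y"
    then have "x \<in> D +>\<^bsub>M\<^esub> y" using D.a_rcos_self[OF that(1)] by simp
    then show "\<exists>d\<in>D. x = d \<oplus>\<^bsub>M\<^esub> y" unfolding a_r_coset_def' by auto
  next
    assume "\<exists>d\<in>D. x = d \<oplus>\<^bsub>M\<^esub> y"
    then have "x \<in> D +>\<^bsub>M\<^esub> y" unfolding a_r_coset_def' by auto
    then show "D +>\<^bsub>M\<^esub> x = D +>\<^bsub>M\<^esub> y" using D.a_repr_independence'[of x y] that by auto
  qed
  show "(D +>\<^bsub>M\<^esub> x) \<oplus>\<^bsub>quotient_module M D\<^esub> (D +>\<^bsub>M\<^esub> y) = D +>\<^bsub>M\<^esub> (x \<oplus>\<^bsub>M\<^esub> y)"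
    if "x \<in> carrier M" "y \<in> carrier M" for x y
    unfolding quotient_module_def using D.a_rcos_sum that by simp
  show "r \<odot>\<^bsub>quotient_module M D\<^esub> (D +>\<^bsub>M\<^esub> x) = D +>\<^bsub>M\<^esub> (r \<odot>\<^bsub>M\<^esub> x)"
    if r: "r \<in> carrier R" and x: "x \<in> carrier M" for r x
  proof -
    have "D +>\<^bsub>M\<^esub> (r \<odot>\<^bsub>M\<^esub> y) = D +>\<^bsub>M\<^esub> (r \<odot>\<^bsub>M\<^esub> x)" if "y \<in> D +>\<^bsub>M\<^esub> x" for y
    proof -
      obtain d where d: "d \<in> D" "y = d \<oplus>\<^bsub>M\<^esub> x" using \<open>y \<in> _\<close> unfolding a_r_coset_def' by auto
      then have "r \<odot>\<^bsub>M\<^esub> y = r \<odot>\<^bsub>M\<^esub> d \<oplus>\<^bsub>M\<^esub> r \<odot>\<^bsub>M\<^esub> x" using r x sub_carrier[OF D] by (simp add: smult_r_distr)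
      moreover have "r \<odot>\<^bsub>M\<^esub> d \<in> D" using sub_smult[OF D r d(1)] .
      moreover have "r \<odot>\<^bsub>M\<^esub> y \<in> carrier M" "r \<odot>\<^bsub>M\<^esub> x \<in> carrier M" using d r x sub_carrier[OF D] by auto
      ultimately show ?thesis using eq by blast
    qed
    moreover have "x \<in> D +>\<^bsub>M\<^esub> x" using D.a_rcos_self x by auto
    ultimately have "(\<Union>y\<in>D +>\<^bsub>M\<^esub> x. D +>\<^bsub>M\<^esub> (r \<odot>\<^bsub>M\<^esub> y)) = D +>\<^bsub>M\<^esub> (r \<odot>\<^bsub>M\<^esub> x)" by blast
    then show ?thesis unfolding quotient_module_def by simp
  qed
  show "\<zero>\<^bsub>quotient_module M D\<^esub> = D +>\<^bsub>M\<^esub> \<zero>\<^bsub>M\<^esub>"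
    unfolding quotient_module_def using M.a_coset_add_zero[OF submoduleE(1)[OF D]] by simp
qed

lemma quotient_is_module: assumes D: "sub D" shows "module R (quotient_module M D)"
proof (rule moduleI)
  let ?B = "quotient_module M D" and ?q = "\<lambda>x. D +>\<^bsub>M\<^esub> x"
  note q = quotient_props(1,3-5)[OF D]
  show "cring R" by (rule R.is_cring)
  show "abelian_group ?B"
  proof (rule abelian_groupI)
    fix x assume "x \<in> carrier ?B"
    then obtain x' where x': "x' \<in> carrier M" "x = ?q x'" unfolding q by auto
    show "\<zero>\<^bsub>?B\<^esub> \<oplus>\<^bsub>?B\<^esub> x = x" using x' by (simp add: q)
    show "\<exists>y\<in>carrier ?B. y \<oplus>\<^bsub>?B\<^esub> x = \<zero>\<^bsub>?B\<^esub>"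
      by (rule bexI[of _ "?q (\<ominus>\<^bsub>M\<^esub> x')"]) (use x' in \<open>auto simp: q M.l_neg\<close>)
  qed (auto simp: q M.a_ac)
qed (auto simp: quotient_props[OF D] smult_l_distr smult_r_distr smult_assoc1)

lemma quotient_hom: assumes D: "sub D" shows "(\<lambda>x. D +>\<^bsub>M\<^esub> x) \<in> module_hom R M (quotient_module M D)"
  by (rule module_homI) (auto simp: quotient_props[OF D])

text \<open>The correspondence theorem: images and preimages match the submodules of the quotient
  with those above \<open>D\<close>, and both directions preserve that the sum with \<open>N\<close>
  is everything.\<close>

lemma superfluous_quotient:
  assumes D: "sub D" and N: "sub N" and DN: "D \<subseteq> N"
  shows "superfluous R (quotient_module M D) (quotient_submodule M N D) \<longleftrightarrow>
    (\<forall>U. sub U \<and> D \<subseteq> U \<and> N <+>\<^bsub>M\<^esub> U = carrier M \<longrightarrow> U = carrier M)"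
    (is "?L = ?R")
proof -
  let ?B = "quotient_module M D" and ?q = "\<lambda>x. D +>\<^bsub>M\<^esub> x"
  interpret B: module R ?B by (rule quotient_is_module[OF D])
  note q = quotient_props[OF D] and c = sub_carrier[OF N]
  \<comment> \<open>A submodule above \<open>D\<close> is a union of cosets, so membership in it can
    be tested after the quotient map.\<close>
  have closed: "x \<in> U" if "sub U" "D \<subseteq> U" "x \<in> carrier M" "u \<in> U" "?q x = ?q u" for x u U
    using that q(2)[of x u] sub_carrier[OF that(1)] sub_add[OF that(1)] by blast
  show ?thesis
  proof
    assume L: ?L
    show ?R
    proof (intro allI impI, elim conjE)
      fix U assume U: "sub U" "D \<subseteq> U" "N <+>\<^bsub>M\<^esub> U = carrier M"
      have "submodule (?q ` U) R ?B" using hom_image_sub[OF B.module_axioms quotient_hom[OF D] U(1)] .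
      moreover have "quotient_submodule M N D <+>\<^bsub>?B\<^esub> (?q ` U) = carrier ?B"
      proof
        show "quotient_submodule M N D <+>\<^bsub>?B\<^esub> (?q ` U) \<subseteq> carrier ?B"
          unfolding B.mem_set_add quotient_submodule_def subset_eq
          using c sub_carrier[OF U(1)] by (auto simp: B.mem_set_add q)
        show "carrier ?B \<subseteq> quotient_submodule M N D <+>\<^bsub>?B\<^esub> (?q ` U)"
        proof
          fix y assume "y \<in> carrier ?B"
          then obtain x where x: "x \<in> carrier M" "y = ?q x" unfolding q by auto
          then obtain n u where "n \<in> N" "u \<in> U" "x = n \<oplus>\<^bsub>M\<^esub> u" using U(3) mem_set_add by blast
          then have "y = ?q n \<oplus>\<^bsub>?B\<^esub> ?q u" "?q n \<in> quotient_submodule M N D"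
            unfolding quotient_submodule_def using x c sub_carrier[OF U(1)] by (auto simp: q)
          then show "y \<in> quotient_submodule M N D <+>\<^bsub>?B\<^esub> (?q ` U)"
            unfolding B.mem_set_add using \<open>u \<in> U\<close> by blast
        qed
      qed
      ultimately have "?q ` U = carrier ?B" using L unfolding superfluous_def by blast
      then have "?q x \<in> ?q ` U" if "x \<in> carrier M" for x using that q(1) by auto
      then show "U = carrier M" using closed[OF U(1,2)] sub_carrier[OF U(1)] by blast
    qed
  next
    assume R: ?R
    show ?L unfolding superfluous_def
    proof (intro conjI allI impI, goal_cases)
      case 1
      show ?case unfolding quotient_submodule_def
        using hom_image_sub[OF B.module_axioms quotient_hom[OF D] N] .
    next
      case (2 V)
      then have V: "submodule V R ?B" "quotient_submodule M N D <+>\<^bsub>?B\<^esub> V = carrier ?B" by auto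
      let ?U = "{x \<in> carrier M. ?q x \<in> V}"
      have U: "sub ?U" using hom_preimage_sub[OF B.module_axioms quotient_hom[OF D] V(1)] .
      have DU: "D \<subseteq> ?U"
      proof
        fix d assume d: "d \<in> D"
        then have dc: "d \<in> carrier M" using sub_carrier[OF D] by auto
        then have "?q d = ?q \<zero>\<^bsub>M\<^esub>" using q(2)[of d "\<zero>\<^bsub>M\<^esub>"] bexI[of "\<lambda>e. d = e \<oplus>\<^bsub>M\<^esub> \<zero>\<^bsub>M\<^esub>" d D] d by auto
        then show "d \<in> ?U" using dc B.sub_zero[OF V(1)] q(5) by auto
      qed
      have "carrier M \<subseteq> N <+>\<^bsub>M\<^esub> ?U"
      proof
        fix x assume x: "x \<in> carrier M"
        then have "?q x \<in> quotient_submodule M N D <+>\<^bsub>?B\<^esub> V" using V(2) q(1) by auto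
        then obtain n v where nv: "n \<in> N" "v \<in> V" "?q x = ?q n \<oplus>\<^bsub>?B\<^esub> v"
          unfolding B.mem_set_add quotient_submodule_def by auto
        then obtain y where y: "y \<in> carrier M" "v = ?q y" using B.sub_carrier[OF V(1)] q(1) by auto
        have "n \<oplus>\<^bsub>M\<^esub> y \<in> N <+>\<^bsub>M\<^esub> ?U" unfolding mem_set_add using nv y by blast
        moreover have "?q x = ?q (n \<oplus>\<^bsub>M\<^esub> y)" using nv y c by (simp add: q)
        ultimately show "x \<in> N <+>\<^bsub>M\<^esub> ?U"
          using closed[OF sub_sum[OF N U] _ x] DN sum_upper1[OF N U] by blast
      qed
      then have "?U = carrier M" using R U DU submoduleE(1)[OF sub_sum[OF N U]] by blast
      then have "carrier ?B \<subseteq> V" unfolding q(1) by auto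
      then show ?case using B.submoduleE(1)[OF V(1)] by auto
    qed
  qed
qed

lemma lies_above_iff:
  assumes "sub N"
  shows "lies_above_direct_summand R M N \<longleftrightarrow> above_summand R M N"
proof -
  have "D \<subseteq> N \<Longrightarrow> dsum D E \<Longrightarrow> superfluous R (quotient_module M D) (quotient_submodule M N D) \<longleftrightarrow>
    (\<forall>U. sub U \<and> D \<subseteq> U \<and> N <+>\<^bsub>M\<^esub> U = carrier M \<longrightarrow> U = carrier M)" for D E
    using superfluous_quotient[OF _ assms] dsumD(1) by blast
  then show ?thesis
    unfolding lies_above_direct_summand_def above_summand_def direct_summand_def by blast
qed

text \<open>For an image generated \<open>N\<close>, the endomorphisms with image in
  \<open>N\<close>, indexed by themselves, form a family whose sum is \<open>N\<close>. Conversely,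
  the sum of a family contains each image of the family and so is generated by the images it
  contains.\<close>

lemma dual_self_CS_Baer_iff: "dual_self_CS_Baer R M \<longleftrightarrow> CS_Baer R M"
proof
  assume "dual_self_CS_Baer R M"
  then interpret dual_self_CS_Baer R M .
  show "CS_Baer R M" unfolding CS_Baer_def
  proof (intro allI impI)
    fix N assume N: "image_generated R M N"
    let ?I = "{f \<in> End. f ` carrier M \<subseteq> N}"
    let ?S = "module_sum M ?I (\<lambda>f. f ` carrier M)"
    have im: "sub (f ` carrier M)" if "f \<in> ?I" for f using image_sub carrier_is_submodule that by auto
    have "N \<subseteq> ?S"
      using N module_sum_sub[of ?I "\<lambda>f. f ` carrier M"] module_sum_upper[of ?I "\<lambda>f. f ` carrier M"] im
      unfolding image_generated_def by blast
    moreover have "?S \<subseteq> N"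
      by (rule module_sum_least) (use N in \<open>auto simp: image_generated_def\<close>)
    moreover have "lies_above_direct_summand R M ?S"
      using sum_of_images_lies_above[of "\<lambda>f. f" ?I] by auto
    ultimately show "above_summand R M N"
      using lies_above_iff N unfolding image_generated_def by auto
  qed
next
  assume B: "CS_Baer R M"
  show "dual_self_CS_Baer R M"
  proof
    fix I :: "('c \<Rightarrow> 'c) set" and f assume f: "f \<in> I \<rightarrow> End"
    let ?S = "module_sum M I (\<lambda>i. f i ` carrier M)"
    have im: "sub (f i ` carrier M)" if "i \<in> I" for i using image_sub carrier_is_submodule that f by auto
    have S: "sub ?S" using module_sum_sub[of I "\<lambda>i. f i ` carrier M"] im by auto
    have "f i ` carrier M \<subseteq> ?S" if "i \<in> I" for i
      using module_sum_upper[of I "\<lambda>i. f i ` carrier M"] im that by auto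
    then have "?S \<subseteq> U" if "sub U" "\<forall>g\<in>End. g ` carrier M \<subseteq> ?S \<longrightarrow> g ` carrier M \<subseteq> U" for U
      using module_sum_least[of U I "\<lambda>i. f i ` carrier M"] that f by blast
    then have "image_generated R M ?S"
      unfolding image_generated_def using S by blast
    then show "lies_above_direct_summand R M ?S" using B lies_above_iff[OF S] unfolding CS_Baer_def by auto
  qed
qed

end

text \<open>The two base rings may differ. Scalars enter \<open>CS_Baer\<close> only through
  submodules and endomorphisms, which allows \<open>R\<close> to be exchanged for a
  localization.\<close>

lemma CS_Baer_cong:
  assumes "carrier M = carrier N" "add M = add N" "\<zero>\<^bsub>M\<^esub> = \<zero>\<^bsub>N\<^esub>"
    and sub: "\<And>A. submodule A R M \<longleftrightarrow> submodule A S N"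
    and "module_hom R M M = module_hom S N N"
  shows "CS_Baer R M \<longleftrightarrow> CS_Baer S N"
proof -
  have "set_add M A B = set_add N A B" for A B unfolding set_add_def' assms(2) ..
  then show ?thesis
    unfolding CS_Baer_def image_generated_def above_summand_def direct_sum_decomposition_def
    using assms by simp
qed


section \<open>Torsion and primary parts\<close>

context dedekind_module begin

abbreviation tor :: "'c set" where "tor \<equiv> torsion R M"
abbreviation prim :: "'a set \<Rightarrow> 'c set" where "prim \<equiv> primary_part R M"

lemma mem_torsion: "x \<in> tor \<longleftrightarrow> x \<in> carrier M \<and> (\<exists>r\<in>carrier R. r \<noteq> \<zero> \<and> r \<odot>\<^bsub>M\<^esub> x = \<zero>\<^bsub>M\<^esub>)"
  unfolding torsion_def using smult_l_null R.zero_closed by blast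

lemma torsion_sub: "sub tor"
proof (rule submoduleI)
  show "tor \<subseteq> carrier M" using mem_torsion by auto
  show "\<zero>\<^bsub>M\<^esub> \<in> tor" unfolding mem_torsion using R.one_closed R.one_not_zero smult_r_null by blast
  fix x assume "x \<in> tor"
  then obtain r where r: "x \<in> carrier M" "r \<in> carrier R" "r \<noteq> \<zero>" "r \<odot>\<^bsub>M\<^esub> x = \<zero>\<^bsub>M\<^esub>" unfolding mem_torsion by auto
  then have "r \<odot>\<^bsub>M\<^esub> (\<ominus>\<^bsub>M\<^esub> x) = \<zero>\<^bsub>M\<^esub>" by (simp add: smult_r_minus)
  then show "\<ominus>\<^bsub>M\<^esub> x \<in> tor" unfolding mem_torsion using r by blast
  { fix a assume a: "a \<in> carrier R"
    have "r \<odot>\<^bsub>M\<^esub> (a \<odot>\<^bsub>M\<^esub> x) = a \<odot>\<^bsub>M\<^esub> (r \<odot>\<^bsub>M\<^esub> x)" using r(1,2) a by (simp add: smult_assoc1[symmetric] R.m_comm)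
    then have "r \<odot>\<^bsub>M\<^esub> (a \<odot>\<^bsub>M\<^esub> x) = \<zero>\<^bsub>M\<^esub>" using r a by simp
    then show "a \<odot>\<^bsub>M\<^esub> x \<in> tor" unfolding mem_torsion using r a by blast }
  fix y assume "y \<in> tor"
  then obtain s where s: "y \<in> carrier M" "s \<in> carrier R" "s \<noteq> \<zero>" "s \<odot>\<^bsub>M\<^esub> y = \<zero>\<^bsub>M\<^esub>" unfolding mem_torsion by auto
  have "(r \<otimes> s) \<odot>\<^bsub>M\<^esub> (x \<oplus>\<^bsub>M\<^esub> y) = s \<odot>\<^bsub>M\<^esub> (r \<odot>\<^bsub>M\<^esub> x) \<oplus>\<^bsub>M\<^esub> r \<odot>\<^bsub>M\<^esub> (s \<odot>\<^bsub>M\<^esub> y)"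
    using r(1,2) s(1,2) by (simp add: smult_r_distr smult_assoc1[symmetric] R.m_comm)
  then have "(r \<otimes> s) \<odot>\<^bsub>M\<^esub> (x \<oplus>\<^bsub>M\<^esub> y) = \<zero>\<^bsub>M\<^esub>" using r s by simp
  moreover have "r \<otimes> s \<noteq> \<zero>" using r s R.integral by blast
  ultimately show "x \<oplus>\<^bsub>M\<^esub> y \<in> tor" unfolding mem_torsion using r s by blast
qed

text \<open>The part killed by the \<open>n\<close>-th power of \<open>p\<close>. Primary parts are
  unions of these layers, so facts about them can be proved by induction on
  \<open>n\<close>.\<close>

definition layer :: "'a set \<Rightarrow> nat \<Rightarrow> 'c set" where
  "layer p n = {x \<in> carrier M. \<forall>r \<in> p [^]\<^bsub>ideals_set R\<^esub> n. r \<odot>\<^bsub>M\<^esub> x = \<zero>\<^bsub>M\<^esub>}"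

lemma primary_part_layers: "prim p = (\<Union>n. layer p n)"
  unfolding primary_part_def layer_def by auto

lemma layer_0: "layer p 0 = {\<zero>\<^bsub>M\<^esub>}"
proof -
  have "p [^]\<^bsub>ideals_set R\<^esub> (0::nat) = carrier R" by (simp add: nat_pow_def ideals_set_def)
  then have "x \<in> layer p 0 \<longleftrightarrow> x = \<zero>\<^bsub>M\<^esub>" for x
    unfolding layer_def using R.one_closed smult_one[of x] by force
  then show ?thesis by auto
qed

lemma prime_power_Suc:
  "p [^]\<^bsub>ideals_set R\<^esub> Suc n = ideal_prod R (p [^]\<^bsub>ideals_set R\<^esub> n) p"
  by (simp add: nat_pow_def ideals_set_def)

lemma prime_power_subset: assumes "p \<in> P" shows "p [^]\<^bsub>ideals_set R\<^esub> (n::nat) \<subseteq> carrier R"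
proof -
  have "ideal p R" using primeD(1)[OF assms] primeideal.axioms(1) by blast
  then have "ideal (p [^]\<^bsub>ideals_set R\<^esub> n) R"
  proof (induction n)
    case 0
    then show ?case using oneideal by (simp add: nat_pow_def ideals_set_def)
  next
    case (Suc n)
    then show ?case unfolding prime_power_Suc by (intro ideal_prod_is_ideal)
  qed
  then show ?thesis using ideal.Icarr[of "p [^]\<^bsub>ideals_set R\<^esub> n" R] by auto
qed

text \<open>The ideal \<open>p^n p\<close> is generated additively by products \<open>r c\<close>,
  so it kills \<open>x\<close> iff \<open>p^n\<close> kills each \<open>c x\<close> with
  \<open>c\<close> in \<open>p\<close>. This recursion replaces most reasoning about powers of
  ideals.\<close>

lemma layer_Suc: assumes p: "p \<in> P" shows "layer p (Suc n) = {x \<in> carrier M. \<forall>c\<in>p. c \<odot>\<^bsub>M\<^esub> x \<in> layer p n}"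
proof -
  let ?Q = "p [^]\<^bsub>ideals_set R\<^esub> n"
  note c = primeD(4)[OF p] prime_power_subset[OF p, of n]
  have "(\<forall>r\<in>ideal_prod R ?Q p. r \<odot>\<^bsub>M\<^esub> x = \<zero>\<^bsub>M\<^esub>) \<longleftrightarrow> (\<forall>c\<in>p. \<forall>r\<in>?Q. r \<odot>\<^bsub>M\<^esub> (c \<odot>\<^bsub>M\<^esub> x) = \<zero>\<^bsub>M\<^esub>)" if x: "x \<in> carrier M" for x
  proof
    assume l: "\<forall>r\<in>ideal_prod R ?Q p. r \<odot>\<^bsub>M\<^esub> x = \<zero>\<^bsub>M\<^esub>"
    show "\<forall>c\<in>p. \<forall>r\<in>?Q. r \<odot>\<^bsub>M\<^esub> (c \<odot>\<^bsub>M\<^esub> x) = \<zero>\<^bsub>M\<^esub>"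
    proof (intro ballI)
      fix a r assume ar: "a \<in> p" "r \<in> ?Q"
      then have "(r \<otimes> a) \<odot>\<^bsub>M\<^esub> x = \<zero>\<^bsub>M\<^esub>" using l ideal_prod.prod[of r ?Q a p R] by auto
      then show "r \<odot>\<^bsub>M\<^esub> (a \<odot>\<^bsub>M\<^esub> x) = \<zero>\<^bsub>M\<^esub>" using x ar c by (simp add: smult_assoc1 subset_eq)
    qed
  next
    assume r: "\<forall>c\<in>p. \<forall>r\<in>?Q. r \<odot>\<^bsub>M\<^esub> (c \<odot>\<^bsub>M\<^esub> x) = \<zero>\<^bsub>M\<^esub>"
    have "k \<in> carrier R \<and> k \<odot>\<^bsub>M\<^esub> x = \<zero>\<^bsub>M\<^esub>" if "k \<in> ideal_prod R ?Q p" for k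
      using that
    proof (induction k)
      case (prod i j)
      then show ?case using r c x by (auto simp: smult_assoc1 subset_eq)
    next
      case (sum i j)
      then show ?case using x by (auto simp: smult_l_distr)
    qed
    then show "\<forall>r\<in>ideal_prod R ?Q p. r \<odot>\<^bsub>M\<^esub> x = \<zero>\<^bsub>M\<^esub>" by auto
  qed
  note eq = this
  have "x \<in> layer p (Suc n) \<longleftrightarrow> x \<in> {x \<in> carrier M. \<forall>c\<in>p. c \<odot>\<^bsub>M\<^esub> x \<in> layer p n}" for x
    unfolding layer_def prime_power_Suc using eq[of x] c(1) by auto
  then show ?thesis by auto
qed

lemma layer_sub: "p \<in> P \<Longrightarrow> sub (layer p n)"
proof (induction n)
  case 0
  then show ?case using layer_0 sub_zero_singleton by simp
next
  case (Suc n)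
  have cc: "c \<in> p \<Longrightarrow> c \<in> carrier R" for c using primeD(4)[OF Suc(2)] by auto
  note IH = Suc(1)[OF Suc(2)]
  show ?case unfolding layer_Suc[OF Suc(2)]
  proof (rule submoduleI)
    fix a x assume a: "a \<in> carrier R" "x \<in> {x \<in> carrier M. \<forall>c\<in>p. c \<odot>\<^bsub>M\<^esub> x \<in> layer p n}"
    have "c \<odot>\<^bsub>M\<^esub> (a \<odot>\<^bsub>M\<^esub> x) = a \<odot>\<^bsub>M\<^esub> (c \<odot>\<^bsub>M\<^esub> x)" if "c \<in> p" for c
      using a cc[OF that] by (simp add: smult_assoc1[symmetric] R.m_comm)
    then show "a \<odot>\<^bsub>M\<^esub> x \<in> {x \<in> carrier M. \<forall>c\<in>p. c \<odot>\<^bsub>M\<^esub> x \<in> layer p n}" using a sub_smult[OF IH] by auto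
  qed (auto simp: cc smult_r_minus smult_r_distr sub_zero[OF IH] sub_neg[OF IH] sub_add[OF IH])
qed

lemma layer_mono: "p \<in> P \<Longrightarrow> layer p n \<subseteq> layer p (Suc n)"
  unfolding layer_Suc using sub_smult[OF layer_sub] sub_carrier[OF layer_sub] primeD(4) by blast

lemma primary_sub: assumes "p \<in> P" shows "sub (prim p)"
  unfolding primary_part_layers
proof (rule sub_Union_chain)
  have "m \<le> n \<Longrightarrow> layer p m \<subseteq> layer p n" for m n
    using layer_mono[OF assms] by (rule lift_Suc_mono_le)
  then have "layer p m \<subseteq> layer p n \<or> layer p n \<subseteq> layer p m" for m n
    using nat_le_linear[of m n] by blast
  then show "U \<subseteq> V \<or> V \<subseteq> U" if "U \<in> range (layer p)" "V \<in> range (layer p)" for U V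
    using that by auto
qed (use layer_sub[OF assms] in auto)

text \<open>Induction along the layers with the index hidden: multiplication by an element of
  \<open>p\<close> descends by one layer, and the bottom layer is zero.\<close>

lemma primary_induct [consumes 2, case_names zero step]:
  assumes p: "p \<in> P" and x: "x \<in> prim p" and zero: "Q \<zero>\<^bsub>M\<^esub>"
    and step: "\<And>x. x \<in> prim p \<Longrightarrow> (\<And>c. c \<in> p \<Longrightarrow> c \<odot>\<^bsub>M\<^esub> x \<in> prim p) \<Longrightarrow> (\<And>c. c \<in> p \<Longrightarrow> Q (c \<odot>\<^bsub>M\<^esub> x)) \<Longrightarrow> Q x"
  shows "Q x"
proof -
  obtain n where "x \<in> layer p n" using x primary_part_layers by auto
  then show ?thesis
  proof (induction n arbitrary: x)
    case 0
    then show ?case using layer_0 zero by auto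
  next
    case (Suc n)
    then have "c \<odot>\<^bsub>M\<^esub> x \<in> layer p n" if "c \<in> p" for c using layer_Suc[OF p] that by auto
    then show ?case using step[of x] Suc primary_part_layers by blast
  qed
qed

text \<open>Modulo \<open>p\<close> the element \<open>t\<close> is invertible, say
  \<open>c + u t = 1\<close> with \<open>c\<close> in \<open>p\<close>. Then
  \<open>x = c x + u t x\<close>, and \<open>c x\<close> is covered by induction. The inverse at
  \<open>x\<close> is an element of \<open>R\<close>, so dividing by \<open>t\<close> never leaves a
  submodule.\<close>

lemma primary_invertible:
  assumes p: "p \<in> P" and t: "t \<in> carrier R - p" and x: "x \<in> prim p"
  shows "\<exists>r\<in>carrier R. x = r \<odot>\<^bsub>M\<^esub> (t \<odot>\<^bsub>M\<^esub> x)"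
  using p x
proof (induction rule: primary_induct)
  case zero
  show ?case using t by (intro bexI[of _ \<zero>]) auto
next
  case (step x)
  have xc: "x \<in> carrier M" using sub_carrier[OF primary_sub[OF p]] step by auto
  have "t \<in> PIdl t" "ideal (PIdl t) R" using t cgenideal_self cgenideal_ideal by auto
  then obtain c u' where c: "c \<in> p" "u' \<in> PIdl t" "c \<oplus> u' = \<one>"
    using coprime_split[OF primeD(3)[OF p]] t by (metis DiffD2 subsetD)
  then obtain u where u: "u \<in> carrier R" "u' = u \<otimes> t" unfolding cgenideal_def by auto
  have cc: "c \<in> carrier R" using c primeD(4)[OF p] by auto
  obtain r where r: "r \<in> carrier R" "c \<odot>\<^bsub>M\<^esub> x = r \<odot>\<^bsub>M\<^esub> (t \<odot>\<^bsub>M\<^esub> (c \<odot>\<^bsub>M\<^esub> x))" using step c by blast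
  have "x = (c \<oplus> u \<otimes> t) \<odot>\<^bsub>M\<^esub> x" using c u xc by simp
  also have "\<dots> = c \<odot>\<^bsub>M\<^esub> x \<oplus>\<^bsub>M\<^esub> u \<odot>\<^bsub>M\<^esub> (t \<odot>\<^bsub>M\<^esub> x)" using cc u t xc by (simp add: smult_l_distr smult_assoc1)
  also have "c \<odot>\<^bsub>M\<^esub> x = (r \<otimes> c) \<odot>\<^bsub>M\<^esub> (t \<odot>\<^bsub>M\<^esub> x)"
    by (subst r(2)) (use r(1) t cc xc in \<open>simp add: smult_assoc1[symmetric] R.m_ac\<close>)
  also have "(r \<otimes> c) \<odot>\<^bsub>M\<^esub> (t \<odot>\<^bsub>M\<^esub> x) \<oplus>\<^bsub>M\<^esub> u \<odot>\<^bsub>M\<^esub> (t \<odot>\<^bsub>M\<^esub> x) = (r \<otimes> c \<oplus> u) \<odot>\<^bsub>M\<^esub> (t \<odot>\<^bsub>M\<^esub> x)"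
    using r(1) t cc xc u by (simp add: smult_l_distr)
  finally show ?case using r(1) cc u by (intro bexI[of _ "r \<otimes> c \<oplus> u"]) auto
qed

lemma primary_cancel:
  assumes "p \<in> P" "t \<in> carrier R - p" "x \<in> prim p" "sub U" "t \<odot>\<^bsub>M\<^esub> x \<in> U"
  shows "x \<in> U"
  using primary_invertible[OF assms(1-3)] sub_smult[OF assms(4) _ assms(5)] by metis

lemma primary_torsion: assumes p: "p \<in> P" shows "prim p \<subseteq> tor"
proof
  fix x assume "x \<in> prim p"
  with p show "x \<in> tor"
  proof (induction rule: primary_induct)
    case zero
    show ?case using sub_zero[OF torsion_sub] .
  next
    case (step x)
    have xc: "x \<in> carrier M" using sub_carrier[OF primary_sub[OF p]] step by auto
    obtain a where a: "a \<in> p" "a \<noteq> \<zero>" using primeD(2,5)[OF p] by blast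
    then have ac: "a \<in> carrier R" using primeD(4)[OF p] by auto
    obtain r where r: "r \<in> carrier R" "r \<noteq> \<zero>" "r \<odot>\<^bsub>M\<^esub> (a \<odot>\<^bsub>M\<^esub> x) = \<zero>\<^bsub>M\<^esub>" using step a mem_torsion by blast
    then have "(r \<otimes> a) \<odot>\<^bsub>M\<^esub> x = \<zero>\<^bsub>M\<^esub>" "r \<otimes> a \<noteq> \<zero>" using a ac xc R.integral by (auto simp: smult_assoc1)
    then show ?case unfolding mem_torsion using r ac xc by blast
  qed
qed

text \<open>Each multiplication by an element of \<open>p\<close> outside \<open>q\<close> descends
  by one layer; a product of such elements stays outside \<open>q\<close> and eventually kills
  \<open>x\<close>.\<close>

lemma primary_other_prime:
  assumes p: "p \<in> P" and q: "q \<in> P" "q \<noteq> p" and x: "x \<in> prim p"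
  shows "\<exists>s\<in>carrier R - q. s \<odot>\<^bsub>M\<^esub> x = \<zero>\<^bsub>M\<^esub>"
  using p x
proof (induction rule: primary_induct)
  case zero
  show ?case using primeD(6)[OF q(1)] by (intro bexI[of _ \<one>]) auto
next
  case (step x)
  have xc: "x \<in> carrier M" using sub_carrier[OF primary_sub[OF p]] step by auto
  obtain t where t: "t \<in> p" "t \<in> carrier R - q" using prime_not_subset[OF q(1) p] q by auto
  obtain s where s: "s \<in> carrier R - q" "s \<odot>\<^bsub>M\<^esub> (t \<odot>\<^bsub>M\<^esub> x) = \<zero>\<^bsub>M\<^esub>" using step t by blast
  then have "(s \<otimes> t) \<odot>\<^bsub>M\<^esub> x = \<zero>\<^bsub>M\<^esub>" using t xc by (simp add: smult_assoc1)
  then show ?case using prime_mult_notin[OF q(1) s(1) t(2)] by auto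
qed

lemma power_notin_prime: "p \<in> P \<Longrightarrow> s \<in> carrier R - p \<Longrightarrow> s [^] (n::nat) \<in> carrier R - p"
proof (induction n)
  case 0
  then show ?case using primeD(6) by auto
next
  case (Suc n)
  then show ?case using prime_mult_notin[of p "s [^] n" s] by simp
qed

text \<open>For the uniformizer \<open>a\<close>, the annihilators of \<open>a^n x\<close> become
  stationary at an ideal not inside \<open>p\<close>. So \<open>a^n\<close> kills a multiple of
  \<open>x\<close> by an element outside \<open>p\<close>, and a power of \<open>s\<close> then
  replaces \<open>a^n\<close> by all of \<open>p^n\<close>.\<close>

lemma torsion_local:
  assumes x: "x \<in> tor" and p: "p \<in> P"
  shows "\<exists>s\<in>carrier R - p. s \<odot>\<^bsub>M\<^esub> x \<in> prim p"
proof -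
  note pD = primeD[OF p]
  obtain a s where as: "a \<in> p" "a \<noteq> \<zero>" "s \<in> carrier R" "s \<notin> p"
    "\<And>x. x \<in> p \<Longrightarrow> \<exists>r\<in>carrier R. s \<otimes> x = r \<otimes> a"
    using local_uniformizer[OF pD(1,2)] by blast
  have ac: "a \<in> carrier R" using as pD by auto
  \<comment> \<open>Because \<open>s p\<close> lies in \<open>R a\<close>, each factor
    \<open>s\<close> exchanges an element of \<open>p\<close> for a multiple of
    \<open>a\<close>.\<close>
  have kill: "s [^] n \<odot>\<^bsub>M\<^esub> y \<in> layer p n" if "y \<in> carrier M" "a [^] n \<odot>\<^bsub>M\<^esub> y = \<zero>\<^bsub>M\<^esub>" for n :: nat and y
    using that
  proof (induction n arbitrary: y)
    case 0
    then show ?case using layer_0 by simp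
  next
    case (Suc n)
    have "a [^] n \<odot>\<^bsub>M\<^esub> (a \<odot>\<^bsub>M\<^esub> y) = \<zero>\<^bsub>M\<^esub>" using Suc(2,3) ac by (simp add: smult_assoc1)
    then have IH: "s [^] n \<odot>\<^bsub>M\<^esub> (a \<odot>\<^bsub>M\<^esub> y) \<in> layer p n" using Suc(1,2) ac by auto
    have "c \<odot>\<^bsub>M\<^esub> (s [^] Suc n \<odot>\<^bsub>M\<^esub> y) \<in> layer p n" if c: "c \<in> p" for c
    proof -
      have cc: "c \<in> carrier R" using c pD by auto
      obtain k where k: "k \<in> carrier R" "s \<otimes> c = k \<otimes> a" using as(5)[OF c] by auto
      have "c \<odot>\<^bsub>M\<^esub> (s [^] Suc n \<odot>\<^bsub>M\<^esub> y) = s [^] n \<odot>\<^bsub>M\<^esub> ((s \<otimes> c) \<odot>\<^bsub>M\<^esub> y)"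
        using cc as(3) Suc(2) by (simp add: smult_assoc1[symmetric] R.m_ac)
      also have "\<dots> = k \<odot>\<^bsub>M\<^esub> (s [^] n \<odot>\<^bsub>M\<^esub> (a \<odot>\<^bsub>M\<^esub> y))"
        unfolding k(2) using k(1) ac as(3) Suc(2) by (simp add: smult_assoc1[symmetric] R.m_ac)
      finally show ?thesis using sub_smult[OF layer_sub[OF p] k(1) IH] by simp
    qed
    then show ?case unfolding layer_Suc[OF p] using as(3) Suc(2) by auto
  qed
  have xc: "x \<in> carrier M" using x mem_torsion by auto
  define H where "H n = {r \<in> carrier R. r \<odot>\<^bsub>M\<^esub> (a [^] n \<odot>\<^bsub>M\<^esub> x) \<in> {\<zero>\<^bsub>M\<^esub>}}" for n :: nat
  have H: "ideal (H n) R" for n unfolding H_def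
    by (rule colon_ideal[OF sub_zero_singleton]) (use xc ac in auto)
  have HS: "r \<in> H (Suc n) \<longleftrightarrow> r \<in> carrier R \<and> r \<otimes> a \<in> H n" for r n
    unfolding H_def using xc ac by (auto simp: smult_assoc1[symmetric] R.m_ac)
  have "H n \<subseteq> H (Suc n)" for n
  proof
    fix r assume r: "r \<in> H n"
    then have "r \<otimes> a \<in> H n" using ideal.I_r_closed[OF H] ac by auto
    then show "r \<in> H (Suc n)" using HS r unfolding H_def by auto
  qed
  then obtain n where n: "H (Suc n) = H n" using ideal_sequence_stationary[of H] H by blast
  have "\<not> H n \<subseteq> p"
  proof
    assume sb: "H n \<subseteq> p"
    obtain z where z: "z \<in> carrier R" "primeideal {r \<in> carrier R. r \<otimes> z \<in> H n} R"
      "{r \<in> carrier R. r \<otimes> z \<in> H n} \<subseteq> p"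
      using prime_colon[OF H sb pD(1)] by blast
    let ?c = "{r \<in> carrier R. r \<otimes> z \<in> H n}"
    obtain h where h: "h \<in> carrier R" "h \<noteq> \<zero>" "h \<odot>\<^bsub>M\<^esub> x = \<zero>\<^bsub>M\<^esub>" using x mem_torsion by auto
    have "h \<otimes> z \<odot>\<^bsub>M\<^esub> (a [^] n \<odot>\<^bsub>M\<^esub> x) = (z \<otimes> a [^] n) \<odot>\<^bsub>M\<^esub> (h \<odot>\<^bsub>M\<^esub> x)"
      using h(1) z(1) ac xc by (simp add: smult_assoc1[symmetric] R.m_ac)
    then have "h \<in> ?c" unfolding H_def using h z ac by auto
    then have "?c \<noteq> {\<zero>}" using h(2) by blast
    \<comment> \<open>The prime contains the nonzero \<open>h\<close>, so it is \<open>p\<close> and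
      contains \<open>a\<close>. Hence \<open>a z\<close> lies in \<open>H n\<close>, stationarity
      brings \<open>z\<close> into \<open>H n\<close>, and the prime would contain one.\<close>
    then have c: "?c = p" using nonzero_prime_eq[OF z(2) _ pD(1) z(3)] by auto
    then have "a \<otimes> z \<in> H n" using as(1) by auto
    then have "z \<in> H (Suc n)" using HS z ac by (simp add: R.m_comm)
    then have "\<one> \<in> ?c" using n z by auto
    then show False using c pD(6) by auto
  qed
  then obtain t where t: "t \<in> carrier R - p" "t \<odot>\<^bsub>M\<^esub> (a [^] n \<odot>\<^bsub>M\<^esub> x) = \<zero>\<^bsub>M\<^esub>" unfolding H_def by auto
  then have "a [^] n \<odot>\<^bsub>M\<^esub> (t \<odot>\<^bsub>M\<^esub> x) = \<zero>\<^bsub>M\<^esub>" using xc ac by (simp add: smult_assoc1[symmetric] R.m_comm)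
  then have "s [^] n \<odot>\<^bsub>M\<^esub> (t \<odot>\<^bsub>M\<^esub> x) \<in> layer p n" using kill[of "t \<odot>\<^bsub>M\<^esub> x" n] t xc by auto
  then have "(s [^] n \<otimes> t) \<odot>\<^bsub>M\<^esub> x \<in> prim p"
    unfolding primary_part_layers using t xc as by (auto simp: smult_assoc1)
  moreover have "s [^] n \<otimes> t \<in> carrier R - p"
    using prime_mult_notin[OF p power_notin_prime[OF p] t(1)] as by auto
  ultimately show ?thesis by blast
qed

text \<open>The submodule of the torsion part with prescribed primary parts \<open>D p\<close>.\<close>

definition glue :: "('a set \<Rightarrow> 'c set) \<Rightarrow> 'c set" where
  "glue D = {x \<in> carrier M. \<forall>p\<in>P. \<exists>s\<in>carrier R - p. s \<odot>\<^bsub>M\<^esub> x \<in> D p}"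

text \<open>The elements that lie in \<open>D\<close> up to a denominator at \<open>p\<close>. Two
  of them share the product of their denominators, which is outside \<open>p\<close> again.\<close>

lemma local_sub:
  assumes p: "p \<in> P" and D: "sub D"
  shows "sub {x \<in> carrier M. \<exists>s\<in>carrier R - p. s \<odot>\<^bsub>M\<^esub> x \<in> D}"
proof (rule submoduleI)
  show "\<zero>\<^bsub>M\<^esub> \<in> {x \<in> carrier M. \<exists>s\<in>carrier R - p. s \<odot>\<^bsub>M\<^esub> x \<in> D}"
    using primeD(6)[OF p] sub_zero[OF D] by (auto intro!: bexI[of _ \<one>])
  fix x assume "x \<in> {x \<in> carrier M. \<exists>s\<in>carrier R - p. s \<odot>\<^bsub>M\<^esub> x \<in> D}"
  then obtain s where s: "x \<in> carrier M" "s \<in> carrier R - p" "s \<odot>\<^bsub>M\<^esub> x \<in> D" by auto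
  have "s \<odot>\<^bsub>M\<^esub> (\<ominus>\<^bsub>M\<^esub> x) \<in> D" using s sub_neg[OF D] by (simp add: smult_r_minus)
  then show "\<ominus>\<^bsub>M\<^esub> x \<in> {x \<in> carrier M. \<exists>s\<in>carrier R - p. s \<odot>\<^bsub>M\<^esub> x \<in> D}" using s by auto
  { fix a assume a: "a \<in> carrier R"
    have "s \<odot>\<^bsub>M\<^esub> (a \<odot>\<^bsub>M\<^esub> x) = a \<odot>\<^bsub>M\<^esub> (s \<odot>\<^bsub>M\<^esub> x)" using a s by (simp add: smult_assoc1[symmetric] R.m_comm)
    then show "a \<odot>\<^bsub>M\<^esub> x \<in> {x \<in> carrier M. \<exists>s\<in>carrier R - p. s \<odot>\<^bsub>M\<^esub> x \<in> D}"
      using sub_smult[OF D a s(3)] s(1,2) a by (auto intro!: bexI[of _ s]) }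
  fix y assume "y \<in> {x \<in> carrier M. \<exists>s\<in>carrier R - p. s \<odot>\<^bsub>M\<^esub> x \<in> D}"
  then obtain t where t: "y \<in> carrier M" "t \<in> carrier R - p" "t \<odot>\<^bsub>M\<^esub> y \<in> D" by auto
  have "(s \<otimes> t) \<odot>\<^bsub>M\<^esub> (x \<oplus>\<^bsub>M\<^esub> y) = t \<odot>\<^bsub>M\<^esub> (s \<odot>\<^bsub>M\<^esub> x) \<oplus>\<^bsub>M\<^esub> s \<odot>\<^bsub>M\<^esub> (t \<odot>\<^bsub>M\<^esub> y)"
    using s(1,2) t(1,2) by (simp add: smult_r_distr smult_assoc1[symmetric] R.m_comm)
  also have "\<dots> \<in> D" using s t sub_add[OF D] sub_smult[OF D] by auto
  finally show "x \<oplus>\<^bsub>M\<^esub> y \<in> {x \<in> carrier M. \<exists>s\<in>carrier R - p. s \<odot>\<^bsub>M\<^esub> x \<in> D}"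
    using s t prime_mult_notin[OF p] by blast
qed auto

lemma glue_sub: assumes "\<And>p. p \<in> P \<Longrightarrow> sub (D p)" shows "sub (glue D)"
proof -
  have "sub {x \<in> carrier M. \<exists>s\<in>carrier R - p. s \<odot>\<^bsub>M\<^esub> x \<in> D p}" if "p \<in> P" for p
    using local_sub that assms by blast
  note L = this
  define L' where "L' p = {x \<in> carrier M. \<exists>s\<in>carrier R - p. s \<odot>\<^bsub>M\<^esub> x \<in> D p}" for p
  have L': "sub (L' p)" if "p \<in> P" for p using L[OF that] unfolding L'_def .
  have "glue D = {x \<in> carrier M. \<forall>p\<in>P. x \<in> L' p}" unfolding glue_def L'_def by auto
  moreover have "sub {x \<in> carrier M. \<forall>p\<in>P. x \<in> L' p}"
    by (rule submoduleI)
      (auto simp: sub_zero[OF L'] sub_neg[OF L'] sub_add[OF L'] sub_smult[OF L'])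
  ultimately show ?thesis by simp
qed

text \<open>At a prime other than \<open>p\<close> an element of \<open>prim p\<close> is killed by
  an admissible denominator, so only the condition at \<open>p\<close> has content.\<close>

lemma glue_member:
  assumes "p \<in> P" "\<And>q. q \<in> P \<Longrightarrow> sub (D q)" "x \<in> D p" "x \<in> prim p"
  shows "x \<in> glue D"
  unfolding glue_def
proof (intro CollectI conjI ballI)
  show xc: "x \<in> carrier M" using sub_carrier[OF assms(2)[OF assms(1)]] assms by auto
  fix q assume q: "q \<in> P"
  show "\<exists>s\<in>carrier R - q. s \<odot>\<^bsub>M\<^esub> x \<in> D q"
  proof (cases "q = p")
    case True
    then show ?thesis using assms xc primeD(6) by (intro bexI[of _ \<one>]) auto
  next
    case False
    obtain s where "s \<in> carrier R - q" "s \<odot>\<^bsub>M\<^esub> x = \<zero>\<^bsub>M\<^esub>"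
      using primary_other_prime[OF assms(1) q False assms(4)] by auto
    then show ?thesis using sub_zero[OF assms(2)[OF q]] by (metis)
  qed
qed

lemma glue_inter_primary:
  assumes "p \<in> P" "\<And>q. q \<in> P \<Longrightarrow> sub (D q)" "x \<in> glue D" "x \<in> prim p"
  shows "x \<in> D p"
proof -
  obtain s where "s \<in> carrier R - p" "s \<odot>\<^bsub>M\<^esub> x \<in> D p" using assms(1,3) unfolding glue_def by auto
  then show ?thesis using primary_cancel assms by blast
qed

lemma glue_primary: "glue prim = tor"
proof
  show "tor \<subseteq> glue prim" unfolding glue_def using torsion_local mem_torsion by blast
  show "glue prim \<subseteq> tor"
  proof
    fix x assume x: "x \<in> glue prim"
    obtain p where p: "p \<in> P" using exists_prime by auto
    then obtain s where s: "s \<in> carrier R - p" "s \<odot>\<^bsub>M\<^esub> x \<in> tor" "x \<in> carrier M"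
      using x primary_torsion unfolding glue_def by blast
    then obtain r where r: "r \<in> carrier R" "r \<noteq> \<zero>" "r \<odot>\<^bsub>M\<^esub> (s \<odot>\<^bsub>M\<^esub> x) = \<zero>\<^bsub>M\<^esub>" unfolding mem_torsion by auto
    moreover have "r \<otimes> s \<noteq> \<zero>" using r s p primeD(5)[OF p] R.integral by blast
    ultimately show "x \<in> tor" unfolding mem_torsion using s r by (auto simp: smult_assoc1 intro!: bexI[of _ "r \<otimes> s"])
  qed
qed

lemma glue_mono: "(\<And>p. p \<in> P \<Longrightarrow> D p \<subseteq> E p) \<Longrightarrow> glue D \<subseteq> glue E"
  unfolding glue_def by blast

section \<open>The torsion part as the direct sum of the primary parts\<close>

lemma module_sum_primary: "module_sum M P prim = tor"
proof
  show "module_sum M P prim \<subseteq> tor" by (rule module_sum_least[OF torsion_sub primary_torsion])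
  show "tor \<subseteq> module_sum M P prim"
  proof
    fix x assume x: "x \<in> tor"
    show "x \<in> module_sum M P prim"
    proof (rule local_membership)
      show "sub (module_sum M P prim)" by (rule module_sum_sub[OF primary_sub])
      show "x \<in> carrier M" using x mem_torsion by auto
      fix p assume "p \<in> P"
      then show "\<exists>s\<in>carrier R - p. s \<odot>\<^bsub>M\<^esub> x \<in> module_sum M P prim"
        using torsion_local[OF x] module_sum_upper[where N = prim, OF primary_sub] by blast
    qed
  qed
qed

text \<open>The elements killed by some \<open>s\<close> outside \<open>p\<close> form a submodule
  that contains all other primary parts. On \<open>prim p\<close> such an \<open>s\<close> acts
  injectively, so the intersection is zero.\<close>

lemma independent_primary: "independent_family R M P prim"
  unfolding independent_family_def
proof (intro conjI ballI)
  fix p assume p: "p \<in> P"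
  show "sub (prim p)" using primary_sub p .
  let ?Z = "{x \<in> carrier M. \<exists>s\<in>carrier R - p. s \<odot>\<^bsub>M\<^esub> x \<in> {\<zero>\<^bsub>M\<^esub>}}"
  have "module_sum M (P - {p}) prim \<subseteq> ?Z"
    by (rule module_sum_least[OF local_sub[OF p sub_zero_singleton]])
      (use primary_other_prime[OF _ p] sub_carrier[OF primary_sub] in blast)
  then have "x = \<zero>\<^bsub>M\<^esub>" if "x \<in> prim p" "x \<in> module_sum M (P - {p}) prim" for x
    using primary_cancel[OF p _ that(1) sub_zero_singleton] that(2) by blast
  moreover have "sub (module_sum M (P - {p}) prim)" by (rule module_sum_sub) (simp add: primary_sub)
  ultimately show "prim p \<inter> module_sum M (P - {p}) prim = {\<zero>\<^bsub>M\<^esub>}"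
    using sub_zero[OF primary_sub[OF p]] sub_zero by blast
qed

end


section \<open>Dual self-CS-Baer modules and their torsion parts\<close>

context module begin

lemma restricted_hom_iff:
  "f \<in> module_hom R (M\<lparr>carrier := T\<rparr>) (M\<lparr>carrier := T\<rparr>) \<longleftrightarrow> (\<forall>x\<in>T. f x \<in> T) \<and>
     (\<forall>x\<in>T. \<forall>y\<in>T. f (x \<oplus>\<^bsub>M\<^esub> y) = f x \<oplus>\<^bsub>M\<^esub> f y) \<and> (\<forall>r\<in>carrier R. \<forall>x\<in>T. f (r \<odot>\<^bsub>M\<^esub> x) = r \<odot>\<^bsub>M\<^esub> f x)"
  unfolding module_hom_def hom_def by auto

lemma restricted_End:
  assumes "f \<in> End" "sub T" "\<And>x. x \<in> T \<Longrightarrow> f x \<in> T"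
  shows "f \<in> module_hom R (M\<lparr>carrier := T\<rparr>) (M\<lparr>carrier := T\<rparr>)"
  unfolding restricted_hom_iff using assms module_homD[OF assms(1)] sub_carrier[OF assms(2)] by blast

lemma set_add_restrict: "A <+>\<^bsub>M\<lparr>carrier := T\<rparr>\<^esub> B = A <+>\<^bsub>M\<^esub> B"
  unfolding set_add_def' by simp

lemma image_generated_restrict:
  assumes "sub T"
  shows "image_generated R (M\<lparr>carrier := T\<rparr>) N \<longleftrightarrow> sub N \<and> N \<subseteq> T \<and>
     (\<forall>U. sub U \<and> U \<subseteq> T \<and> (\<forall>f \<in> module_hom R (M\<lparr>carrier := T\<rparr>) (M\<lparr>carrier := T\<rparr>). f ` T \<subseteq> N \<longrightarrow> f ` T \<subseteq> U)
        \<longrightarrow> N \<subseteq> U)"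
  unfolding image_generated_def submodule_restrict[OF module_axioms assms] by simp

lemma dsum_restrict:
  assumes "sub T"
  shows "direct_sum_decomposition R (M\<lparr>carrier := T\<rparr>) A B \<longleftrightarrow>
    sub A \<and> sub B \<and> A \<inter> B = {\<zero>\<^bsub>M\<^esub>} \<and> A <+>\<^bsub>M\<^esub> B = T"
  unfolding direct_sum_decomposition_def submodule_restrict[OF module_axioms assms] set_add_restrict
  using sum_upper1[of A B] sum_upper2[of A B] by simp metis

lemma above_summand_restrict:
  assumes "sub T"
  shows "above_summand R (M\<lparr>carrier := T\<rparr>) N \<longleftrightarrow> (\<exists>D E. sub D \<and> sub E \<and> D \<inter> E = {\<zero>\<^bsub>M\<^esub>} \<and> D <+>\<^bsub>M\<^esub> E = T \<and> D \<subseteq> N \<and>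
     (\<forall>U. sub U \<and> U \<subseteq> T \<and> D \<subseteq> U \<and> N <+>\<^bsub>M\<^esub> U = T \<longrightarrow> U = T))"
  unfolding above_summand_def submodule_restrict[OF module_axioms assms] set_add_restrict dsum_restrict[OF assms]
  by simp

text \<open>Precomposing with the projection extends endomorphisms of \<open>T\<close> to
  \<open>M\<close>, so \<open>N\<close> is image generated in \<open>M\<close> too. The complement
  found in \<open>M\<close> is cut down to \<open>T\<close> by the modular law.\<close>

lemma CS_Baer_summand:
  assumes B: "CS_Baer R M" and TL: "dsum T L"
  shows "CS_Baer R (M\<lparr>carrier := T\<rparr>)"
  unfolding CS_Baer_def
proof (intro allI impI)
  note d = dsumD[OF TL]
  fix N assume "image_generated R (M\<lparr>carrier := T\<rparr>) N"
  then have N: "sub N" "N \<subseteq> T" and gen: "\<And>U. sub U \<Longrightarrow> U \<subseteq> T \<Longrightarrow>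
     (\<And>f. f \<in> module_hom R (M\<lparr>carrier := T\<rparr>) (M\<lparr>carrier := T\<rparr>) \<Longrightarrow> f ` T \<subseteq> N \<Longrightarrow> f ` T \<subseteq> U) \<Longrightarrow> N \<subseteq> U"
    unfolding image_generated_restrict[OF d(1)] by auto
  obtain pr where pr: "pr \<in> End" "\<And>x. x \<in> T \<Longrightarrow> pr x = x" "\<And>x. x \<in> carrier M \<Longrightarrow> pr x \<in> T"
    using projection[OF TL] by metis
  have "image_generated R M N"
    unfolding image_generated_def
  proof (intro conjI allI impI)
    fix U assume "sub U \<and> (\<forall>f\<in>End. f ` carrier M \<subseteq> N \<longrightarrow> f ` carrier M \<subseteq> U)"
    then have U: "sub U" "\<forall>f\<in>End. f ` carrier M \<subseteq> N \<longrightarrow> f ` carrier M \<subseteq> U" by auto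
    have "N \<subseteq> U \<inter> T"
    proof (rule gen)
      show "sub (U \<inter> T)" using sub_inter U d by auto
      fix f assume f: "f \<in> module_hom R (M\<lparr>carrier := T\<rparr>) (M\<lparr>carrier := T\<rparr>)" "f ` T \<subseteq> N"
      have "(\<lambda>x. f (pr x)) \<in> End"
        by (rule module_homI) (use f(1) pr sub_carrier[OF d(1)] module_homD[OF pr(1)] in \<open>auto simp: restricted_hom_iff\<close>)
      moreover have "(\<lambda>x. f (pr x)) ` carrier M \<subseteq> N" using f(2) pr(3) by auto
      ultimately have "(\<lambda>x. f (pr x)) ` carrier M \<subseteq> U" using U(2) by blast
      then have "f x \<in> U" if "x \<in> T" for x using that pr(2) sub_carrier[OF d(1)] by force
      then show "f ` T \<subseteq> U \<inter> T" using f(2) N(2) by auto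
    qed auto
    then show "N \<subseteq> U" by auto
  qed (rule N)
  then have "above_summand R M N" using B unfolding CS_Baer_def by blast
  then obtain D E where DE: "dsum D E" "D \<subseteq> N"
    "\<And>U. sub U \<Longrightarrow> D \<subseteq> U \<Longrightarrow> N <+>\<^bsub>M\<^esub> U = carrier M \<Longrightarrow> U = carrier M"
    unfolding above_summand_def by blast
  note e = dsumD[OF DE(1)]
  have DT: "D \<subseteq> T" using DE N by auto
  show "above_summand R (M\<lparr>carrier := T\<rparr>) N"
    unfolding above_summand_restrict[OF d(1)]
  proof (rule exI[of _ D], rule exI[of _ "T \<inter> E"], intro conjI allI impI)
    show "sub D" "sub (T \<inter> E)" using e d sub_inter by auto
    show "D \<inter> (T \<inter> E) = {\<zero>\<^bsub>M\<^esub>}" using e(3) DT by blast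
    show "D <+>\<^bsub>M\<^esub> (T \<inter> E) = T"
      using sum_modular[OF e(1,2) d(1) DT] e(4) submoduleE(1)[OF d(1)] sum_least[OF d(1) DT, of "T \<inter> E"] by blast
    fix U assume "sub U \<and> U \<subseteq> T \<and> D \<subseteq> U \<and> N <+>\<^bsub>M\<^esub> U = T"
    then have U: "sub U" "U \<subseteq> T" "D \<subseteq> U" "N <+>\<^bsub>M\<^esub> U = T" by auto
    \<comment> \<open>A supplement \<open>U\<close> inside \<open>T\<close> is enlarged to
      \<open>U + L\<close>, tested in \<open>M\<close>, and recovered by intersecting with
      \<open>T\<close>.\<close>
    note UL = sub_sum[OF U(1) d(2)] sum_upper1[OF U(1) d(2)] sum_upper2[OF U(1) d(2)]
    note NUL = sub_sum[OF N(1) UL(1)] sum_upper2[OF N(1) UL(1)]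
    have "T \<subseteq> N <+>\<^bsub>M\<^esub> (U <+>\<^bsub>M\<^esub> L)" using sum_mono[OF subset_refl UL(2)] U(4) by blast
    then have "T <+>\<^bsub>M\<^esub> L \<subseteq> N <+>\<^bsub>M\<^esub> (U <+>\<^bsub>M\<^esub> L)" using sum_least[OF NUL(1)] UL(3) NUL(2) by blast
    then have "N <+>\<^bsub>M\<^esub> (U <+>\<^bsub>M\<^esub> L) = carrier M" using d(4) submoduleE(1)[OF NUL(1)] by auto
    then have "U <+>\<^bsub>M\<^esub> L = carrier M" using DE(3)[OF UL(1)] U(3) UL(2) by auto
    then have "T \<subseteq> U <+>\<^bsub>M\<^esub> (T \<inter> L)" using sum_modular[OF U(1) d(2,1) U(2)] submoduleE(1)[OF d(1)] by blast
    also have "\<dots> \<subseteq> U" using sum_least[OF U(1)] d(3) sub_zero[OF U(1)] by simp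
    finally show "U = T" using U(2) by auto
  qed (rule DE(2))
qed

end

context dedekind_module begin

text \<open>Over a commutative ring multiplication by \<open>r\<close> is an endomorphism, and
  \<open>p M\<close> is the sum of the images of those with \<open>r\<close> in
  \<open>p\<close>.\<close>

lemma ideal_smult_image_generated:
  assumes p: "p \<in> P"
  shows "image_generated R M (ideal_smult p (carrier M))"
  unfolding image_generated_def
proof (intro conjI allI impI)
  show "sub (ideal_smult p (carrier M))" using ideal_smult_sub primeD(4)[OF p] carrier_is_submodule by blast
  fix U assume "sub U \<and> (\<forall>f\<in>End. f ` carrier M \<subseteq> ideal_smult p (carrier M) \<longrightarrow> f ` carrier M \<subseteq> U)"
  then have U: "sub U" "\<forall>f\<in>End. f ` carrier M \<subseteq> ideal_smult p (carrier M) \<longrightarrow> f ` carrier M \<subseteq> U" by auto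
  show "ideal_smult p (carrier M) \<subseteq> U"
  proof (rule ideal_smult_least[OF U(1)])
    fix r x assume r: "r \<in> p" and x: "x \<in> carrier M"
    have "(\<lambda>x. r \<odot>\<^bsub>M\<^esub> x) ` carrier M \<subseteq> ideal_smult p (carrier M)" using ideal_smult_mem[OF r] by auto
    then show "r \<odot>\<^bsub>M\<^esub> x \<in> U" using U(2) scale_End[of r] primeD(4)[OF p] r x by blast
  qed
qed

text \<open>A complement of a summand over which \<open>p M\<close> is superfluous is torsion: for \<open>t \<notin> p\<close> a submodule
  maximal among those containing \<open>D + R t y\<close> but not \<open>y\<close> would be proper and supplement \<open>p M\<close>.\<close>

lemma torsion_complement:
  assumes B: "CS_Baer R M" and p: "p \<in> P"
  obtains D E where "dsum D E" "D \<subseteq> ideal_smult p (carrier M)" "E \<subseteq> tor"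
proof -
  let ?pM = "ideal_smult p (carrier M)"
  have pM: "sub ?pM" using ideal_smult_sub primeD(4)[OF p] carrier_is_submodule by blast
  have "above_summand R M ?pM" using B ideal_smult_image_generated[OF p] unfolding CS_Baer_def by blast
  then obtain D E where DE: "dsum D E" "D \<subseteq> ?pM"
    and sup': "\<forall>U. sub U \<and> D \<subseteq> U \<and> ?pM <+>\<^bsub>M\<^esub> U = carrier M \<longrightarrow> U = carrier M"
    unfolding above_summand_def by (elim exE conjE)
  have sup: "U = carrier M" if "sub U" "D \<subseteq> U" "?pM <+>\<^bsub>M\<^esub> U = carrier M" for U
    using sup' that by simp
  note d = dsumD[OF DE(1)]
  have key: "y \<in> D <+>\<^bsub>M\<^esub> (\<lambda>r. r \<odot>\<^bsub>M\<^esub> (t \<odot>\<^bsub>M\<^esub> y)) ` carrier R" if t: "t \<in> carrier R - p" and y: "y \<in> carrier M" for t y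
  proof (rule ccontr)
    assume ny: "\<not> ?thesis"
    define Y where "Y = D <+>\<^bsub>M\<^esub> (\<lambda>r. r \<odot>\<^bsub>M\<^esub> (t \<odot>\<^bsub>M\<^esub> y)) ` carrier R"
    have ty: "t \<odot>\<^bsub>M\<^esub> y \<in> carrier M" using t y by auto
    note cy = sub_cyclic[OF ty]
    have "sub Y" "Y \<inter> {y} = {}" unfolding Y_def using sub_sum[OF d(1) cy] ny by auto
    then obtain U where U: "sub U" "Y \<subseteq> U" "U \<inter> {y} = {}"
      and U4: "\<forall>W'. sub W' \<and> U \<subseteq> W' \<and> W' \<inter> {y} = {} \<longrightarrow> W' = U"
      using maximal_avoiding[of Y "{y}"] by blast
    have DU: "D \<subseteq> U" using sum_upper1[OF d(1) cy] U(2) unfolding Y_def by blast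
    have tyU: "t \<odot>\<^bsub>M\<^esub> y \<in> U" using sum_upper2[OF d(1) cy] mem_cyclic[OF ty] U(2) unfolding Y_def by blast
    have "w \<in> ?pM <+>\<^bsub>M\<^esub> U" if w: "w \<in> carrier M" for w
    proof -
      \<comment> \<open>The multipliers of \<open>t^n w\<close> into \<open>U\<close> grow with
        \<open>n\<close>. At the stationary index, a multiplier that works after one more factor
        \<open>t\<close> works already.\<close>
      define J where "J n = {h \<in> carrier R. h \<odot>\<^bsub>M\<^esub> (t [^] n \<odot>\<^bsub>M\<^esub> w) \<in> U}" for n :: nat
      have J: "ideal (J n) R" for n unfolding J_def
        by (rule colon_ideal[OF U(1)]) (use t w in auto)
      have e: "h \<odot>\<^bsub>M\<^esub> (t [^] Suc n \<odot>\<^bsub>M\<^esub> w) = t \<odot>\<^bsub>M\<^esub> (h \<odot>\<^bsub>M\<^esub> (t [^] n \<odot>\<^bsub>M\<^esub> w))" if "h \<in> carrier R" for h n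
        using that t w by (simp add: smult_assoc1[symmetric] R.m_ac)
      have "J n \<subseteq> J (Suc n)" for n unfolding J_def using e sub_smult[OF U(1)] t by auto
      then obtain n where n: "J (Suc n) = J n" using ideal_sequence_stationary[of J] J by blast
      let ?w = "t [^] n \<odot>\<^bsub>M\<^esub> w"
      have wc: "?w \<in> carrier M" using t w by auto
      note cw = sub_cyclic[OF wc]
      \<comment> \<open>Otherwise maximality gives \<open>y = u + r t^n w\<close> with
        \<open>u\<close> in \<open>U\<close>. As \<open>t y\<close> lies in \<open>U\<close>, so
        does \<open>r t^(n+1) w\<close>, hence \<open>r t^n w\<close>, and finally \<open>y\<close>
        itself, which \<open>U\<close> avoids.\<close>
      have wU: "?w \<in> U"
      proof (rule ccontr)
        assume nw: "?w \<notin> U"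
        let ?W = "U <+>\<^bsub>M\<^esub> (\<lambda>r. r \<odot>\<^bsub>M\<^esub> ?w) ` carrier R"
        have "?W \<noteq> U" using sum_upper2[OF U(1) cw] mem_cyclic[OF wc] nw by auto
        then have "?W \<inter> {y} \<noteq> {}" using U4 sub_sum[OF U(1) cw] sum_upper1[OF U(1) cw] by blast
        then have "y \<in> ?W" by auto
        then obtain u r where ur: "u \<in> U" "r \<in> carrier R" "y = u \<oplus>\<^bsub>M\<^esub> r \<odot>\<^bsub>M\<^esub> ?w" unfolding mem_set_add by auto
        have "t \<odot>\<^bsub>M\<^esub> y = t \<odot>\<^bsub>M\<^esub> u \<oplus>\<^bsub>M\<^esub> t \<odot>\<^bsub>M\<^esub> (r \<odot>\<^bsub>M\<^esub> ?w)"
          using ur t wc sub_carrier[OF U(1)] by (simp add: smult_r_distr)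
        then have "t \<odot>\<^bsub>M\<^esub> (r \<odot>\<^bsub>M\<^esub> ?w) \<in> U"
          using sub_cancel[OF U(1), of "t \<odot>\<^bsub>M\<^esub> u" "t \<odot>\<^bsub>M\<^esub> (r \<odot>\<^bsub>M\<^esub> ?w)"] tyU ur t wc sub_smult[OF U(1)] by auto
        then have "r \<in> J (Suc n)" unfolding J_def using e[OF ur(2)] ur(2) by auto
        then have "r \<odot>\<^bsub>M\<^esub> ?w \<in> U" using n unfolding J_def by auto
        then have "y \<in> U" using ur sub_add[OF U(1)] by auto
        then show False using U(3) by auto
      qed
      \<comment> \<open>The power of \<open>t\<close> is still invertible modulo \<open>p\<close>:
        from \<open>c + k t^n = 1\<close>, the element \<open>w\<close> is \<open>c w\<close> in
        \<open>p M\<close> plus a multiple of \<open>t^n w\<close> in \<open>U\<close>.\<close>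
      have tn: "t [^] n \<in> carrier R - p" using power_notin_prime[OF p t] .
      then have "t [^] n \<in> PIdl (t [^] n)" "ideal (PIdl (t [^] n)) R" using cgenideal_self cgenideal_ideal by auto
      then obtain c k' where c: "c \<in> p" "k' \<in> PIdl (t [^] n)" "c \<oplus> k' = \<one>"
        using coprime_split[OF primeD(3)[OF p]] tn by (metis DiffD2 subsetD)
      then obtain k where k: "k \<in> carrier R" "k' = k \<otimes> t [^] n" unfolding cgenideal_def by auto
      have cc: "c \<in> carrier R" using c primeD(4)[OF p] by auto
      have "w = (c \<oplus> k \<otimes> t [^] n) \<odot>\<^bsub>M\<^esub> w" using c k w by simp
      also have "\<dots> = c \<odot>\<^bsub>M\<^esub> w \<oplus>\<^bsub>M\<^esub> k \<odot>\<^bsub>M\<^esub> ?w" using cc k t w by (simp add: smult_l_distr smult_assoc1)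
      finally have "w = c \<odot>\<^bsub>M\<^esub> w \<oplus>\<^bsub>M\<^esub> k \<odot>\<^bsub>M\<^esub> ?w" .
      then show ?thesis unfolding mem_set_add
        using ideal_smult_mem[OF c(1) w] sub_smult[OF U(1) k(1) wU] by blast
    qed
    then have "?pM <+>\<^bsub>M\<^esub> U = carrier M" using submoduleE(1)[OF sub_sum[OF pM U(1)]] by blast
    then have "U = carrier M" using sup U(1) DU by blast
    then show False using U(3) y by auto
  qed
  \<comment> \<open>Here the second maximal ideal is used: \<open>t\<close> avoids \<open>p\<close>
    but lies in \<open>q\<close>, so no multiple of \<open>t\<close> equals one.\<close>
  obtain q where q: "q \<in> P" "q \<noteq> p" using exists_other_prime[OF p] by auto
  then obtain t where t: "t \<in> q" "t \<in> carrier R - p" using prime_not_subset[OF p] by auto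
  have "E \<subseteq> tor"
  proof
    fix y assume y: "y \<in> E"
    then have yc: "y \<in> carrier M" using sub_carrier[OF d(2)] by auto
    obtain e r where er: "e \<in> D" "r \<in> carrier R" "y = e \<oplus>\<^bsub>M\<^esub> r \<odot>\<^bsub>M\<^esub> (t \<odot>\<^bsub>M\<^esub> y)"
      using key[OF t(2) yc] unfolding mem_set_add by auto
    have rt: "r \<otimes> t \<in> carrier R" using er t by auto
    have ec: "e \<in> carrier M" using er sub_carrier[OF d(1)] by auto
    have "(\<one> \<oplus> \<ominus> (r \<otimes> t)) \<odot>\<^bsub>M\<^esub> y = y \<oplus>\<^bsub>M\<^esub> \<ominus>\<^bsub>M\<^esub> (r \<odot>\<^bsub>M\<^esub> (t \<odot>\<^bsub>M\<^esub> y))"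
      using er(2) t yc by (simp add: smult_l_distr smult_l_minus smult_assoc1)
    also have "\<dots> = (e \<oplus>\<^bsub>M\<^esub> r \<odot>\<^bsub>M\<^esub> (t \<odot>\<^bsub>M\<^esub> y)) \<oplus>\<^bsub>M\<^esub> \<ominus>\<^bsub>M\<^esub> (r \<odot>\<^bsub>M\<^esub> (t \<odot>\<^bsub>M\<^esub> y))" using er(3) by simp
    also have "\<dots> = e" using er(2) t yc ec by (simp add: M.a_assoc M.r_neg)
    finally have eq: "(\<one> \<oplus> \<ominus> (r \<otimes> t)) \<odot>\<^bsub>M\<^esub> y = e" .
    then have "e \<in> E" using sub_smult[OF d(2) _ y, of "\<one> \<oplus> \<ominus> (r \<otimes> t)"] rt by auto
    then have "e = \<zero>\<^bsub>M\<^esub>" using er(1) d(3) by auto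
    moreover have "\<one> \<oplus> \<ominus> (r \<otimes> t) \<noteq> \<zero>"
    proof
      assume "\<one> \<oplus> \<ominus> (r \<otimes> t) = \<zero>"
      then have "\<one> = r \<otimes> t" using R.minus_equality[of \<one> "\<ominus> (r \<otimes> t)"] rt by simp
      moreover have "r \<otimes> t \<in> q"
        by (rule ideal.I_l_closed[OF primeideal.axioms(1)[OF primeD(1)[OF q(1)]] t(1) er(2)])
      ultimately show False using primeD(6)[OF q(1)] by simp
    qed
    ultimately show "y \<in> tor" unfolding mem_torsion using eq rt yc by (auto intro!: bexI[of _ "\<one> \<oplus> \<ominus> (r \<otimes> t)"])
  qed
  then show thesis using that DE by blast
qed

text \<open>If \<open>r y\<close> is torsion and \<open>r\<close> is nonzero, then \<open>y\<close>
  is torsion; a quotient taken in \<open>B\<close> therefore stays in the torsion part.\<close>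

lemma divisible_torsion_part:
  assumes B: "sub B" "divisible B" shows "divisible (tor \<inter> B)"
  unfolding divisible_def
proof (intro ballI impI)
  fix r x assume r: "r \<in> carrier R" "r \<noteq> \<zero>" and x: "x \<in> tor \<inter> B"
  then obtain y where y: "y \<in> B" "x = r \<odot>\<^bsub>M\<^esub> y" using B(2) unfolding divisible_def by blast
  obtain k where k: "k \<in> carrier R" "k \<noteq> \<zero>" "k \<odot>\<^bsub>M\<^esub> x = \<zero>\<^bsub>M\<^esub>"
    using x mem_torsion[of x] by blast
  have "(k \<otimes> r) \<odot>\<^bsub>M\<^esub> y = \<zero>\<^bsub>M\<^esub>" "k \<otimes> r \<noteq> \<zero>"
    using k r y sub_carrier[OF B(1)] R.integral by (auto simp: smult_assoc1)
  then have "y \<in> tor" unfolding mem_torsion using y k r sub_carrier[OF B(1)] by blast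
  then show "\<exists>y\<in>tor \<inter> B. x = r \<odot>\<^bsub>M\<^esub> y" using y by auto
qed

text \<open>The sum \<open>S\<close> of all torsion images lies above a summand \<open>A\<close>. Its complement \<open>C\<close> satisfies
  \<open>p C = C\<close> for every prime \<open>p\<close>, since \<open>S\<close> contains the torsion complement of a summand inside \<open>p M\<close>.
  The torsion of the divisible module \<open>C\<close> is then a summand contained in \<open>S\<close>, hence zero.\<close>

lemma CS_Baer_torsion_summand:
  assumes B: "CS_Baer R M"
  obtains L where "dsum tor L" "divisible L"
proof -
  let ?F = "{f \<in> End. f ` carrier M \<subseteq> tor}"
  define S where "S = spanned (\<Union>f\<in>?F. f ` carrier M)"
  note T = torsion_sub
  have Fc: "(\<Union>f\<in>?F. f ` carrier M) \<subseteq> tor" by auto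
  then have "(\<Union>f\<in>?F. f ` carrier M) \<subseteq> carrier M" using submoduleE(1)[OF T] by (rule subset_trans)
  then have S: "sub S" unfolding S_def by (rule spanned_sub)
  have ST: "S \<subseteq> tor" unfolding S_def using spanned_least[OF T Fc] .
  have FS: "f ` carrier M \<subseteq> S" if "f \<in> End" "f ` carrier M \<subseteq> tor" for f
    unfolding S_def using that by (intro subset_trans[OF _ spanned_upper]) auto
  have "image_generated R M S" unfolding image_generated_def
  proof (intro conjI allI impI S)
    fix U assume U: "sub U \<and> (\<forall>f\<in>End. f ` carrier M \<subseteq> S \<longrightarrow> f ` carrier M \<subseteq> U)"
    then have "(\<Union>f\<in>?F. f ` carrier M) \<subseteq> U" using FS by (intro UN_least) simp
    then show "S \<subseteq> U" unfolding S_def using U spanned_least by blast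
  qed
  then have "above_summand R M S" using B unfolding CS_Baer_def by blast
  then obtain A C where AC: "dsum A C" "A \<subseteq> S"
    and sup: "\<And>U. sub U \<Longrightarrow> A \<subseteq> U \<Longrightarrow> S <+>\<^bsub>M\<^esub> U = carrier M \<Longrightarrow> U = carrier M"
    unfolding above_summand_def by blast
  note d = dsumD[OF AC(1)]
  \<comment> \<open>A torsion summand is the image of its projection, one of the endomorphisms that
    make up \<open>S\<close>.\<close>
  have summand_S: "E \<subseteq> S" if ED: "dsum E D" and ET: "E \<subseteq> tor" for D E
  proof -
    obtain pr where "pr \<in> End" "pr ` carrier M = E" using projection[OF ED] by metis
    then show ?thesis using FS[of pr] ET by simp
  qed
  have full: "U = carrier M" if U: "sub U" "A \<subseteq> U" and sb: "carrier M \<subseteq> S <+>\<^bsub>M\<^esub> U" for U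
    using sup[OF U] sb submoduleE(1)[OF sub_sum[OF S U(1)]] by blast
  have divC: "divisible C"
  proof (rule divisibleI[OF d(2)])
    fix p assume p: "p \<in> P"
    let ?pM = "ideal_smult p (carrier M)"
    have pM: "sub ?pM" using ideal_smult_sub primeD(4)[OF p] carrier_is_submodule by blast
    obtain D E where DE: "dsum D E" "D \<subseteq> ?pM" "E \<subseteq> tor" using torsion_complement[OF B p] .
    \<comment> \<open>As \<open>D\<close> lies in \<open>p M\<close> and its torsion complement
      \<open>E\<close> in \<open>S\<close>, the submodule \<open>A + p M\<close> supplements
      \<open>S\<close> and must be all of \<open>M\<close>. Projecting along \<open>A\<close> then
      puts \<open>C\<close> inside \<open>p C\<close>.\<close>
    let ?U = "A <+>\<^bsub>M\<^esub> ?pM"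
    note U = sub_sum[OF d(1) pM] sum_upper1[OF d(1) pM] sum_upper2[OF d(1) pM]
    note SU = sub_sum[OF S U(1)] sum_upper1[OF S U(1)] sum_upper2[OF S U(1)]
    have "D \<subseteq> S <+>\<^bsub>M\<^esub> ?U" using DE(2) U(3) SU(3) by (blast intro: subset_trans)
    moreover have "E \<subseteq> S <+>\<^bsub>M\<^esub> ?U" using summand_S[OF dsum_sym[OF DE(1)] DE(3)] SU(2) by (rule subset_trans)
    ultimately have "carrier M \<subseteq> S <+>\<^bsub>M\<^esub> ?U" using sum_least[OF SU(1)] dsumD(4)[OF DE(1)] by metis
    then have UM: "?U = carrier M" using full[OF U(1,2)] by blast
    obtain pr where pr: "pr \<in> End" "\<And>x. x \<in> C \<Longrightarrow> pr x = x" "\<And>x. x \<in> A \<Longrightarrow> pr x = \<zero>\<^bsub>M\<^esub>"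
      "\<And>x. x \<in> carrier M \<Longrightarrow> pr x \<in> C"
      using projection[OF dsum_sym[OF AC(1)]] by metis
    have pC: "sub (ideal_smult p C)" using ideal_smult_sub primeD(4)[OF p] d(2) by blast
    have "?pM \<subseteq> {x \<in> carrier M. pr x \<in> ideal_smult p C}"
    proof (rule ideal_smult_least[OF preimage_sub[OF pr(1) pC]])
      fix r x assume r: "r \<in> p" "x \<in> carrier M"
      then have "r \<in> carrier R" using primeD(4)[OF p] by auto
      then show "r \<odot>\<^bsub>M\<^esub> x \<in> {x \<in> carrier M. pr x \<in> ideal_smult p C}"
        using r pr(4) module_homD(3)[OF pr(1)] ideal_smult_mem[of r p "pr x" C] by auto
    qed
    then have pM': "pr m \<in> ideal_smult p C" "m \<in> carrier M" if "m \<in> ?pM" for m using that by auto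
    show "C \<subseteq> ideal_smult p C"
    proof
      fix b assume b: "b \<in> C"
      then have "b \<in> ?U" using UM sub_carrier[OF d(2)] by auto
      then obtain a m where am: "a \<in> A" "m \<in> ?pM" "b = a \<oplus>\<^bsub>M\<^esub> m" unfolding mem_set_add by auto
      then have "pr b = pr a \<oplus>\<^bsub>M\<^esub> pr m" using module_homD(2)[OF pr(1)] sub_carrier[OF d(1)] pM'(2) by auto
      then have "b = pr m" using pr(2)[OF b] pr(3)[OF am(1)] pr(4) pM'(2)[OF am(2)] sub_carrier[OF d(2)] by auto
      then show "b \<in> ideal_smult p C" using pM'(1)[OF am(2)] by simp
    qed
  qed
  \<comment> \<open>The torsion of \<open>C\<close> is divisible, so it is a summand and lies in
    \<open>S\<close>. Thus \<open>A\<close> together with the rest of \<open>C\<close> already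
    supplements \<open>S\<close> and is all of \<open>M\<close>, which leaves only zero for this
    torsion.\<close>
  let ?V = "tor \<inter> C"
  have V: "sub ?V" "divisible ?V" using sub_inter[OF T d(2)] divisible_torsion_part[OF d(2) divC] .
  obtain W where W: "dsum ?V W"
    using divisible_complement[OF V sub_zero_singleton] sub_zero[OF V(1)] by blast
  note w = dsumD[OF W]
  have CW: "sub (C \<inter> W)" using sub_inter d w by auto
  let ?U = "A <+>\<^bsub>M\<^esub> (C \<inter> W)"
  note U = sub_sum[OF d(1) CW] sum_upper1[OF d(1) CW] sum_upper2[OF d(1) CW]
  note SU = sub_sum[OF S U(1)] sum_upper1[OF S U(1)] sum_upper2[OF S U(1)]
  have "C \<subseteq> ?V <+>\<^bsub>M\<^esub> (C \<inter> W)" using sum_modular[OF V(1) w(2) d(2)] w(4) submoduleE(1)[OF d(2)] by blast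
  also have "\<dots> \<subseteq> S <+>\<^bsub>M\<^esub> ?U"
    by (rule sum_mono) (use summand_S[OF W] U(3) in auto)
  finally have "C \<subseteq> S <+>\<^bsub>M\<^esub> ?U" .
  moreover have "A \<subseteq> S <+>\<^bsub>M\<^esub> ?U" using U(2) SU(3) by blast
  ultimately have "carrier M \<subseteq> S <+>\<^bsub>M\<^esub> ?U" using sum_least[OF SU(1)] d(4) by metis
  then have UM: "?U = carrier M" using full[OF U(1,2)] by blast
  have V0: "v = \<zero>\<^bsub>M\<^esub>" if v: "v \<in> tor" "v \<in> C" for v
  proof -
    have vc: "v \<in> carrier M" using sub_carrier[OF d(2)] v by auto
    then have "v \<in> ?U" using UM by simp
    then obtain a b where ab: "a \<in> A" "b \<in> C \<inter> W" "v = a \<oplus>\<^bsub>M\<^esub> b" unfolding mem_set_add by auto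
    have "\<zero>\<^bsub>M\<^esub> \<oplus>\<^bsub>M\<^esub> v = a \<oplus>\<^bsub>M\<^esub> b" using ab vc by simp
    then have "v = b" using decomposition_unique(2)[OF d(1-3) sub_zero[OF d(1)] ab(1) v(2)] ab(2) by auto
    then show ?thesis using w(3) v ab by auto
  qed
  \<comment> \<open>\<open>A\<close> consists of torsion elements, so the \<open>C\<close>-part of a
    torsion element is torsion, hence zero.\<close>
  have "tor \<subseteq> A"
  proof
    fix x assume x: "x \<in> tor"
    then have "x \<in> A <+>\<^bsub>M\<^esub> C" using d(4) mem_torsion by auto
    then obtain a b where ab: "a \<in> A" "b \<in> C" "x = a \<oplus>\<^bsub>M\<^esub> b" unfolding mem_set_add by auto
    then have "b \<in> tor" using sub_cancel[OF T, of a b] x AC(2) ST sub_carrier[OF d(2)] by blast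
    then have "b = \<zero>\<^bsub>M\<^esub>" using V0 ab by auto
    then show "x \<in> A" using ab sub_carrier[OF d(1)] by simp
  qed
  then have "A = tor" using AC(2) ST by auto
  then show thesis using that AC(1) divC by auto
qed

text \<open>\<open>N\<close> is \<open>V + Z\<close>, generated by the images of \<open>L\<close>
  and of the torsion part. The divisible \<open>V\<close> splits into its torsion
  \<open>tor \<inter> V\<close> and a torsion-free \<open>V'\<close>. The former joins
  \<open>Z\<close> inside \<open>tor\<close> and is treated there; \<open>V'\<close> goes directly
  into the summand of \<open>M\<close>.\<close>

lemma CS_Baer_from_torsion:
  assumes TL: "dsum tor L" and L: "divisible L" and BT: "CS_Baer R (M\<lparr>carrier := tor\<rparr>)"
  shows "CS_Baer R M"
  unfolding CS_Baer_def
proof (intro allI impI)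
  note d = dsumD[OF TL]
  note T = torsion_sub
  fix N assume "image_generated R M N"
  then have N: "sub N" and gen: "\<And>U. sub U \<Longrightarrow> (\<And>f. f \<in> End \<Longrightarrow> f ` carrier M \<subseteq> N \<Longrightarrow> f ` carrier M \<subseteq> U) \<Longrightarrow> N \<subseteq> U"
    unfolding image_generated_def by blast+
  let ?F = "{f \<in> End. f ` carrier M \<subseteq> N}"
  define V where "V = spanned (\<Union>f\<in>?F. f ` L)"
  define Z where "Z = spanned (\<Union>f\<in>?F. f ` tor)"
  have VN: "(\<Union>f\<in>?F. f ` L) \<subseteq> N" using submoduleE(1)[OF d(2)] by blast
  have ZN: "(\<Union>f\<in>?F. f ` tor) \<subseteq> N" using submoduleE(1)[OF d(1)] by blast
  have V: "sub V" unfolding V_def using VN submoduleE(1)[OF N] by (intro spanned_sub) (rule subset_trans)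
  have Z: "sub Z" unfolding Z_def using ZN submoduleE(1)[OF N] by (intro spanned_sub) (rule subset_trans)
  have "V \<subseteq> N" "Z \<subseteq> N" unfolding V_def Z_def using spanned_least[OF N] VN ZN by auto
  have FV: "f x \<in> V" if "f \<in> ?F" "x \<in> L" for f x
    unfolding V_def by (rule subsetD[OF spanned_upper]) (use that in blast)
  have FZ: "f x \<in> Z" if "f \<in> ?F" "x \<in> tor" for f x
    unfolding Z_def by (rule subsetD[OF spanned_upper]) (use that in blast)
  have End_tor: "f x \<in> tor" if f: "f \<in> End" and x: "x \<in> tor" for f x
  proof -
    obtain r where r: "r \<in> carrier R" "r \<noteq> \<zero>" "r \<odot>\<^bsub>M\<^esub> x = \<zero>\<^bsub>M\<^esub>" "x \<in> carrier M" using x unfolding mem_torsion by auto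
    then have "r \<odot>\<^bsub>M\<^esub> f x = \<zero>\<^bsub>M\<^esub>" using module_homD(3)[OF f r(1,4)] End_zero[OF f] by simp
    then show ?thesis unfolding mem_torsion using r module_homD(1)[OF f] by auto
  qed
  have ZT: "Z \<subseteq> tor" unfolding Z_def by (rule spanned_least[OF T]) (use End_tor in auto)
  have NVZ: "N \<subseteq> V <+>\<^bsub>M\<^esub> Z"
  proof (rule gen[OF sub_sum[OF V Z]])
    fix f assume f: "f \<in> End" "f ` carrier M \<subseteq> N"
    show "f ` carrier M \<subseteq> V <+>\<^bsub>M\<^esub> Z"
    proof
      fix y assume "y \<in> f ` carrier M"
      then obtain x where x: "x \<in> carrier M" "y = f x" by auto
      then have "x \<in> tor <+>\<^bsub>M\<^esub> L" using d(4) by simp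
      then obtain t l where tl: "t \<in> tor" "l \<in> L" "x = t \<oplus>\<^bsub>M\<^esub> l" unfolding mem_set_add by auto
      have tc: "t \<in> carrier M" "l \<in> carrier M" using tl sub_carrier[OF T] sub_carrier[OF d(2)] by auto
      have "f t \<oplus>\<^bsub>M\<^esub> f l = f l \<oplus>\<^bsub>M\<^esub> f t" using tc module_homD(1)[OF f(1)] by (simp add: M.a_comm)
      then have "y = f l \<oplus>\<^bsub>M\<^esub> f t" using x tl tc module_homD(2)[OF f(1)] by simp
      then show "y \<in> V <+>\<^bsub>M\<^esub> Z" unfolding mem_set_add using FV FZ f tl by blast
    qed
  qed
  \<comment> \<open>Division by \<open>r\<close> is done in \<open>L\<close> before applying
    \<open>f\<close>; since \<open>r V\<close> is a submodule, checking the generators of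
    \<open>V\<close> suffices.\<close>
  have divV: "divisible V" unfolding divisible_def
  proof (intro ballI impI)
    fix r x assume r: "r \<in> carrier R" "r \<noteq> \<zero>" and x: "x \<in> V"
    have "V \<subseteq> (\<lambda>x. r \<odot>\<^bsub>M\<^esub> x) ` V" unfolding V_def
    proof (rule spanned_least, fold V_def)
      show "sub ((\<lambda>x. r \<odot>\<^bsub>M\<^esub> x) ` V)" using sub_scale[OF V r(1)] .
      show "(\<Union>f\<in>?F. f ` L) \<subseteq> (\<lambda>x. r \<odot>\<^bsub>M\<^esub> x) ` V"
      proof
        fix y assume "y \<in> (\<Union>f\<in>?F. f ` L)"
        then obtain f l where f: "f \<in> ?F" "l \<in> L" "y = f l" by auto
        then obtain l' where l': "l' \<in> L" "l = r \<odot>\<^bsub>M\<^esub> l'" using L r unfolding divisible_def by blast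
        then have "y = r \<odot>\<^bsub>M\<^esub> f l'" using f module_homD(3)[of f M r l'] r sub_carrier[OF d(2)] by auto
        then show "y \<in> (\<lambda>x. r \<odot>\<^bsub>M\<^esub> x) ` V" using FV[OF f(1) l'(1)] by auto
      qed
    qed
    then show "\<exists>y\<in>V. x = r \<odot>\<^bsub>M\<^esub> y" using x by auto
  qed
  let ?V0 = "tor \<inter> V"
  have V0: "sub ?V0" "divisible ?V0" using sub_inter[OF T V] divisible_torsion_part[OF V divV] .
  obtain W0 where W0: "dsum ?V0 W0"
    using divisible_complement[OF V0 sub_zero_singleton] sub_zero[OF V0(1)] by blast
  note w0 = dsumD[OF W0]
  define V' where "V' = V \<inter> W0"
  have V': "sub V'" unfolding V'_def using sub_inter V w0 by auto
  have VV: "V \<subseteq> ?V0 <+>\<^bsub>M\<^esub> V'"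
    unfolding V'_def using sum_modular[OF V0(1) w0(2) V] w0(4) submoduleE(1)[OF V] by blast
  \<comment> \<open>A quotient taken in \<open>V\<close> is replaced by its component in
    \<open>V'\<close>. The dropped component contributes nothing to \<open>x\<close>, by uniqueness
    of the decomposition.\<close>
  have divV': "divisible V'" unfolding divisible_def
  proof (intro ballI impI)
    fix r x assume r: "r \<in> carrier R" "r \<noteq> \<zero>" and x: "x \<in> V'"
    then obtain y where y: "y \<in> V" "x = r \<odot>\<^bsub>M\<^esub> y" using divV unfolding divisible_def V'_def by blast
    then obtain a b where ab: "a \<in> ?V0" "b \<in> V'" "y = a \<oplus>\<^bsub>M\<^esub> b" using VV mem_set_add by blast
    have c: "a \<in> carrier M" "b \<in> carrier M" "x \<in> carrier M"
      using ab x sub_carrier[OF V0(1)] sub_carrier[OF V'] by auto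
    have "\<zero>\<^bsub>M\<^esub> \<oplus>\<^bsub>M\<^esub> x = r \<odot>\<^bsub>M\<^esub> a \<oplus>\<^bsub>M\<^esub> r \<odot>\<^bsub>M\<^esub> b" using c y ab r by (simp add: smult_r_distr)
    moreover have "x \<in> W0" "r \<odot>\<^bsub>M\<^esub> b \<in> W0" "r \<odot>\<^bsub>M\<^esub> a \<in> ?V0"
      using x ab sub_smult[OF w0(2) r(1)] sub_smult[OF V0(1) r(1)] unfolding V'_def by auto
    ultimately have "x = r \<odot>\<^bsub>M\<^esub> b"
      using decomposition_unique(2)[OF w0(1-3) sub_zero[OF V0(1)]] by blast
    then show "\<exists>y\<in>V'. x = r \<odot>\<^bsub>M\<^esub> y" using ab by auto
  qed
  have "V' \<inter> tor = {\<zero>\<^bsub>M\<^esub>}"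
    using w0(3) sub_zero[OF V'] sub_zero[OF T] unfolding V'_def by blast
  \<comment> \<open>The complement of \<open>V'\<close> is taken above the torsion part, so that
    \<open>W\<close> is the sum of \<open>tor\<close> and \<open>W \<inter> L\<close>, and a
    decomposition of \<open>tor\<close> refines it.\<close>
  then obtain W where W: "tor \<subseteq> W" "dsum V' W" using divisible_complement[OF V' divV' T] by blast
  note w = dsumD[OF W(2)]
  define NT where "NT = Z <+>\<^bsub>M\<^esub> ?V0"
  have NT: "sub NT" "Z \<subseteq> NT" "?V0 \<subseteq> NT"
    unfolding NT_def using sub_sum[OF Z V0(1)] sum_upper1[OF Z V0(1)] sum_upper2[OF Z V0(1)] .
  have NTT: "NT \<subseteq> tor" unfolding NT_def using sum_least[OF T ZT] by auto
  have NTN: "NT \<subseteq> N" unfolding NT_def using sum_least[OF N \<open>Z \<subseteq> N\<close>] \<open>V \<subseteq> N\<close> by blast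
  have "image_generated R (M\<lparr>carrier := tor\<rparr>) NT"
    unfolding image_generated_restrict[OF T]
  proof (intro conjI allI impI NT(1) NTT)
    fix U assume "sub U \<and> U \<subseteq> tor \<and>
      (\<forall>f\<in>module_hom R (M\<lparr>carrier := tor\<rparr>) (M\<lparr>carrier := tor\<rparr>). f ` tor \<subseteq> NT \<longrightarrow> f ` tor \<subseteq> U)"
    then have U: "sub U" and imU: "\<And>f. f \<in> module_hom R (M\<lparr>carrier := tor\<rparr>) (M\<lparr>carrier := tor\<rparr>) \<Longrightarrow>
       f ` tor \<subseteq> NT \<Longrightarrow> f ` tor \<subseteq> U" by auto
    have "f ` tor \<subseteq> U" if f: "f \<in> ?F" for f
    proof (rule imU)
      show "f \<in> module_hom R (M\<lparr>carrier := tor\<rparr>) (M\<lparr>carrier := tor\<rparr>)"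
        using restricted_End[OF _ T] End_tor f by blast
      show "f ` tor \<subseteq> NT" using FZ[OF f] NT(2) by blast
    qed
    then have "Z \<subseteq> U" unfolding Z_def by (intro spanned_least[OF U] UN_least)
    \<comment> \<open>The torsion part of \<open>V\<close> is a summand of \<open>M\<close>; its
      projection restricts to an endomorphism of \<open>tor\<close> with exactly this image.\<close>
    moreover have "?V0 \<subseteq> U"
    proof -
      obtain pr where pr: "pr \<in> End" "\<And>x. x \<in> ?V0 \<Longrightarrow> pr x = x" "\<And>x. x \<in> carrier M \<Longrightarrow> pr x \<in> ?V0"
        using projection[OF W0] by metis
      have "pr ` tor \<subseteq> U"
      proof (rule imU)
        show "pr \<in> module_hom R (M\<lparr>carrier := tor\<rparr>) (M\<lparr>carrier := tor\<rparr>)"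
          using restricted_End[OF pr(1) T] pr(3) sub_carrier[OF T] by blast
        show "pr ` tor \<subseteq> NT" using pr(3) sub_carrier[OF T] NT(3) by blast
      qed
      then show ?thesis using pr(2) by (metis (no_types, lifting) IntD1 imageI subset_iff)
    qed
    ultimately show "NT \<subseteq> U" unfolding NT_def by (rule sum_least[OF U])
  qed
  then have "above_summand R (M\<lparr>carrier := tor\<rparr>) NT" using BT unfolding CS_Baer_def by blast
  then obtain D E where DE: "sub D" "sub E" "D \<inter> E = {\<zero>\<^bsub>M\<^esub>}" "D <+>\<^bsub>M\<^esub> E = tor" "D \<subseteq> NT"
    and sup': "\<forall>U. sub U \<and> U \<subseteq> tor \<and> D \<subseteq> U \<and> NT <+>\<^bsub>M\<^esub> U = tor \<longrightarrow> U = tor"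
    unfolding above_summand_restrict[OF T] by (elim exE conjE)
  have sup: "U = tor" if "sub U" "U \<subseteq> tor" "D \<subseteq> U" "NT <+>\<^bsub>M\<^esub> U = tor" for U
    using sup' that by simp
  have DT: "D \<subseteq> tor" "E \<subseteq> tor" using DE sum_upper1 sum_upper2 by blast+
  have WL: "sub (W \<inter> L)" using sub_inter w d by auto
  \<comment> \<open>The summand below \<open>N\<close> is \<open>V' + D\<close>; its complement
    consists of the complement \<open>E\<close> of \<open>D\<close> in \<open>tor\<close> and of
    what \<open>W\<close> has beyond \<open>tor\<close>.\<close>
  let ?A = "V' <+>\<^bsub>M\<^esub> D" and ?B = "E <+>\<^bsub>M\<^esub> (W \<inter> L)"
  note A = sub_sum[OF V' DE(1)] sum_upper1[OF V' DE(1)] sum_upper2[OF V' DE(1)]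
  note B = sub_sum[OF DE(2) WL] sum_upper1[OF DE(2) WL] sum_upper2[OF DE(2) WL]
  note AB = sub_sum[OF A(1) B(1)] sum_upper1[OF A(1) B(1)] sum_upper2[OF A(1) B(1)]
  have "dsum ?A ?B"
  proof (rule dsumI[OF A(1) B(1)])
    fix x assume "x \<in> ?A" "x \<in> ?B"
    then obtain v y e l where x: "v \<in> V'" "y \<in> D" "x = v \<oplus>\<^bsub>M\<^esub> y" "e \<in> E" "l \<in> W \<inter> L" "x = e \<oplus>\<^bsub>M\<^esub> l"
      unfolding mem_set_add by blast
    have "e \<in> W" "y \<in> W" "l \<in> W" using x(2,4,5) W(1) DT by auto
    then have el: "e \<oplus>\<^bsub>M\<^esub> l \<in> W" "y \<in> W" using sub_add[OF w(2)] by auto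
    then have "v \<oplus>\<^bsub>M\<^esub> y = \<zero>\<^bsub>M\<^esub> \<oplus>\<^bsub>M\<^esub> (e \<oplus>\<^bsub>M\<^esub> l)" using x sub_carrier[OF w(2)] by auto
    then have v: "v = \<zero>\<^bsub>M\<^esub>" "y = e \<oplus>\<^bsub>M\<^esub> l"
      using decomposition_unique[OF w(1-3) x(1) sub_zero[OF w(1)] el(2,1)] by auto
    have yc: "y \<in> carrier M" "y \<in> tor" "e \<in> tor" using x DT sub_carrier[OF DE(1)] by auto
    then have "y \<oplus>\<^bsub>M\<^esub> \<zero>\<^bsub>M\<^esub> = e \<oplus>\<^bsub>M\<^esub> l" using v by simp
    then have "y = e"
      using decomposition_unique(1)[OF d(1-3) yc(2,3) sub_zero[OF d(2)]] x(5) by blast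
    then have "y = \<zero>\<^bsub>M\<^esub>" using DE(3) x by auto
    then show "x = \<zero>\<^bsub>M\<^esub>" using v x by simp
  next
    fix x assume xc: "x \<in> carrier M"
    have sAB: "D \<subseteq> ?A <+>\<^bsub>M\<^esub> ?B" "E \<subseteq> ?A <+>\<^bsub>M\<^esub> ?B" "V' \<subseteq> ?A <+>\<^bsub>M\<^esub> ?B" "W \<inter> L \<subseteq> ?A <+>\<^bsub>M\<^esub> ?B"
      using A(2,3) B(2,3) AB(2,3) by (blast intro: subset_trans)+
    then have TAB: "tor \<subseteq> ?A <+>\<^bsub>M\<^esub> ?B" using sum_least[OF AB(1) sAB(1,2)] DE(4) by simp
    have "W \<subseteq> tor <+>\<^bsub>M\<^esub> (W \<inter> L)" using sum_modular[OF d(1,2) w(2) W(1)] d(4) submoduleE(1)[OF w(2)] by blast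
    also have "\<dots> \<subseteq> ?A <+>\<^bsub>M\<^esub> ?B" using sum_least[OF AB(1) TAB] sAB(4) by blast
    finally have "W \<subseteq> ?A <+>\<^bsub>M\<^esub> ?B" .
    then have "V' <+>\<^bsub>M\<^esub> W \<subseteq> ?A <+>\<^bsub>M\<^esub> ?B" using sum_least[OF AB(1)] sAB(3) by blast
    then show "x \<in> ?A <+>\<^bsub>M\<^esub> ?B" using xc w(4) by auto
  qed
  moreover have "?A \<subseteq> N"
    by (rule sum_least[OF N]) (use \<open>V \<subseteq> N\<close> NTN DE(5) V'_def in auto)
  \<comment> \<open>Since \<open>V'\<close> lies in \<open>U\<close>, supplementing \<open>N\<close>
    amounts to supplementing \<open>NT\<close>. Then \<open>tor \<inter> U\<close> supplements
    \<open>NT\<close> inside \<open>tor\<close>, so it is all of \<open>tor\<close> and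
    \<open>U\<close> contains \<open>NT\<close>.\<close>
  moreover have "U = carrier M" if U: "sub U" "?A \<subseteq> U" "N <+>\<^bsub>M\<^esub> U = carrier M" for U
  proof -
    note NU = sub_sum[OF NT(1) U(1)] sum_upper1[OF NT(1) U(1)] sum_upper2[OF NT(1) U(1)]
    have V'U: "V' \<subseteq> U" "D \<subseteq> U" using A(2,3) U(2) by auto
    have "?V0 <+>\<^bsub>M\<^esub> V' \<subseteq> NT <+>\<^bsub>M\<^esub> U" by (rule sum_mono[OF NT(3) V'U(1)])
    then have "V \<subseteq> NT <+>\<^bsub>M\<^esub> U" using VV by (rule subset_trans[rotated])
    then have "V <+>\<^bsub>M\<^esub> Z \<subseteq> NT <+>\<^bsub>M\<^esub> U" using sum_least[OF NU(1)] NT(2) NU(2) by (meson subset_trans)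
    then have "N \<subseteq> NT <+>\<^bsub>M\<^esub> U" using NVZ by (rule subset_trans[rotated])
    then have full: "carrier M \<subseteq> NT <+>\<^bsub>M\<^esub> U" using sum_least[OF NU(1) _ NU(3)] U(3) by metis
    have TU: "sub (tor \<inter> U)" using sub_inter[OF T U(1)] .
    have "tor \<subseteq> NT <+>\<^bsub>M\<^esub> (tor \<inter> U)"
      using sum_modular[OF NT(1) U(1) T NTT] full submoduleE(1)[OF T] by blast
    then have "NT <+>\<^bsub>M\<^esub> (tor \<inter> U) = tor" using sum_least[OF T NTT, of "tor \<inter> U"] by blast
    then have "tor \<inter> U = tor" using sup[OF TU] DT V'U by blast
    then have "NT <+>\<^bsub>M\<^esub> U \<subseteq> U" using sum_least[OF U(1)] NTT by blast
    then show ?thesis using full submoduleE(1)[OF U(1)] by blast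
  qed
  ultimately show "above_summand R M N" unfolding above_summand_def by blast
qed

text \<open>Downwards, a primary part is a summand of the torsion part, complemented by the other
  primary parts glued together. Upwards, the summands belonging to \<open>N \<inter> prim p\<close>
  are glued, and the inclusions are checked one prime at a time.\<close>

lemma CS_Baer_torsion_iff_primary:
  "CS_Baer R (M\<lparr>carrier := tor\<rparr>) \<longleftrightarrow> (\<forall>p\<in>P. CS_Baer R (M\<lparr>carrier := prim p\<rparr>))"
proof (intro iffI ballI)
  note T = torsion_sub
  fix p assume BT: "CS_Baer R (M\<lparr>carrier := tor\<rparr>)" and p: "p \<in> P"
  interpret T: module R "M\<lparr>carrier := tor\<rparr>" using submodule.submodule_is_module[OF T module_axioms] .
  let ?D = "\<lambda>q. if q = p then {\<zero>\<^bsub>M\<^esub>} else prim q"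
  have D: "sub (?D q)" if "q \<in> P" for q using that primary_sub sub_zero_singleton by auto
  have C: "sub (glue ?D)" using D by (rule glue_sub)
  note pp = primary_sub[OF p]
  note pC = sub_sum[OF pp C] sum_upper1[OF pp C] sum_upper2[OF pp C]
  have "T.dsum (prim p) (glue ?D)"
    unfolding dsum_restrict[OF T]
  proof (intro conjI pp C)
    show "prim p \<inter> glue ?D = {\<zero>\<^bsub>M\<^esub>}"
      using glue_inter_primary[where D = ?D, OF p D] sub_zero[OF pp] sub_zero[OF C] by auto
    have "glue ?D \<subseteq> glue prim" by (rule glue_mono) (use sub_zero[OF primary_sub] in auto)
    then have "prim p <+>\<^bsub>M\<^esub> glue ?D \<subseteq> tor" using sum_least[OF T primary_torsion[OF p]] glue_primary by auto
    moreover have "x \<in> prim p <+>\<^bsub>M\<^esub> glue ?D" if x: "x \<in> tor" for x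
    proof (rule local_membership[OF pC(1)])
      show "x \<in> carrier M" using x mem_torsion by auto
      fix q assume q: "q \<in> P"
      obtain s where s: "s \<in> carrier R - q" "s \<odot>\<^bsub>M\<^esub> x \<in> prim q" using torsion_local[OF x q] by auto
      have "s \<odot>\<^bsub>M\<^esub> x \<in> prim p <+>\<^bsub>M\<^esub> glue ?D"
      proof (cases "q = p")
        case True
        then show ?thesis using s pC by auto
      next
        case False
        then have "s \<odot>\<^bsub>M\<^esub> x \<in> glue ?D" using glue_member[where D = ?D, OF q D] s by auto
        then show ?thesis using pC by auto
      qed
      then show "\<exists>s\<in>carrier R - q. s \<odot>\<^bsub>M\<^esub> x \<in> prim p <+>\<^bsub>M\<^esub> glue ?D" using s by auto
    qed
    ultimately show "prim p <+>\<^bsub>M\<^esub> glue ?D = tor" by auto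
  qed
  then show "CS_Baer R (M\<lparr>carrier := prim p\<rparr>)" using T.CS_Baer_summand[OF BT] by simp
next
  note T = torsion_sub
  assume BP: "\<forall>p\<in>P. CS_Baer R (M\<lparr>carrier := prim p\<rparr>)"
  show "CS_Baer R (M\<lparr>carrier := tor\<rparr>)"
    unfolding CS_Baer_def
  proof (intro allI impI)
    fix N assume "image_generated R (M\<lparr>carrier := tor\<rparr>) N"
    then have N: "sub N" "N \<subseteq> tor" and gen: "\<And>U. sub U \<Longrightarrow> U \<subseteq> tor \<Longrightarrow>
       (\<And>f. f \<in> module_hom R (M\<lparr>carrier := tor\<rparr>) (M\<lparr>carrier := tor\<rparr>) \<Longrightarrow> f ` tor \<subseteq> N \<Longrightarrow> f ` tor \<subseteq> U) \<Longrightarrow> N \<subseteq> U"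
      unfolding image_generated_restrict[OF T] by auto
    define Q where "Q p D E \<longleftrightarrow> sub D \<and> sub E \<and> D \<inter> E = {\<zero>\<^bsub>M\<^esub>} \<and> D <+>\<^bsub>M\<^esub> E = prim p \<and> D \<subseteq> N \<inter> prim p \<and>
       (\<forall>U. sub U \<and> U \<subseteq> prim p \<and> D \<subseteq> U \<and> (N \<inter> prim p) <+>\<^bsub>M\<^esub> U = prim p \<longrightarrow> U = prim p)" for p D E
    have "\<exists>D E. Q p D E" if p: "p \<in> P" for p
    proof -
      note pp = primary_sub[OF p]
      have "image_generated R (M\<lparr>carrier := prim p\<rparr>) (N \<inter> prim p)"
        unfolding image_generated_restrict[OF pp]
      proof (intro conjI allI impI)
        show "sub (N \<inter> prim p)" using sub_inter[OF N(1) pp] .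
        fix U assume "sub U \<and> U \<subseteq> prim p \<and> (\<forall>f\<in>module_hom R (M\<lparr>carrier := prim p\<rparr>) (M\<lparr>carrier := prim p\<rparr>).
          f ` prim p \<subseteq> N \<inter> prim p \<longrightarrow> f ` prim p \<subseteq> U)"
        then have U: "sub U" "U \<subseteq> prim p" and imU:
          "\<And>f. f \<in> module_hom R (M\<lparr>carrier := prim p\<rparr>) (M\<lparr>carrier := prim p\<rparr>) \<Longrightarrow> f ` prim p \<subseteq> N \<inter> prim p \<Longrightarrow> f ` prim p \<subseteq> U"
          by auto
        let ?U = "{x \<in> carrier M. \<exists>s\<in>carrier R - p. s \<odot>\<^bsub>M\<^esub> x \<in> U}"
        \<comment> \<open>Generation of \<open>N\<close> is tested on the torsion elements that lie
          in \<open>U\<close> up to a denominator at \<open>p\<close>. An endomorphism of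
          \<open>tor\<close> preserves \<open>prim p\<close>, so \<open>imU\<close> applies to its
          restriction.\<close>
        have "N \<subseteq> tor \<inter> ?U"
        proof (rule gen)
          show "sub (tor \<inter> ?U)" using sub_inter[OF T local_sub[OF p U(1)]] .
          fix f assume f: "f \<in> module_hom R (M\<lparr>carrier := tor\<rparr>) (M\<lparr>carrier := tor\<rparr>)" "f ` tor \<subseteq> N"
          note fD = f(1)[unfolded restricted_hom_iff]
          have pT: "x \<in> prim p \<Longrightarrow> x \<in> tor" for x using primary_torsion[OF p] by auto
          have f0: "f \<zero>\<^bsub>M\<^esub> = \<zero>\<^bsub>M\<^esub>"
          proof -
            have "f (\<zero> \<odot>\<^bsub>M\<^esub> \<zero>\<^bsub>M\<^esub>) = \<zero> \<odot>\<^bsub>M\<^esub> f \<zero>\<^bsub>M\<^esub>" "f \<zero>\<^bsub>M\<^esub> \<in> tor" using fD sub_zero[OF T] R.zero_closed by blast+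
            then show ?thesis using sub_carrier[OF T] by simp
          qed
          have fp: "f x \<in> prim p" if x: "x \<in> prim p" for x
          proof -
            obtain n :: nat where n: "\<forall>r \<in> p [^]\<^bsub>ideals_set R\<^esub> n. r \<odot>\<^bsub>M\<^esub> x = \<zero>\<^bsub>M\<^esub>"
              using x unfolding primary_part_def by auto
            have "r \<odot>\<^bsub>M\<^esub> f x = \<zero>\<^bsub>M\<^esub>" if "r \<in> p [^]\<^bsub>ideals_set R\<^esub> n" for r
            proof -
              have "f (r \<odot>\<^bsub>M\<^esub> x) = r \<odot>\<^bsub>M\<^esub> f x" using fD pT[OF x] prime_power_subset[OF p] that by blast
              then show ?thesis using n that f0 by simp
            qed
            moreover have "f x \<in> carrier M" using fD pT[OF x] sub_carrier[OF T] by auto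
            ultimately show ?thesis unfolding primary_part_def by auto
          qed
          have "f ` prim p \<subseteq> U"
          proof (rule imU)
            show "f \<in> module_hom R (M\<lparr>carrier := prim p\<rparr>) (M\<lparr>carrier := prim p\<rparr>)"
              unfolding restricted_hom_iff using fD fp pT by auto
            show "f ` prim p \<subseteq> N \<inter> prim p" using f(2) fp pT by blast
          qed
          then have "f x \<in> ?U" if x: "x \<in> tor" for x
          proof -
            obtain s where s: "s \<in> carrier R - p" "s \<odot>\<^bsub>M\<^esub> x \<in> prim p" using torsion_local[OF x p] by auto
            have "f (s \<odot>\<^bsub>M\<^esub> x) = s \<odot>\<^bsub>M\<^esub> f x" using fD x s by auto
            moreover have "f (s \<odot>\<^bsub>M\<^esub> x) \<in> U" using \<open>f ` prim p \<subseteq> U\<close> s by auto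
            moreover have "f x \<in> carrier M" using fD x sub_carrier[OF T] by auto
            ultimately show ?thesis using s by auto
          qed
          then show "f ` tor \<subseteq> tor \<inter> ?U" using f(2) N(2) by blast
        qed auto
        then show "N \<inter> prim p \<subseteq> U" using primary_cancel[OF p _ _ U(1)] by blast
      qed auto
      then have "above_summand R (M\<lparr>carrier := prim p\<rparr>) (N \<inter> prim p)" using BP p unfolding CS_Baer_def by blast
      then show ?thesis unfolding above_summand_restrict[OF pp] Q_def .
    qed
    then obtain D E where Q: "\<And>p. p \<in> P \<Longrightarrow> Q p (D p) (E p)" by metis
    have DE: "\<And>p. p \<in> P \<Longrightarrow> sub (D p)" "\<And>p. p \<in> P \<Longrightarrow> sub (E p)"
      "\<And>p. p \<in> P \<Longrightarrow> D p \<inter> E p = {\<zero>\<^bsub>M\<^esub>}" "\<And>p. p \<in> P \<Longrightarrow> D p <+>\<^bsub>M\<^esub> E p = prim p" "\<And>p. p \<in> P \<Longrightarrow> D p \<subseteq> N \<inter> prim p"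
      and sup: "\<And>p U. p \<in> P \<Longrightarrow> sub U \<Longrightarrow> U \<subseteq> prim p \<Longrightarrow> D p \<subseteq> U \<Longrightarrow> (N \<inter> prim p) <+>\<^bsub>M\<^esub> U = prim p \<Longrightarrow> U = prim p"
      using Q unfolding Q_def by simp_all
    have DP: "D p \<subseteq> prim p" "E p \<subseteq> prim p" if "p \<in> P" for p
      using DE(4)[OF that] sum_upper1[OF DE(1,2)[OF that]] sum_upper2[OF DE(1,2)[OF that]] by auto
    have gD: "sub (glue D)" and gE: "sub (glue E)" using glue_sub DE by blast+
    note gDE = sub_sum[OF gD gE] sum_upper1[OF gD gE] sum_upper2[OF gD gE]
    have inD: "x \<in> glue D" if "p \<in> P" "x \<in> D p" for p x
      using glue_member[where D = D, OF that(1) DE(1) that(2)] DP that by auto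
    have inE: "x \<in> glue E" if "p \<in> P" "x \<in> E p" for p x
      using glue_member[where D = E, OF that(1) DE(2) that(2)] DP that by auto
    show "above_summand R (M\<lparr>carrier := tor\<rparr>) N"
      unfolding above_summand_restrict[OF T]
    proof (rule exI[of _ "glue D"], rule exI[of _ "glue E"], intro conjI allI impI gD gE)
      have "x = \<zero>\<^bsub>M\<^esub>" if x: "x \<in> glue D" "x \<in> glue E" for x
      proof -
        have xc: "x \<in> carrier M" using sub_carrier[OF gD] x by auto
        have "x \<in> {\<zero>\<^bsub>M\<^esub>}"
        proof (rule local_membership[OF sub_zero_singleton xc])
          fix p assume p: "p \<in> P"
          obtain s t where st: "s \<in> carrier R - p" "s \<odot>\<^bsub>M\<^esub> x \<in> D p" "t \<in> carrier R - p" "t \<odot>\<^bsub>M\<^esub> x \<in> E p"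
            using x p unfolding glue_def by blast
          have e: "(s \<otimes> t) \<odot>\<^bsub>M\<^esub> x = t \<odot>\<^bsub>M\<^esub> (s \<odot>\<^bsub>M\<^esub> x)" "(s \<otimes> t) \<odot>\<^bsub>M\<^esub> x = s \<odot>\<^bsub>M\<^esub> (t \<odot>\<^bsub>M\<^esub> x)"
            using st xc by (simp_all add: smult_assoc1[symmetric] R.m_comm)
          have "(s \<otimes> t) \<odot>\<^bsub>M\<^esub> x \<in> D p" unfolding e(1) using sub_smult[OF DE(1)[OF p]] st by auto
          moreover have "(s \<otimes> t) \<odot>\<^bsub>M\<^esub> x \<in> E p" unfolding e(2) using sub_smult[OF DE(2)[OF p]] st by auto
          ultimately have "(s \<otimes> t) \<odot>\<^bsub>M\<^esub> x \<in> D p \<inter> E p" by blast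
          then show "\<exists>s\<in>carrier R - p. s \<odot>\<^bsub>M\<^esub> x \<in> {\<zero>\<^bsub>M\<^esub>}"
            using DE(3)[OF p] prime_mult_notin[OF p st(1,3)] by auto
        qed
        then show ?thesis by simp
      qed
      then show "glue D \<inter> glue E = {\<zero>\<^bsub>M\<^esub>}" using sub_zero[OF gD] sub_zero[OF gE] by blast
      have "glue D \<subseteq> glue prim" by (rule glue_mono) (rule DP(1))
      moreover have "glue E \<subseteq> glue prim" by (rule glue_mono) (rule DP(2))
      ultimately have "glue D \<subseteq> tor" "glue E \<subseteq> tor" unfolding glue_primary by simp_all
      then have "glue D <+>\<^bsub>M\<^esub> glue E \<subseteq> tor" by (rule sum_least[OF T])
      moreover have "x \<in> glue D <+>\<^bsub>M\<^esub> glue E" if x: "x \<in> tor" for x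
      proof (rule local_membership[OF gDE(1)])
        show "x \<in> carrier M" using x mem_torsion by auto
        fix p assume p: "p \<in> P"
        obtain s where s: "s \<in> carrier R - p" "s \<odot>\<^bsub>M\<^esub> x \<in> prim p" using torsion_local[OF x p] by auto
        then have "s \<odot>\<^bsub>M\<^esub> x \<in> D p <+>\<^bsub>M\<^esub> E p" using DE(4)[OF p] by simp
        then obtain y e where "y \<in> D p" "e \<in> E p" "s \<odot>\<^bsub>M\<^esub> x = y \<oplus>\<^bsub>M\<^esub> e" unfolding mem_set_add by auto
        then have "s \<odot>\<^bsub>M\<^esub> x \<in> glue D <+>\<^bsub>M\<^esub> glue E" unfolding mem_set_add using inD[OF p] inE[OF p] by blast
        then show "\<exists>s\<in>carrier R - p. s \<odot>\<^bsub>M\<^esub> x \<in> glue D <+>\<^bsub>M\<^esub> glue E" using s by auto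
      qed
      ultimately show "glue D <+>\<^bsub>M\<^esub> glue E = tor" by auto
      show "glue D \<subseteq> N"
      proof
        fix x assume x: "x \<in> glue D"
        show "x \<in> N"
        proof (rule local_membership[OF N(1) sub_carrier[OF gD x]])
          show "\<exists>s\<in>carrier R - p. s \<odot>\<^bsub>M\<^esub> x \<in> N" if "p \<in> P" for p
            using x DE(5)[OF that] that unfolding glue_def by blast
        qed
      qed
      fix U assume "sub U \<and> U \<subseteq> tor \<and> glue D \<subseteq> U \<and> N <+>\<^bsub>M\<^esub> U = tor"
      then have U: "sub U" "U \<subseteq> tor" "glue D \<subseteq> U" "N <+>\<^bsub>M\<^esub> U = tor" by auto
      \<comment> \<open>To split \<open>x\<close> of \<open>prim p\<close> inside
        \<open>prim p\<close>, write \<open>x = n + u\<close> in \<open>tor\<close>, move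
        \<open>n\<close> and \<open>u\<close> into \<open>prim p\<close> by a common multiplier
        outside \<open>p\<close>, and cancel that multiplier on \<open>x\<close>.\<close>
      have full: "U \<inter> prim p = prim p" if p: "p \<in> P" for p
      proof (rule sup[OF p])
        note pp = primary_sub[OF p]
        note Np = sub_inter[OF N(1) pp]
        show Up: "sub (U \<inter> prim p)" using sub_inter[OF U(1) pp] .
        show "D p \<subseteq> U \<inter> prim p" using inD[OF p] U(3) DP(1)[OF p] by blast
        note sp = sub_sum[OF Np Up]
        have "(N \<inter> prim p) <+>\<^bsub>M\<^esub> (U \<inter> prim p) \<subseteq> prim p" by (rule sum_least[OF pp]) auto
        moreover have "x \<in> (N \<inter> prim p) <+>\<^bsub>M\<^esub> (U \<inter> prim p)" if x: "x \<in> prim p" for x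
        proof -
          have "x \<in> N <+>\<^bsub>M\<^esub> U" using x primary_torsion[OF p] U(4) by auto
          then obtain n u where nu: "n \<in> N" "u \<in> U" "x = n \<oplus>\<^bsub>M\<^esub> u" unfolding mem_set_add by auto
          obtain s where s: "s \<in> carrier R - p" "s \<odot>\<^bsub>M\<^esub> n \<in> prim p" using torsion_local[OF _ p, of n] nu N by auto
          obtain t where t: "t \<in> carrier R - p" "t \<odot>\<^bsub>M\<^esub> u \<in> prim p" using torsion_local[OF _ p, of u] nu U by auto
          have c: "n \<in> carrier M" "u \<in> carrier M" using nu sub_carrier[OF N(1)] sub_carrier[OF U(1)] by auto
          have "(s \<otimes> t) \<odot>\<^bsub>M\<^esub> x = t \<odot>\<^bsub>M\<^esub> (s \<odot>\<^bsub>M\<^esub> n) \<oplus>\<^bsub>M\<^esub> s \<odot>\<^bsub>M\<^esub> (t \<odot>\<^bsub>M\<^esub> u)"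
            using s(1) t(1) c nu(3) by (simp add: smult_r_distr smult_assoc1[symmetric] R.m_comm)
          moreover have "t \<odot>\<^bsub>M\<^esub> (s \<odot>\<^bsub>M\<^esub> n) \<in> N \<inter> prim p"
            using sub_smult[OF N(1)] sub_smult[OF pp] s t nu by auto
          moreover have "s \<odot>\<^bsub>M\<^esub> (t \<odot>\<^bsub>M\<^esub> u) \<in> U \<inter> prim p"
            using sub_smult[OF U(1)] sub_smult[OF pp] s t nu by auto
          ultimately have "(s \<otimes> t) \<odot>\<^bsub>M\<^esub> x \<in> (N \<inter> prim p) <+>\<^bsub>M\<^esub> (U \<inter> prim p)" unfolding mem_set_add by blast
          then show ?thesis using primary_cancel[OF p prime_mult_notin[OF p s(1) t(1)] x sp] by blast
        qed
        ultimately show "(N \<inter> prim p) <+>\<^bsub>M\<^esub> (U \<inter> prim p) = prim p" by auto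
      qed auto
      have "x \<in> U" if x: "x \<in> tor" for x
      proof (rule local_membership[OF U(1)])
        show "x \<in> carrier M" using x mem_torsion by auto
        show "\<exists>s\<in>carrier R - p. s \<odot>\<^bsub>M\<^esub> x \<in> U" if "p \<in> P" for p
          using torsion_local[OF x that] full[OF that] by blast
      qed
      then show "U = tor" using U(2) by auto
    qed
  qed
qed

end


section \<open>Torsion-free divisible modules\<close>

text \<open>A nonzero \<open>r\<close> acts bijectively on \<open>L\<close>, so \<open>L\<close> is
  a vector space over the quotient field; the action is not constructed, and fractions are handled
  by clearing denominators.\<close>

locale torsion_free_divisible = dedekind_module +
  fixes L
  assumes L_sub: "sub L" and L_torsion_free: "tor \<inter> L = {\<zero>\<^bsub>M\<^esub>}" and L_divisible: "divisible L"
begin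

abbreviation "K \<equiv> localization R (carrier R - {\<zero>})"
abbreviation "fr \<equiv> fraction R (carrier R - {\<zero>})"

sublocale K: domain_localization R "carrier R - {\<zero>}"
  by (rule localization_quotient_field)

lemma L_carrier: "x \<in> L \<Longrightarrow> x \<in> carrier M" using sub_carrier[OF L_sub] .

lemma L_cancel:
  assumes "r \<in> carrier R" "r \<noteq> \<zero>" "x \<in> L" "r \<odot>\<^bsub>M\<^esub> x = \<zero>\<^bsub>M\<^esub>" shows "x = \<zero>\<^bsub>M\<^esub>"
proof -
  have "x \<in> tor" unfolding mem_torsion using assms L_carrier by auto
  then show ?thesis using L_torsion_free assms by auto
qed

lemma spanned_sub': "G \<subseteq> L \<Longrightarrow> sub (spanned G)"
  using spanned_sub submoduleE(1)[OF L_sub] by (meson subset_trans)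

lemma spanned_in_L: "G \<subseteq> L \<Longrightarrow> spanned G \<subseteq> L"
  using spanned_least[OF L_sub] .

lemma spanned_mono: "G \<subseteq> H \<Longrightarrow> H \<subseteq> L \<Longrightarrow> spanned G \<subseteq> spanned H"
  using spanned_least[OF spanned_sub'] spanned_upper by (meson subset_trans)

lemma spanned_insert:
  assumes "G \<subseteq> L" "b \<in> L" "x \<in> spanned (insert b G)"
  shows "\<exists>v\<in>spanned G. \<exists>k\<in>carrier R. x = v \<oplus>\<^bsub>M\<^esub> k \<odot>\<^bsub>M\<^esub> b"
proof -
  have bc: "b \<in> carrier M" using L_carrier assms(2) .
  note c = sub_cyclic[OF bc] and g = spanned_sub'[OF assms(1)]
  have "insert b G \<subseteq> spanned G <+>\<^bsub>M\<^esub> (\<lambda>k. k \<odot>\<^bsub>M\<^esub> b) ` carrier R"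
    using sum_upper1[OF g c] sum_upper2[OF g c] mem_cyclic[OF bc] spanned_upper[of G] by blast
  then have "x \<in> spanned G <+>\<^bsub>M\<^esub> (\<lambda>k. k \<odot>\<^bsub>M\<^esub> b) ` carrier R"
    using spanned_least[OF sub_sum[OF g c]] assms(3) by blast
  then show ?thesis unfolding mem_set_add by auto
qed

text \<open>The elements lying in spans of finite parts of \<open>G\<close> already form a
  submodule. This lets independence pass to unions of chains and makes coordinates finitely
  supported.\<close>

lemma spanned_finite:
  assumes "G \<subseteq> L" "x \<in> spanned G"
  shows "\<exists>F. finite F \<and> F \<subseteq> G \<and> x \<in> spanned F"
proof -
  let ?U = "{x. \<exists>F. finite F \<and> F \<subseteq> G \<and> x \<in> spanned F}"
  have s: "sub (spanned F)" if "F \<subseteq> G" for F using that spanned_sub' assms(1) by blast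
  have "sub ?U"
  proof (rule submoduleI)
    show "?U \<subseteq> carrier M" using s sub_carrier by blast
    show "\<zero>\<^bsub>M\<^esub> \<in> ?U" using sub_zero[OF s[of "{}"]] by (intro CollectI exI[of _ "{}"]) auto
    show "\<ominus>\<^bsub>M\<^esub> a \<in> ?U" if "a \<in> ?U" for a using that sub_neg[OF s] by blast
    show "r \<odot>\<^bsub>M\<^esub> a \<in> ?U" if "r \<in> carrier R" "a \<in> ?U" for r a using that sub_smult[OF s] by blast
    fix a b assume "a \<in> ?U" "b \<in> ?U"
    then obtain F F' where F: "finite F" "F \<subseteq> G" "a \<in> spanned F" "finite F'" "F' \<subseteq> G" "b \<in> spanned F'" by blast
    then have FF: "F \<union> F' \<subseteq> G" "finite (F \<union> F')" by auto
    then have "F \<union> F' \<subseteq> L" using assms(1) by (meson subset_trans)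
    then have "a \<in> spanned (F \<union> F')" "b \<in> spanned (F \<union> F')"
      using spanned_mono[of F "F \<union> F'"] spanned_mono[of F' "F \<union> F'"] F by auto
    then have "a \<oplus>\<^bsub>M\<^esub> b \<in> spanned (F \<union> F')" using sub_add[OF s[OF FF(1)]] by auto
    then show "a \<oplus>\<^bsub>M\<^esub> b \<in> ?U" using FF by blast
  qed
  moreover have "G \<subseteq> ?U"
  proof
    fix b assume b: "b \<in> G"
    have "b \<in> spanned {b}" using spanned_upper[of "{b}"] by auto
    then show "b \<in> ?U" using b by (intro CollectI exI[of _ "{b}"]) auto
  qed
  ultimately show ?thesis using spanned_least[of ?U G] assms(2) by blast
qed

text \<open>Linear independence over the quotient field, expressed inside \<open>L\<close> by clearing denominators.\<close>

definition independent :: "'c set \<Rightarrow> bool" where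
  "independent G \<longleftrightarrow> G \<subseteq> L \<and> (\<forall>b\<in>G. \<forall>r\<in>carrier R. r \<noteq> \<zero> \<longrightarrow> r \<odot>\<^bsub>M\<^esub> b \<notin> spanned (G - {b}))"

text \<open>Zorn's lemma; a dependence in a union of a chain occurs in one of its members. That
  every \<open>x\<close> has a nonzero multiple in the span says that \<open>B\<close> is a basis
  after clearing denominators.\<close>

lemma maximal_independent:
  obtains B where "independent B" "\<And>x. x \<in> L \<Longrightarrow> \<exists>r\<in>carrier R. r \<noteq> \<zero> \<and> r \<odot>\<^bsub>M\<^esub> x \<in> spanned B"
proof -
  have "\<exists>B\<in>Collect independent. \<forall>B'\<in>Collect independent. B \<subseteq> B' \<longrightarrow> B' = B"
  proof (rule subset_Zorn_nonempty)
    have "independent {}" unfolding independent_def by auto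
    then show "Collect independent \<noteq> {}" by blast
    fix C assume C: "C \<noteq> {}" "subset.chain (Collect independent) C"
    have ind: "independent G" if "G \<in> C" for G using C(2) that unfolding subset_chain_def by auto
    have "independent (\<Union>C)"
      unfolding independent_def
    proof (intro conjI ballI impI)
      show CL: "\<Union>C \<subseteq> L" using ind unfolding independent_def by blast
      fix b r assume b: "b \<in> \<Union>C" and r: "r \<in> carrier R" "r \<noteq> \<zero>"
      show "r \<odot>\<^bsub>M\<^esub> b \<notin> spanned (\<Union>C - {b})"
      proof
        assume "r \<odot>\<^bsub>M\<^esub> b \<in> spanned (\<Union>C - {b})"
        moreover have "\<Union>C - {b} \<subseteq> L" using CL by blast
        ultimately obtain F where F: "finite F" "F \<subseteq> \<Union>C - {b}" "r \<odot>\<^bsub>M\<^esub> b \<in> spanned F"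
          using spanned_finite by metis
        have "\<exists>G\<in>C. insert b F \<subseteq> G"
        proof (rule finite_subset_Union_chain[of "insert b F" C "Collect independent"])
          show "finite (insert b F)" "insert b F \<subseteq> \<Union>C" "C \<noteq> {}" using F b C by auto
          show "subset.chain (Collect independent) C" using C(2) .
        qed auto
        then obtain G where G: "G \<in> C" "b \<in> G" "F \<subseteq> G - {b}" using F(2) by blast
        have "G - {b} \<subseteq> L" using ind[OF G(1)] unfolding independent_def by auto
        then have "r \<odot>\<^bsub>M\<^esub> b \<in> spanned (G - {b})" using spanned_mono[OF G(3)] F(3) by blast
        then show False using ind[OF G(1)] G(2) r unfolding independent_def by blast
      qed
    qed
    then show "\<Union>C \<in> Collect independent" by simp
  qed
  then obtain B where B: "independent B" "\<And>B'. independent B' \<Longrightarrow> B \<subseteq> B' \<Longrightarrow> B' = B" by blast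
  have BL: "B \<subseteq> L" using B(1) unfolding independent_def by auto
  have "\<exists>r\<in>carrier R. r \<noteq> \<zero> \<and> r \<odot>\<^bsub>M\<^esub> x \<in> spanned B" if x: "x \<in> L" for x
  proof (rule ccontr)
    assume n: "\<not> ?thesis"
    have xB: "x \<notin> B"
      using n spanned_upper[of B] L_carrier[OF x] R.one_closed R.one_not_zero by (metis smult_one subsetD)
    have xc: "x \<in> carrier M" using L_carrier[OF x] .
    have "independent (insert x B)"
      unfolding independent_def
    proof (intro conjI ballI impI)
      show "insert x B \<subseteq> L" using BL x by auto
      fix b r assume b: "b \<in> insert x B" and r: "r \<in> carrier R" "r \<noteq> \<zero>"
      show "r \<odot>\<^bsub>M\<^esub> b \<notin> spanned (insert x B - {b})"
      proof (cases "b = x")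
        case True
        then have "insert x B - {b} = B" using xB by auto
        then show ?thesis using n r True by auto
      next
        case False
        then have bB: "b \<in> B" using b by auto
        have e: "insert x B - {b} = insert x (B - {b})" using False by auto
        have s: "B - {b} \<subseteq> L" using BL by auto
        have bc: "b \<in> carrier M" using bB BL L_carrier by auto
        show ?thesis
        proof
          assume "r \<odot>\<^bsub>M\<^esub> b \<in> spanned (insert x B - {b})"
          then obtain v k where v: "v \<in> spanned (B - {b})" "k \<in> carrier R" "r \<odot>\<^bsub>M\<^esub> b = v \<oplus>\<^bsub>M\<^esub> k \<odot>\<^bsub>M\<^esub> x"
            using spanned_insert[OF s x] unfolding e by blast
          show False
          \<comment> \<open>If \<open>x\<close> does not occur, the relation contradicts the
            independence of \<open>B\<close>; if it does, a nonzero multiple of \<open>x\<close>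
            lies in the span of \<open>B\<close>, contrary to the assumption.\<close>
          proof (cases "k = \<zero>")
            case True
            then have "r \<odot>\<^bsub>M\<^esub> b = v" using v xc sub_carrier[OF spanned_sub'[OF s]] by simp
            then show False using v bB r B(1) unfolding independent_def by auto
          next
            case k: False
            note sB = spanned_sub'[OF BL]
            have "v \<in> spanned B" using spanned_mono[OF _ BL, of "B - {b}"] v by auto
            moreover have "r \<odot>\<^bsub>M\<^esub> b \<in> spanned B" using sub_smult[OF sB r(1)] spanned_upper[of B] bB by auto
            ultimately have "k \<odot>\<^bsub>M\<^esub> x \<in> spanned B"
              using sub_cancel[OF sB, of v "k \<odot>\<^bsub>M\<^esub> x"] v xc by auto
            then show False using n v(2) k by auto
          qed
        qed
      qed
    qed
    then show False using B(2)[of "insert x B"] xB by auto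
  qed
  then show thesis using that B(1) by blast
qed

text \<open>The index set is the basis itself, which explains the type of \<open>I\<close>.
  Injectivity of the coordinate map rests on the absence of torsion, surjectivity on
  divisibility.\<close>

lemma isomorphic_copies:
  "\<exists>I :: 'c set. module_isomorphic R (M\<lparr>carrier := L\<rparr>) (direct_sum_copies I (quotient_field_module R))"
proof -
  obtain B where B: "independent B" and full: "\<And>x. x \<in> L \<Longrightarrow> \<exists>r\<in>carrier R. r \<noteq> \<zero> \<and> r \<odot>\<^bsub>M\<^esub> x \<in> spanned B"
    using maximal_independent by blast
  interpret KR: cring K by (rule K.cring_Q)
  have BL: "B \<subseteq> L" using B unfolding independent_def by auto
  have sB: "sub (spanned (B - {b}))" for b using BL by (intro spanned_sub') auto
  note cB = sub_carrier[OF sB]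
  define C where "C x b k r \<longleftrightarrow> k \<in> carrier R \<and> r \<in> carrier R \<and> r \<noteq> \<zero> \<and>
    (\<exists>v\<in>spanned (B - {b}). r \<odot>\<^bsub>M\<^esub> x = v \<oplus>\<^bsub>M\<^esub> k \<odot>\<^bsub>M\<^esub> b)" for x b k r
  have ex: "\<exists>k r. C x b k r" if x: "x \<in> L" and b: "b \<in> B" for x b
  proof -
    obtain r where r: "r \<in> carrier R" "r \<noteq> \<zero>" "r \<odot>\<^bsub>M\<^esub> x \<in> spanned B" using full[OF x] by auto
    have "insert b (B - {b}) = B" "B - {b} \<subseteq> L" "b \<in> L" using b BL by auto
    then obtain v k where "v \<in> spanned (B - {b})" "k \<in> carrier R" "r \<odot>\<^bsub>M\<^esub> x = v \<oplus>\<^bsub>M\<^esub> k \<odot>\<^bsub>M\<^esub> b"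
      using spanned_insert[of "B - {b}" b "r \<odot>\<^bsub>M\<^esub> x"] r by auto
    then show ?thesis unfolding C_def using r by blast
  qed
  \<comment> \<open>Two relations for the same \<open>x\<close> and \<open>b\<close>, scaled to a
    common left side, differ by a multiple of \<open>b\<close> in the span of the rest; independence
    makes its coefficient vanish.\<close>
  have unique: "r' \<otimes> k = r \<otimes> k'" if x: "x \<in> L" and b: "b \<in> B" and C: "C x b k r" "C x b k' r'" for x b k r k' r'
  proof (rule ccontr)
    assume ne: "r' \<otimes> k \<noteq> r \<otimes> k'"
    obtain v v' where v: "v \<in> spanned (B - {b})" "r \<odot>\<^bsub>M\<^esub> x = v \<oplus>\<^bsub>M\<^esub> k \<odot>\<^bsub>M\<^esub> b"
      "v' \<in> spanned (B - {b})" "r' \<odot>\<^bsub>M\<^esub> x = v' \<oplus>\<^bsub>M\<^esub> k' \<odot>\<^bsub>M\<^esub> b" using C unfolding C_def by auto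
    have c: "k \<in> carrier R" "r \<in> carrier R" "k' \<in> carrier R" "r' \<in> carrier R" using C unfolding C_def by auto
    have cc: "v \<in> carrier M" "v' \<in> carrier M" "b \<in> carrier M" "x \<in> carrier M"
      using v cB b BL x L_carrier by auto
    have "r' \<odot>\<^bsub>M\<^esub> v \<oplus>\<^bsub>M\<^esub> (r' \<otimes> k) \<odot>\<^bsub>M\<^esub> b = r' \<odot>\<^bsub>M\<^esub> (r \<odot>\<^bsub>M\<^esub> x)"
      unfolding v(2) using c cc by (simp add: smult_r_distr smult_assoc1)
    also have "\<dots> = r \<odot>\<^bsub>M\<^esub> (r' \<odot>\<^bsub>M\<^esub> x)" using c cc by (simp add: smult_assoc1[symmetric] R.m_comm)
    also have "\<dots> = r \<odot>\<^bsub>M\<^esub> v' \<oplus>\<^bsub>M\<^esub> (r \<otimes> k') \<odot>\<^bsub>M\<^esub> b"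
      unfolding v(4) using c cc by (simp add: smult_r_distr smult_assoc1)
    finally have eq: "r' \<odot>\<^bsub>M\<^esub> v \<oplus>\<^bsub>M\<^esub> (r' \<otimes> k) \<odot>\<^bsub>M\<^esub> b = r \<odot>\<^bsub>M\<^esub> v' \<oplus>\<^bsub>M\<^esub> (r \<otimes> k') \<odot>\<^bsub>M\<^esub> b" .
    have "r' \<odot>\<^bsub>M\<^esub> v \<oplus>\<^bsub>M\<^esub> (r' \<otimes> k \<oplus> \<ominus> (r \<otimes> k')) \<odot>\<^bsub>M\<^esub> b = (r' \<odot>\<^bsub>M\<^esub> v \<oplus>\<^bsub>M\<^esub> (r' \<otimes> k) \<odot>\<^bsub>M\<^esub> b) \<oplus>\<^bsub>M\<^esub> \<ominus>\<^bsub>M\<^esub> ((r \<otimes> k') \<odot>\<^bsub>M\<^esub> b)"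
      using c cc by (simp add: smult_l_distr smult_l_minus M.a_assoc)
    also have "\<dots> = r \<odot>\<^bsub>M\<^esub> v'" unfolding eq using c cc by (simp add: M.a_assoc M.r_neg)
    finally have "r' \<odot>\<^bsub>M\<^esub> v \<oplus>\<^bsub>M\<^esub> (r' \<otimes> k \<oplus> \<ominus> (r \<otimes> k')) \<odot>\<^bsub>M\<^esub> b \<in> spanned (B - {b})"
      using sub_smult[OF sB] c v by simp
    then have "(r' \<otimes> k \<oplus> \<ominus> (r \<otimes> k')) \<odot>\<^bsub>M\<^esub> b \<in> spanned (B - {b})"
      by (rule sub_cancel[OF sB, rotated 2]) (use sub_smult[OF sB] c v cc in auto)
    moreover have "r' \<otimes> k \<oplus> \<ominus> (r \<otimes> k') \<noteq> \<zero>"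
    proof
      assume "r' \<otimes> k \<oplus> \<ominus> (r \<otimes> k') = \<zero>"
      then have "\<ominus> (\<ominus> (r \<otimes> k')) = r' \<otimes> k" using c by (intro R.minus_equality) auto
      then show False using ne c by simp
    qed
    ultimately show False using B b c unfolding independent_def by blast
  qed
  \<comment> \<open>\<open>C x b k r\<close> says that the coordinate of \<open>x\<close> at \<open>b\<close> is \<open>k / r\<close>.\<close>
  define cf where "cf x b = (THE q. \<exists>k r. C x b k r \<and> q = fr k r)" for x b
  have cf: "cf x b = fr k r" if "x \<in> L" "b \<in> B" "C x b k r" for x b k r
    unfolding cf_def
  proof (rule the_equality)
    show "\<exists>k' r'. C x b k' r' \<and> fr k r = fr k' r'" using that by auto
    fix q assume "\<exists>k' r'. C x b k' r' \<and> q = fr k' r'"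
    then obtain k' r' where C': "C x b k' r'" "q = fr k' r'" by auto
    then have "r \<otimes> k' = r' \<otimes> k" using unique[OF that(1,2) C'(1) that(3)] by simp
    then show "q = fr k r" using C' that(3) K.fraction_eq unfolding C_def by auto
  qed
  let ?Q = "quotient_field_module R"
  let ?N = "direct_sum_copies B ?Q"
  have Qs: "carrier ?Q = carrier K" "\<zero>\<^bsub>?Q\<^esub> = \<zero>\<^bsub>K\<^esub>" "\<And>a b. a \<oplus>\<^bsub>?Q\<^esub> b = a \<oplus>\<^bsub>K\<^esub> b"
    "\<And>r q. r \<odot>\<^bsub>?Q\<^esub> q = fr r \<one> \<otimes>\<^bsub>K\<^esub> q"
    unfolding quotient_field_module_def quotient_field_def to_quotient_field_def by auto
  have cfK: "cf x b \<in> carrier K" if "x \<in> L" "b \<in> B" for x b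
  proof -
    have "\<exists>k r. C x b k r" using ex[OF that] .
    then obtain k r where C: "C x b k r" by auto
    then have "k \<in> carrier R" "r \<in> carrier R - {\<zero>}" unfolding C_def by auto
    then show ?thesis using cf[OF that C] K.frac_closed by simp
  qed
  have cf0: "cf x b = \<zero>\<^bsub>K\<^esub>" if x: "x \<in> L" "b \<in> B" "r \<in> carrier R" "r \<noteq> \<zero>" "r \<odot>\<^bsub>M\<^esub> x \<in> spanned (B - {b})" for x b r
  proof -
    have "b \<in> carrier M" "r \<odot>\<^bsub>M\<^esub> x \<in> carrier M" using x BL L_carrier cB by auto
    then have "C x b \<zero> r" unfolding C_def using x by (auto intro!: bexI[of _ "r \<odot>\<^bsub>M\<^esub> x"])
    then show ?thesis using cf x by (simp add: K.Q_zero K.fraction_eq)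
  qed
  have cf_add: "cf (x \<oplus>\<^bsub>M\<^esub> y) b = cf x b \<oplus>\<^bsub>K\<^esub> cf y b" if "x \<in> L" "y \<in> L" "b \<in> B" for x y b
  proof -
    have "\<exists>k r. C x b k r" "\<exists>k r. C y b k r" using ex that by auto
    then obtain k r k' r' where C: "C x b k r" "C y b k' r'" by auto
    obtain v v' where v: "v \<in> spanned (B - {b})" "r \<odot>\<^bsub>M\<^esub> x = v \<oplus>\<^bsub>M\<^esub> k \<odot>\<^bsub>M\<^esub> b"
      "v' \<in> spanned (B - {b})" "r' \<odot>\<^bsub>M\<^esub> y = v' \<oplus>\<^bsub>M\<^esub> k' \<odot>\<^bsub>M\<^esub> b" using C unfolding C_def by auto
    have c: "k \<in> carrier R" "r \<in> carrier R" "k' \<in> carrier R" "r' \<in> carrier R" "r \<noteq> \<zero>" "r' \<noteq> \<zero>"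
      using C unfolding C_def by auto
    have cc: "v \<in> carrier M" "v' \<in> carrier M" "b \<in> carrier M" "x \<in> carrier M" "y \<in> carrier M"
      using v cB that BL L_carrier by auto
    have "(r \<otimes> r') \<odot>\<^bsub>M\<^esub> (x \<oplus>\<^bsub>M\<^esub> y) = r' \<odot>\<^bsub>M\<^esub> (r \<odot>\<^bsub>M\<^esub> x) \<oplus>\<^bsub>M\<^esub> r \<odot>\<^bsub>M\<^esub> (r' \<odot>\<^bsub>M\<^esub> y)"
      using c cc by (simp add: smult_r_distr smult_assoc1[symmetric] R.m_comm)
    also have "\<dots> = (r' \<odot>\<^bsub>M\<^esub> v \<oplus>\<^bsub>M\<^esub> r \<odot>\<^bsub>M\<^esub> v') \<oplus>\<^bsub>M\<^esub> (k \<otimes> r' \<oplus> k' \<otimes> r) \<odot>\<^bsub>M\<^esub> b"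
      unfolding v(2,4) using c cc
      by (simp add: smult_r_distr smult_l_distr smult_assoc1[symmetric] R.m_comm M.a_ac)
    finally have "(r \<otimes> r') \<odot>\<^bsub>M\<^esub> (x \<oplus>\<^bsub>M\<^esub> y) = (r' \<odot>\<^bsub>M\<^esub> v \<oplus>\<^bsub>M\<^esub> r \<odot>\<^bsub>M\<^esub> v') \<oplus>\<^bsub>M\<^esub> (k \<otimes> r' \<oplus> k' \<otimes> r) \<odot>\<^bsub>M\<^esub> b" .
    moreover have "r' \<odot>\<^bsub>M\<^esub> v \<oplus>\<^bsub>M\<^esub> r \<odot>\<^bsub>M\<^esub> v' \<in> spanned (B - {b})" using c sub_add[OF sB] sub_smult[OF sB] v by auto
    moreover have "r \<otimes> r' \<noteq> \<zero>" using c R.integral by blast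
    ultimately have "C (x \<oplus>\<^bsub>M\<^esub> y) b (k \<otimes> r' \<oplus> k' \<otimes> r) (r \<otimes> r')"
      unfolding C_def using c by blast
    then have "cf (x \<oplus>\<^bsub>M\<^esub> y) b = fr (k \<otimes> r' \<oplus> k' \<otimes> r) (r \<otimes> r')" using cf sub_add[OF L_sub] that by auto
    then show ?thesis using cf[OF that(1,3) C(1)] cf[OF that(2,3) C(2)] c by (simp add: K.frac_add)
  qed
  have cf_smult: "cf (t \<odot>\<^bsub>M\<^esub> x) b = fr t \<one> \<otimes>\<^bsub>K\<^esub> cf x b" if "t \<in> carrier R" "x \<in> L" "b \<in> B" for t x b
  proof -
    have "\<exists>k r. C x b k r" using ex that by auto
    then obtain k r where C: "C x b k r" by auto
    obtain v where v: "v \<in> spanned (B - {b})" "r \<odot>\<^bsub>M\<^esub> x = v \<oplus>\<^bsub>M\<^esub> k \<odot>\<^bsub>M\<^esub> b" using C unfolding C_def by auto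
    have c: "k \<in> carrier R" "r \<in> carrier R" "r \<noteq> \<zero>" using C unfolding C_def by auto
    have cc: "v \<in> carrier M" "b \<in> carrier M" "x \<in> carrier M" using v cB that BL L_carrier by auto
    have "r \<odot>\<^bsub>M\<^esub> (t \<odot>\<^bsub>M\<^esub> x) = t \<odot>\<^bsub>M\<^esub> (r \<odot>\<^bsub>M\<^esub> x)" using c cc that by (simp add: smult_assoc1[symmetric] R.m_comm)
    also have "\<dots> = t \<odot>\<^bsub>M\<^esub> v \<oplus>\<^bsub>M\<^esub> (t \<otimes> k) \<odot>\<^bsub>M\<^esub> b" unfolding v(2) using c cc that by (simp add: smult_r_distr smult_assoc1)
    finally have "r \<odot>\<^bsub>M\<^esub> (t \<odot>\<^bsub>M\<^esub> x) = t \<odot>\<^bsub>M\<^esub> v \<oplus>\<^bsub>M\<^esub> (t \<otimes> k) \<odot>\<^bsub>M\<^esub> b" .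
    moreover have "t \<odot>\<^bsub>M\<^esub> v \<in> spanned (B - {b})" using sub_smult[OF sB that(1) v(1)] .
    ultimately have "C (t \<odot>\<^bsub>M\<^esub> x) b (t \<otimes> k) r" unfolding C_def using c that(1) by blast
    then have "cf (t \<odot>\<^bsub>M\<^esub> x) b = fr (t \<otimes> k) r" using cf sub_smult[OF L_sub] that by auto
    then show ?thesis using cf[OF that(2,3) C] c that by (simp add: K.frac_mult)
  qed
  have fin: "\<exists>F. finite F \<and> F \<subseteq> B \<and> (\<exists>r\<in>carrier R. r \<noteq> \<zero> \<and> r \<odot>\<^bsub>M\<^esub> x \<in> spanned F)" if x: "x \<in> L" for x
  proof -
    obtain r where r: "r \<in> carrier R" "r \<noteq> \<zero>" "r \<odot>\<^bsub>M\<^esub> x \<in> spanned B" using full[OF x] by auto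
    obtain F where "finite F" "F \<subseteq> B" "r \<odot>\<^bsub>M\<^esub> x \<in> spanned F" using spanned_finite[OF BL r(3)] by auto
    then show ?thesis using r(1,2) by auto
  qed
  have supp: "finite {b \<in> B. cf x b \<noteq> \<zero>\<^bsub>K\<^esub>}" if x: "x \<in> L" for x
  proof -
    obtain F r where F: "finite F" "F \<subseteq> B" "r \<in> carrier R" "r \<noteq> \<zero>" "r \<odot>\<^bsub>M\<^esub> x \<in> spanned F" using fin[OF x] by blast
    have "b \<in> F" if "b \<in> B" "cf x b \<noteq> \<zero>\<^bsub>K\<^esub>" for b
    proof (rule ccontr)
      assume "b \<notin> F"
      then have "spanned F \<subseteq> spanned (B - {b})" using F(2) BL by (intro spanned_mono) auto
      then show False using cf0[OF x that(1) F(3,4)] F(5) that(2) by auto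
    qed
    then show ?thesis by (intro finite_subset[OF _ F(1)]) auto
  qed
  define \<Phi> where "\<Phi> x = (\<lambda>b\<in>B. cf x b)" for x
  have \<Phi>_carrier: "\<Phi> x \<in> carrier ?N" if "x \<in> L" for x
  proof -
    have "{i \<in> B. \<Phi> x i \<noteq> \<zero>\<^bsub>K\<^esub>} = {b \<in> B. cf x b \<noteq> \<zero>\<^bsub>K\<^esub>}" unfolding \<Phi>_def by auto
    then show ?thesis using supp[OF that] cfK[OF that] unfolding direct_sum_copies_def Qs by (simp add: \<Phi>_def)
  qed
  have \<Phi>_add: "\<Phi> (x \<oplus>\<^bsub>M\<^esub> y) = \<Phi> x \<oplus>\<^bsub>?N\<^esub> \<Phi> y" if "x \<in> L" "y \<in> L" for x y
    unfolding \<Phi>_def direct_sum_copies_def using cf_add[OF that] by (auto simp: Qs fun_eq_iff)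
  have \<Phi>_hom: "\<Phi> \<in> module_hom R (M\<lparr>carrier := L\<rparr>) ?N"
    unfolding module_hom_def hom_def
  proof (intro CollectI conjI ballI Pi_I)
    show "\<Phi> x \<in> carrier (add_monoid ?N)" if "x \<in> carrier (add_monoid (M\<lparr>carrier := L\<rparr>))" for x
      using \<Phi>_carrier that by simp
    show "\<Phi> (x \<otimes>\<^bsub>add_monoid (M\<lparr>carrier := L\<rparr>)\<^esub> y) = \<Phi> x \<otimes>\<^bsub>add_monoid ?N\<^esub> \<Phi> y"
      if "x \<in> carrier (add_monoid (M\<lparr>carrier := L\<rparr>))" "y \<in> carrier (add_monoid (M\<lparr>carrier := L\<rparr>))" for x y
      using \<Phi>_add that by simp
    show "\<Phi> (r \<odot>\<^bsub>M\<lparr>carrier := L\<rparr>\<^esub> x) = r \<odot>\<^bsub>?N\<^esub> \<Phi> x"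
      if "r \<in> carrier R" "x \<in> carrier (M\<lparr>carrier := L\<rparr>)" for r x
      unfolding \<Phi>_def direct_sum_copies_def using cf_smult that by (auto simp: Qs fun_eq_iff)
  qed
  \<comment> \<open>Induction over a finite set whose span contains a nonzero multiple of
    \<open>x\<close>: a zero coordinate at \<open>b\<close> lets \<open>b\<close> be dropped. For
    the empty set a nonzero multiple of \<open>x\<close> is zero, and \<open>L\<close> is
    torsion-free.\<close>
  have inj0: "x = \<zero>\<^bsub>M\<^esub>" if x: "x \<in> L" and z: "\<And>b. b \<in> B \<Longrightarrow> cf x b = \<zero>\<^bsub>K\<^esub>" for x
  proof -
    have "finite F \<Longrightarrow> F \<subseteq> B \<Longrightarrow> r \<in> carrier R \<Longrightarrow> r \<noteq> \<zero> \<Longrightarrow> r \<odot>\<^bsub>M\<^esub> x \<in> spanned F \<Longrightarrow> x = \<zero>\<^bsub>M\<^esub>" for F r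
    proof (induction F rule: finite_induct)
      case empty
      then have "r \<odot>\<^bsub>M\<^esub> x = \<zero>\<^bsub>M\<^esub>" using spanned_least[OF sub_zero_singleton, of "{}"] by auto
      then show ?case using L_cancel empty x by auto
    next
      case (insert b F)
      then have FL: "F \<subseteq> L" "b \<in> L" "b \<in> B" using BL by auto
      obtain v k where v: "v \<in> spanned F" "k \<in> carrier R" "r \<odot>\<^bsub>M\<^esub> x = v \<oplus>\<^bsub>M\<^esub> k \<odot>\<^bsub>M\<^esub> b"
        using spanned_insert[OF FL(1,2) insert.prems(4)] by auto
      have "spanned F \<subseteq> spanned (B - {b})" using insert BL by (intro spanned_mono) auto
      then have "C x b k r" unfolding C_def using v insert by blast
      then have "fr k r = \<zero>\<^bsub>K\<^esub>" using cf[OF x FL(3)] z[OF FL(3)] by simp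
      then have "k = \<zero>" using v insert.prems by (simp add: K.Q_zero K.fraction_eq)
      then have "r \<odot>\<^bsub>M\<^esub> x = v" using v FL L_carrier spanned_in_L[OF FL(1)] by auto
      then show ?case using insert v by auto
    qed
    then show ?thesis using fin[OF x] by blast
  qed
  have "inj_on \<Phi> L"
  proof (rule inj_onI)
    fix x y assume xy: "x \<in> L" "y \<in> L" "\<Phi> x = \<Phi> y"
    have c: "x \<in> carrier M" "y \<in> carrier M" using xy L_carrier by auto
    have yL: "\<ominus>\<^bsub>M\<^esub> y \<in> L" using sub_neg[OF L_sub] xy by auto
    have dL: "x \<oplus>\<^bsub>M\<^esub> \<ominus>\<^bsub>M\<^esub> y \<in> L" using sub_add[OF L_sub] xy yL by auto
    have "cf (x \<oplus>\<^bsub>M\<^esub> \<ominus>\<^bsub>M\<^esub> y) b = \<zero>\<^bsub>K\<^esub>" if b: "b \<in> B" for b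
    proof -
      have "cf x b = cf y b" using xy(3) b unfolding \<Phi>_def by (metis restrict_apply')
      then have "cf (x \<oplus>\<^bsub>M\<^esub> \<ominus>\<^bsub>M\<^esub> y) b = cf (y \<oplus>\<^bsub>M\<^esub> \<ominus>\<^bsub>M\<^esub> y) b" using cf_add xy yL b by simp
      also have "y \<oplus>\<^bsub>M\<^esub> \<ominus>\<^bsub>M\<^esub> y = \<zero>\<^bsub>M\<^esub>" using c by (simp add: M.r_neg)
      also have "cf \<zero>\<^bsub>M\<^esub> b = \<zero>\<^bsub>K\<^esub>"
        using cf0[of "\<zero>\<^bsub>M\<^esub>" b \<one>] sub_zero[OF L_sub] sub_zero[OF sB] b by simp
      finally show ?thesis .
    qed
    then have "x \<oplus>\<^bsub>M\<^esub> \<ominus>\<^bsub>M\<^esub> y = \<zero>\<^bsub>M\<^esub>" using inj0[OF dL] by auto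
    then have "\<ominus>\<^bsub>M\<^esub> (\<ominus>\<^bsub>M\<^esub> y) = x" using c by (intro M.minus_equality) auto
    then show "x = y" using c by simp
  qed
  \<comment> \<open>Induction over a finite set outside which \<open>g\<close> vanishes. The entry
    \<open>k / r\<close> at \<open>c\<close> comes from a \<open>y\<close> with
    \<open>r y = k c\<close>, supplied by divisibility, whose other coordinates are zero.\<close>
  moreover have "\<exists>x\<in>L. \<forall>b\<in>B. cf x b = g b"
    if F: "finite F" "F \<subseteq> B" and g: "\<And>b. b \<in> B \<Longrightarrow> g b \<in> carrier K" "\<And>b. b \<in> B \<Longrightarrow> b \<notin> F \<Longrightarrow> g b = \<zero>\<^bsub>K\<^esub>" for F g
    using that
  proof (induction F arbitrary: g rule: finite_induct)
    case empty
    have "cf \<zero>\<^bsub>M\<^esub> b = g b" if "b \<in> B" for b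
      using cf0[of "\<zero>\<^bsub>M\<^esub>" b \<one>] sub_zero[OF L_sub] sub_zero[OF sB] that empty by simp
    then show ?case using sub_zero[OF L_sub] by auto
  next
    case (insert c F)
    have "\<exists>x\<in>L. \<forall>b\<in>B. cf x b = (g(c := \<zero>\<^bsub>K\<^esub>)) b"
      by (rule insert.IH) (use insert in auto)
    then obtain x where x: "x \<in> L" "\<And>b. b \<in> B \<Longrightarrow> cf x b = (g(c := \<zero>\<^bsub>K\<^esub>)) b" by auto
    have cB': "c \<in> B" "c \<in> L" "c \<in> carrier M" using insert BL L_carrier by auto
    obtain k r where kr: "k \<in> carrier R" "r \<in> carrier R - {\<zero>}" "g c = fr k r"
      using K.fracE[OF insert.prems(2)[OF cB'(1)]] by metis
    have "k \<odot>\<^bsub>M\<^esub> c \<in> L" using sub_smult[OF L_sub kr(1) cB'(2)] .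
    then obtain y where y: "y \<in> L" "k \<odot>\<^bsub>M\<^esub> c = r \<odot>\<^bsub>M\<^esub> y" using L_divisible kr(2) unfolding divisible_def by blast
    have "C y c k r" unfolding C_def using kr y cB' sub_zero[OF sB] L_carrier[OF y(1)]
      by (auto intro!: bexI[of _ "\<zero>\<^bsub>M\<^esub>"])
    then have yc: "cf y c = g c" using cf[OF y(1) cB'(1)] kr by simp
    have yb: "cf y b = \<zero>\<^bsub>K\<^esub>" if "b \<in> B" "b \<noteq> c" for b
    proof (rule cf0[OF y(1) that(1)])
      show "r \<in> carrier R" "r \<noteq> \<zero>" using kr by auto
      have "c \<in> spanned (B - {b})" using spanned_upper[of "B - {b}"] that cB' by auto
      then show "r \<odot>\<^bsub>M\<^esub> y \<in> spanned (B - {b})" using sub_smult[OF sB kr(1)] y(2) by metis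
    qed
    have "cf (x \<oplus>\<^bsub>M\<^esub> y) b = g b" if b: "b \<in> B" for b
    proof (cases "b = c")
      case True
      then show ?thesis using cf_add[OF x(1) y(1) b] x(2)[OF b] yc insert.prems(2)[OF b] by simp
    next
      case False
      then show ?thesis using cf_add[OF x(1) y(1) b] x(2)[OF b] yb[OF b] insert.prems(2)[OF b] by simp
    qed
    then show ?case using sub_add[OF L_sub x(1) y(1)] by blast
  qed
  note surj = this
  have "\<Phi> ` L = carrier ?N"
  proof
    show "\<Phi> ` L \<subseteq> carrier ?N" using \<Phi>_carrier by auto
    show "carrier ?N \<subseteq> \<Phi> ` L"
    proof
      fix g assume "g \<in> carrier ?N"
      then have g: "g \<in> B \<rightarrow>\<^sub>E carrier K" "finite {b \<in> B. g b \<noteq> \<zero>\<^bsub>K\<^esub>}"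
        unfolding direct_sum_copies_def by (auto simp: Qs)
      have "\<exists>x\<in>L. \<forall>b\<in>B. cf x b = g b"
        by (rule surj[OF g(2)]) (use g(1) in auto)
      then obtain x where x: "x \<in> L" "\<forall>b\<in>B. cf x b = g b" by auto
      have "\<Phi> x = g" unfolding \<Phi>_def using x(2) g(1) by (auto simp: fun_eq_iff restrict_def PiE_def extensional_def)
      then show "g \<in> \<Phi> ` L" using x by auto
    qed
  qed
  ultimately have "bij_betw \<Phi> L (carrier ?N)" unfolding bij_betw_def by auto
  then show ?thesis unfolding module_isomorphic_def using \<Phi>_hom by (intro exI[of _ B] bexI[of _ \<Phi>]) auto
qed

end

text \<open>Division by \<open>r\<close> is done coordinatewise by the fraction
  \<open>1 / r\<close>, which cannot enlarge the support; injectivity of the isomorphism brings the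
  result back to \<open>L\<close>.\<close>

lemma (in dedekind_module) copies_divisible:
  assumes L: "sub L" and iso: "module_isomorphic R (M\<lparr>carrier := L\<rparr>) (direct_sum_copies I (quotient_field_module R))"
  shows "divisible L"
  unfolding divisible_def
proof (intro ballI impI)
  interpret K: domain_localization R "carrier R - {\<zero>}" by (rule localization_quotient_field)
  let ?K = "localization R (carrier R - {\<zero>})" and ?fr = "fraction R (carrier R - {\<zero>})"
  interpret KR: cring ?K by (rule K.cring_Q)
  let ?Q = "quotient_field_module R"
  let ?N = "direct_sum_copies I ?Q"
  have Qs: "carrier ?Q = carrier ?K" "\<zero>\<^bsub>?Q\<^esub> = \<zero>\<^bsub>?K\<^esub>" "\<And>a b. a \<oplus>\<^bsub>?Q\<^esub> b = a \<oplus>\<^bsub>?K\<^esub> b"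
    "\<And>r q. r \<odot>\<^bsub>?Q\<^esub> q = ?fr r \<one> \<otimes>\<^bsub>?K\<^esub> q"
    unfolding quotient_field_module_def quotient_field_def to_quotient_field_def by auto
  fix r x assume r: "r \<in> carrier R" "r \<noteq> \<zero>" and x: "x \<in> L"
  obtain f where f: "f \<in> module_hom R (M\<lparr>carrier := L\<rparr>) ?N" "bij_betw f L (carrier ?N)"
    using iso unfolding module_isomorphic_def by auto
  have q: "?fr r \<one> \<otimes>\<^bsub>?K\<^esub> ?fr \<one> r = \<one>\<^bsub>?K\<^esub>" "?fr r \<one> \<in> carrier ?K" "?fr \<one> r \<in> carrier ?K"
    using r by (simp_all add: K.frac_mult K.Q_one K.fraction_eq K.frac_closed)
  have "f x \<in> carrier ?N" using f(2) x by (auto simp: bij_betw_def)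
  then have fx: "f x \<in> I \<rightarrow>\<^sub>E carrier ?K" "finite {b \<in> I. f x b \<noteq> \<zero>\<^bsub>?K\<^esub>}"
    unfolding direct_sum_copies_def by (auto simp: Qs)
  define h where "h = (\<lambda>i\<in>I. ?fr \<one> r \<otimes>\<^bsub>?K\<^esub> f x i)"
  have "{b \<in> I. h b \<noteq> \<zero>\<^bsub>?K\<^esub>} \<subseteq> {b \<in> I. f x b \<noteq> \<zero>\<^bsub>?K\<^esub>}"
    unfolding h_def using q by auto
  then have hf: "finite {b \<in> I. h b \<noteq> \<zero>\<^bsub>?K\<^esub>}" using fx(2) by (rule finite_subset)
  have "h \<in> I \<rightarrow>\<^sub>E carrier ?K" unfolding h_def using fx(1) q by auto
  then have "h \<in> carrier ?N" using hf unfolding direct_sum_copies_def by (simp add: Qs)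
  then have "h \<in> f ` L" using f(2) by (simp add: bij_betw_def)
  then obtain y where y: "y \<in> L" "f y = h" by auto
  have e: "?fr r \<one> \<otimes>\<^bsub>?K\<^esub> (?fr \<one> r \<otimes>\<^bsub>?K\<^esub> z) = z" if "z \<in> carrier ?K" for z
    using q that by (simp add: KR.m_assoc[symmetric])
  have "r \<odot>\<^bsub>?N\<^esub> h = f x"
    unfolding direct_sum_copies_def h_def using e fx(1)
    by (auto simp: Qs fun_eq_iff restrict_def PiE_def extensional_def Pi_iff)
  moreover have "f (r \<odot>\<^bsub>M\<^esub> y) = r \<odot>\<^bsub>?N\<^esub> f y" using f(1) r y unfolding module_hom_def by auto
  ultimately have "f (r \<odot>\<^bsub>M\<^esub> y) = f x" using y by simp
  then have "r \<odot>\<^bsub>M\<^esub> y = x" using f(2) x y sub_smult[OF L r(1) y(1)] by (auto simp: bij_betw_def inj_on_def)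
  then show "\<exists>y\<in>L. x = r \<odot>\<^bsub>M\<^esub> y" using y by auto
qed


section \<open>Primary parts over the localization\<close>

locale primary_localization = dedekind_module +
  fixes p assumes p: "p \<in> P"
begin

abbreviation "S \<equiv> carrier R - p"
abbreviation "Rp \<equiv> localization R S"
abbreviation "fr \<equiv> fraction R S"
abbreviation "N \<equiv> primary_part_module R M p"
abbreviation "T \<equiv> prim p"

sublocale S: domain_localization R S
  by (rule localization_prime[OF primeD(1)[OF p]])

lemma T_sub: "sub T" using primary_sub[OF p] .

lemma T_carrier: "x \<in> T \<Longrightarrow> x \<in> carrier M" using sub_carrier[OF T_sub] .

lemma N_simps: "carrier N = T" "a \<oplus>\<^bsub>N\<^esub> b = a \<oplus>\<^bsub>M\<^esub> b" "\<zero>\<^bsub>N\<^esub> = \<zero>\<^bsub>M\<^esub>"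
  unfolding primary_part_module_def by auto

lemma N_subgroup_iff: "subgroup A (add_monoid N) \<longleftrightarrow> subgroup A (add_monoid (M\<lparr>carrier := T\<rparr>))"
  unfolding primary_part_module_def subgroup_def m_inv_def by simp

lemma smult_cancel:
  assumes "s \<in> S" "x \<in> T" "y \<in> T" "s \<odot>\<^bsub>M\<^esub> x = s \<odot>\<^bsub>M\<^esub> y" shows "x = y"
proof -
  have c: "x \<in> carrier M" "y \<in> carrier M" using assms T_carrier by auto
  have d: "x \<oplus>\<^bsub>M\<^esub> \<ominus>\<^bsub>M\<^esub> y \<in> T" using assms sub_add[OF T_sub] sub_neg[OF T_sub] by auto
  have "s \<odot>\<^bsub>M\<^esub> (x \<oplus>\<^bsub>M\<^esub> \<ominus>\<^bsub>M\<^esub> y) = \<zero>\<^bsub>M\<^esub>" using assms c by (simp add: smult_r_distr smult_r_minus M.r_neg)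
  then have "x \<oplus>\<^bsub>M\<^esub> \<ominus>\<^bsub>M\<^esub> y \<in> {\<zero>\<^bsub>M\<^esub>}" using primary_cancel[OF p assms(1) d sub_zero_singleton] by auto
  then have "\<ominus>\<^bsub>M\<^esub> (\<ominus>\<^bsub>M\<^esub> y) = x" using c by (intro M.minus_equality) auto
  then show ?thesis using c by simp
qed

text \<open>The defining description quantifies over all representatives of the fraction. One
  suffices: another is related to it by cross-multiplication, and \<open>s\<close> can be cancelled
  on the primary part.\<close>

lemma smult_fraction:
  assumes rs: "r \<in> carrier R" "s \<in> S" and xy: "x \<in> T" "y \<in> T" "s \<odot>\<^bsub>M\<^esub> y = r \<odot>\<^bsub>M\<^esub> x"
  shows "fr r s \<odot>\<^bsub>N\<^esub> x = y"
proof -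
  have c: "x \<in> carrier M" "y \<in> carrier M" using xy T_carrier by auto
  have "t \<odot>\<^bsub>M\<^esub> y = b \<odot>\<^bsub>M\<^esub> x" if "(b, t) \<in> fr r s" for b t
  proof -
    have bt: "b \<in> carrier R" "t \<in> S" "t \<otimes> r = s \<otimes> b" using that S.mem_fraction by auto
    have "s \<odot>\<^bsub>M\<^esub> (t \<odot>\<^bsub>M\<^esub> y) = t \<odot>\<^bsub>M\<^esub> (s \<odot>\<^bsub>M\<^esub> y)" using rs bt c by (simp add: smult_assoc1[symmetric] R.m_comm)
    also have "\<dots> = (t \<otimes> r) \<odot>\<^bsub>M\<^esub> x" unfolding xy(3) using rs bt(1,2) c by (simp add: smult_assoc1)
    also have "\<dots> = s \<odot>\<^bsub>M\<^esub> (b \<odot>\<^bsub>M\<^esub> x)" unfolding bt(3) using rs bt(1,2) c by (simp add: smult_assoc1)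
    finally show ?thesis using smult_cancel[OF rs(2)] sub_smult[OF T_sub] bt xy by auto
  qed
  moreover have "(r, s) \<in> fr r s" using S.mem_fraction rs by auto
  ultimately have "(THE y. y \<in> T \<and> (\<forall>(r, s)\<in>fr r s. s \<odot>\<^bsub>M\<^esub> y = r \<odot>\<^bsub>M\<^esub> x)) = y"
    using xy smult_cancel[OF rs(2)] by (intro the_equality) auto
  then show ?thesis unfolding primary_part_module_def by simp
qed

text \<open>The value exists because \<open>s\<close> is invertible at \<open>r x\<close>: from
  \<open>r x = k s r x\<close>, the element \<open>k r x\<close> is a solution.\<close>

lemma fraction_action:
  assumes "U \<in> carrier Rp" "x \<in> T"
  obtains r s y where "r \<in> carrier R" "s \<in> S" "U = fr r s" "y \<in> T" "s \<odot>\<^bsub>M\<^esub> y = r \<odot>\<^bsub>M\<^esub> x" "U \<odot>\<^bsub>N\<^esub> x = y"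
proof -
  obtain r s where rs: "r \<in> carrier R" "s \<in> S" "U = fr r s" using S.fracE[OF assms(1)] by metis
  have rx: "r \<odot>\<^bsub>M\<^esub> x \<in> T" "r \<odot>\<^bsub>M\<^esub> x \<in> carrier M" using sub_smult[OF T_sub rs(1) assms(2)] T_carrier by auto
  obtain k where k: "k \<in> carrier R" "r \<odot>\<^bsub>M\<^esub> x = k \<odot>\<^bsub>M\<^esub> (s \<odot>\<^bsub>M\<^esub> (r \<odot>\<^bsub>M\<^esub> x))" using primary_invertible[OF p rs(2) rx(1)] by auto
  have "s \<odot>\<^bsub>M\<^esub> (k \<odot>\<^bsub>M\<^esub> (r \<odot>\<^bsub>M\<^esub> x)) = k \<odot>\<^bsub>M\<^esub> (s \<odot>\<^bsub>M\<^esub> (r \<odot>\<^bsub>M\<^esub> x))"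
    using k(1) rs rx(2) by (simp add: smult_assoc1[symmetric] R.m_comm del: smult_assoc1)
  then have y: "s \<odot>\<^bsub>M\<^esub> (k \<odot>\<^bsub>M\<^esub> (r \<odot>\<^bsub>M\<^esub> x)) = r \<odot>\<^bsub>M\<^esub> x" using k(2) by simp
  have yT: "k \<odot>\<^bsub>M\<^esub> (r \<odot>\<^bsub>M\<^esub> x) \<in> T" using sub_smult[OF T_sub k(1) rx(1)] .
  show thesis using that[OF rs yT y] smult_fraction[OF rs(1,2) assms(2) yT y] rs(3) by simp
qed

text \<open>Each law for the scalars follows by naming the expected value and verifying its equation
  for one numerator and denominator.\<close>

lemma N_module: "module Rp N"
proof (rule moduleI)
  show "cring Rp" by (rule S.cring_Q)
  show "\<one>\<^bsub>Rp\<^esub> \<odot>\<^bsub>N\<^esub> x = x" if "x \<in> carrier N" for x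
    unfolding S.Q_one using smult_fraction[of \<one> \<one> x x] S.S_one T_carrier[of x] that by (simp add: N_simps)
  show "abelian_group N"
  proof (rule abelian_groupI, unfold N_simps)
    show "\<zero>\<^bsub>M\<^esub> \<in> T" by (rule sub_zero[OF T_sub])
    fix x assume x: "x \<in> T"
    show "\<exists>y\<in>T. y \<oplus>\<^bsub>M\<^esub> x = \<zero>\<^bsub>M\<^esub>"
      by (rule bexI[of _ "\<ominus>\<^bsub>M\<^esub> x"]) (rule M.l_neg[OF T_carrier[OF x]], rule sub_neg[OF T_sub x])
    show "\<zero>\<^bsub>M\<^esub> \<oplus>\<^bsub>M\<^esub> x = x" by (rule M.l_zero[OF T_carrier[OF x]])
    fix y assume y: "y \<in> T"
    show "x \<oplus>\<^bsub>M\<^esub> y \<in> T" by (rule sub_add[OF T_sub x y])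
    show "x \<oplus>\<^bsub>M\<^esub> y = y \<oplus>\<^bsub>M\<^esub> x" by (rule M.a_comm[OF T_carrier[OF x] T_carrier[OF y]])
    fix z assume z: "z \<in> T"
    show "x \<oplus>\<^bsub>M\<^esub> y \<oplus>\<^bsub>M\<^esub> z = x \<oplus>\<^bsub>M\<^esub> (y \<oplus>\<^bsub>M\<^esub> z)"
      by (rule M.a_assoc[OF T_carrier[OF x] T_carrier[OF y] T_carrier[OF z]])
  qed
  fix U x assume U: "U \<in> carrier Rp" and "x \<in> carrier N"
  then have x: "x \<in> T" using N_simps by simp
  obtain r s y where y: "r \<in> carrier R" "s \<in> S" "U = fr r s" "y \<in> T" "s \<odot>\<^bsub>M\<^esub> y = r \<odot>\<^bsub>M\<^esub> x" "U \<odot>\<^bsub>N\<^esub> x = y"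
    using fraction_action[OF U x] by metis
  note cx = T_carrier[OF x] and cy = T_carrier[OF y(4)]
  show "U \<odot>\<^bsub>N\<^esub> x \<in> carrier N" using y N_simps by simp
  { fix V assume V: "V \<in> carrier Rp"
    obtain t v z where z: "t \<in> carrier R" "v \<in> S" "V = fr t v" "z \<in> T" "v \<odot>\<^bsub>M\<^esub> z = t \<odot>\<^bsub>M\<^esub> x" "V \<odot>\<^bsub>N\<^esub> x = z"
      using fraction_action[OF V x] by metis
    note cz = T_carrier[OF z(4)]
    have "(s \<otimes> v) \<odot>\<^bsub>M\<^esub> (y \<oplus>\<^bsub>M\<^esub> z) = v \<odot>\<^bsub>M\<^esub> (s \<odot>\<^bsub>M\<^esub> y) \<oplus>\<^bsub>M\<^esub> s \<odot>\<^bsub>M\<^esub> (v \<odot>\<^bsub>M\<^esub> z)"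
      using y(2) z(2) cy cz by (simp add: smult_r_distr smult_assoc1[symmetric] R.m_comm)
    also have "\<dots> = (r \<otimes> v \<oplus> t \<otimes> s) \<odot>\<^bsub>M\<^esub> x"
      unfolding y(5) z(5) using y(1,2) z(1,2) cx by (simp add: smult_l_distr smult_assoc1[symmetric] R.m_comm)
    finally have e: "(s \<otimes> v) \<odot>\<^bsub>M\<^esub> (y \<oplus>\<^bsub>M\<^esub> z) = (r \<otimes> v \<oplus> t \<otimes> s) \<odot>\<^bsub>M\<^esub> x" .
    have "fr (r \<otimes> v \<oplus> t \<otimes> s) (s \<otimes> v) \<odot>\<^bsub>N\<^esub> x = y \<oplus>\<^bsub>M\<^esub> z"
      by (rule smult_fraction) (use e x y(1,2) z(1,2) sub_add[OF T_sub y(4) z(4)] S.S_mult in auto)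
    then show "(U \<oplus>\<^bsub>Rp\<^esub> V) \<odot>\<^bsub>N\<^esub> x = U \<odot>\<^bsub>N\<^esub> x \<oplus>\<^bsub>N\<^esub> V \<odot>\<^bsub>N\<^esub> x"
      unfolding y(6) z(6) unfolding y(3) z(3) using y z by (simp add: S.frac_add N_simps) }
  { fix x' assume "x' \<in> carrier N"
    then have x': "x' \<in> T" using N_simps by simp
    \<comment> \<open>The value at \<open>x'\<close> is built by hand so that it refers to the same
      \<open>r\<close> and \<open>s\<close> as the value at \<open>x\<close>;
      \<open>fraction_action\<close> would choose its own representative.\<close>
    obtain k where k: "k \<in> carrier R" "r \<odot>\<^bsub>M\<^esub> x' = k \<odot>\<^bsub>M\<^esub> (s \<odot>\<^bsub>M\<^esub> (r \<odot>\<^bsub>M\<^esub> x'))"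
      using primary_invertible[OF p y(2) sub_smult[OF T_sub y(1) x']] by auto
    define z where "z = k \<odot>\<^bsub>M\<^esub> (r \<odot>\<^bsub>M\<^esub> x')"
    have zT: "z \<in> T" unfolding z_def using sub_smult[OF T_sub] k y x' by auto
    have z: "s \<odot>\<^bsub>M\<^esub> z = r \<odot>\<^bsub>M\<^esub> x'"
    proof -
      have "s \<odot>\<^bsub>M\<^esub> z = k \<odot>\<^bsub>M\<^esub> (s \<odot>\<^bsub>M\<^esub> (r \<odot>\<^bsub>M\<^esub> x'))"
        unfolding z_def using k(1) y(1,2) T_carrier[OF x'] by (simp add: smult_assoc1[symmetric] R.m_ac)
      then show ?thesis using k by simp
    qed
    have "s \<odot>\<^bsub>M\<^esub> (y \<oplus>\<^bsub>M\<^esub> z) = r \<odot>\<^bsub>M\<^esub> (x \<oplus>\<^bsub>M\<^esub> x')"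
      using y z T_carrier[OF zT] T_carrier[OF x'] cx cy by (simp add: smult_r_distr)
    then have "fr r s \<odot>\<^bsub>N\<^esub> (x \<oplus>\<^bsub>M\<^esub> x') = y \<oplus>\<^bsub>M\<^esub> z"
      by (intro smult_fraction) (use y x x' zT sub_add[OF T_sub] in auto)
    moreover have "fr r s \<odot>\<^bsub>N\<^esub> x' = z" using smult_fraction y x' zT z by auto
    ultimately show "U \<odot>\<^bsub>N\<^esub> (x \<oplus>\<^bsub>N\<^esub> x') = U \<odot>\<^bsub>N\<^esub> x \<oplus>\<^bsub>N\<^esub> U \<odot>\<^bsub>N\<^esub> x'"
      unfolding y(6) unfolding y(3) by (simp add: N_simps) }
  { fix V assume V: "V \<in> carrier Rp"
    obtain t v z where z: "t \<in> carrier R" "v \<in> S" "V = fr t v" "z \<in> T" "v \<odot>\<^bsub>M\<^esub> z = t \<odot>\<^bsub>M\<^esub> y" "V \<odot>\<^bsub>N\<^esub> y = z"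
      using fraction_action[OF V y(4)] by metis
    note cz = T_carrier[OF z(4)]
    have "(v \<otimes> s) \<odot>\<^bsub>M\<^esub> z = s \<odot>\<^bsub>M\<^esub> (v \<odot>\<^bsub>M\<^esub> z)"
      using y(2) z(2) cz by (simp add: smult_assoc1[symmetric] R.m_comm)
    also have "\<dots> = t \<odot>\<^bsub>M\<^esub> (s \<odot>\<^bsub>M\<^esub> y)" unfolding z(5) using y(2) z(1) cy by (simp add: smult_assoc1[symmetric] R.m_comm)
    also have "\<dots> = (t \<otimes> r) \<odot>\<^bsub>M\<^esub> x" unfolding y(5) using y(1) z(1) cx by (simp add: smult_assoc1)
    finally have "fr (t \<otimes> r) (v \<otimes> s) \<odot>\<^bsub>N\<^esub> x = z"
      by (intro smult_fraction) (use x y(1,2) z(1,2,4) S.S_mult in auto)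
    then show "(V \<otimes>\<^bsub>Rp\<^esub> U) \<odot>\<^bsub>N\<^esub> x = V \<odot>\<^bsub>N\<^esub> (U \<odot>\<^bsub>N\<^esub> x)"
      unfolding y(6) z(6) unfolding y(3) z(3) using y z by (simp add: S.frac_mult) }
qed

lemma scalar_action: "r \<in> carrier R \<Longrightarrow> x \<in> T \<Longrightarrow> fr r \<one> \<odot>\<^bsub>N\<^esub> x = r \<odot>\<^bsub>M\<^esub> x"
  using smult_fraction[of r \<one> x "r \<odot>\<^bsub>M\<^esub> x"] S.S_one T_carrier sub_smult[OF T_sub] by simp

text \<open>If \<open>s y = r x\<close> lies in \<open>A\<close>, so does \<open>y\<close> by
  \<open>primary_cancel\<close>; hence an \<open>R\<close>-submodule is closed under fractions. The
  other direction restricts scalars along \<open>r / 1\<close>.\<close>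

lemma submodule_N_iff: "submodule A Rp N \<longleftrightarrow> submodule A R (M\<lparr>carrier := T\<rparr>)"
proof
  assume A: "submodule A Rp N"
  then have AT: "A \<subseteq> T" using module.submoduleE(1)[OF N_module] N_simps by simp
  have "r \<odot>\<^bsub>M\<^esub> x \<in> A" if "r \<in> carrier R" "x \<in> A" for r x
    using submodule.smult_closed[OF A, of "fr r \<one>" x] that AT scalar_action S.frac_closed[OF _ S.S_one] by auto
  then show "submodule A R (M\<lparr>carrier := T\<rparr>)"
    using submodule.axioms(1)[OF A] unfolding submodule_def submodule_axioms_def N_subgroup_iff by simp
next
  assume A: "submodule A R (M\<lparr>carrier := T\<rparr>)"
  then have sA: "sub A" "A \<subseteq> T" using submodule_restrict[OF module_axioms T_sub] by auto
  have "U \<odot>\<^bsub>N\<^esub> x \<in> A" if U: "U \<in> carrier Rp" and x: "x \<in> A" for U x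
  proof -
    have "x \<in> T" using x sA by auto
    then obtain r s y where y: "r \<in> carrier R" "s \<in> S" "y \<in> T" "s \<odot>\<^bsub>M\<^esub> y = r \<odot>\<^bsub>M\<^esub> x" "U \<odot>\<^bsub>N\<^esub> x = y"
      using fraction_action[OF U] by metis
    then have "s \<odot>\<^bsub>M\<^esub> y \<in> A" using sub_smult[OF sA(1)] x by simp
    then show ?thesis using primary_cancel[OF p y(2,3) sA(1)] y(5) by simp
  qed
  then show "submodule A Rp N"
    using submodule.axioms(1)[OF A] unfolding submodule_def submodule_axioms_def N_subgroup_iff by simp
qed

text \<open>From \<open>s y = r x\<close>, an \<open>R\<close>-linear \<open>f\<close> gives
  \<open>s f(y) = r f(x)\<close>, and this equation determines \<open>f(y)\<close> as the multiple
  of \<open>f(x)\<close> by the fraction.\<close>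

lemma module_hom_N: "module_hom R (M\<lparr>carrier := T\<rparr>) (M\<lparr>carrier := T\<rparr>) = module_hom Rp N N"
proof -
  have "(\<forall>U\<in>carrier Rp. \<forall>x\<in>T. f (U \<odot>\<^bsub>N\<^esub> x) = U \<odot>\<^bsub>N\<^esub> f x) \<longleftrightarrow> (\<forall>r\<in>carrier R. \<forall>x\<in>T. f (r \<odot>\<^bsub>M\<^esub> x) = r \<odot>\<^bsub>M\<^esub> f x)"
    if fT: "\<And>x. x \<in> T \<Longrightarrow> f x \<in> T" for f
  proof (intro iffI ballI)
    fix r x assume f: "\<forall>U\<in>carrier Rp. \<forall>x\<in>T. f (U \<odot>\<^bsub>N\<^esub> x) = U \<odot>\<^bsub>N\<^esub> f x" and r: "r \<in> carrier R" "x \<in> T"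
    then have "f (fr r \<one> \<odot>\<^bsub>N\<^esub> x) = fr r \<one> \<odot>\<^bsub>N\<^esub> f x" using S.frac_closed[OF r(1) S.S_one] by blast
    then show "f (r \<odot>\<^bsub>M\<^esub> x) = r \<odot>\<^bsub>M\<^esub> f x" using scalar_action r fT by simp
  next
    fix U x assume f: "\<forall>r\<in>carrier R. \<forall>x\<in>T. f (r \<odot>\<^bsub>M\<^esub> x) = r \<odot>\<^bsub>M\<^esub> f x" and U: "U \<in> carrier Rp" and x: "x \<in> T"
    obtain r s y where y: "r \<in> carrier R" "s \<in> S" "U = fr r s" "y \<in> T" "s \<odot>\<^bsub>M\<^esub> y = r \<odot>\<^bsub>M\<^esub> x" "U \<odot>\<^bsub>N\<^esub> x = y"
      using fraction_action[OF U x] by metis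
    have "f (s \<odot>\<^bsub>M\<^esub> y) = s \<odot>\<^bsub>M\<^esub> f y" "f (r \<odot>\<^bsub>M\<^esub> x) = r \<odot>\<^bsub>M\<^esub> f x" using f y(1,2,4) x by blast+
    then have "s \<odot>\<^bsub>M\<^esub> f y = r \<odot>\<^bsub>M\<^esub> f x" using y(5) by simp
    then have "U \<odot>\<^bsub>N\<^esub> f x = f y" using smult_fraction[OF y(1,2) fT[OF x] fT[OF y(4)]] y(3) by simp
    then show "f (U \<odot>\<^bsub>N\<^esub> x) = U \<odot>\<^bsub>N\<^esub> f x" using y(6) by simp
  qed
  note lin = this
  have "f \<in> module_hom R (M\<lparr>carrier := T\<rparr>) (M\<lparr>carrier := T\<rparr>) \<longleftrightarrow> f \<in> module_hom Rp N N" for f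
  \<comment> \<open>The equivalence \<open>lin\<close> presupposes that \<open>f\<close> preserves
    \<open>T\<close>; otherwise \<open>f\<close> is a homomorphism on neither side.\<close>
  proof (cases "\<forall>x\<in>T. f x \<in> T")
    case True
    then show ?thesis unfolding module_hom_def hom_def using lin[of f] by (simp add: N_simps)
  next
    case False
    then show ?thesis unfolding module_hom_def hom_def by (auto simp: N_simps)
  qed
  then show ?thesis by auto
qed

lemma dual_self_CS_Baer_localization:
  "dual_self_CS_Baer Rp N \<longleftrightarrow> CS_Baer R (M\<lparr>carrier := T\<rparr>)"
proof -
  have "CS_Baer R (M\<lparr>carrier := T\<rparr>) \<longleftrightarrow> CS_Baer Rp N"
    by (rule CS_Baer_cong) (simp_all add: submodule_N_iff module_hom_N, simp_all add: primary_part_module_def)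
  then show ?thesis using module.dual_self_CS_Baer_iff[OF N_module] by simp
qed

end

theorem theorem9p3:
  fixes R :: "('a, 'c) ring_scheme" and M :: "('a, 'm, 'd) module_scheme"
  assumes "dedekind_domain R" and "\<not> local_ring R" and "module R M"
  shows
    "(dual_self_CS_Baer R M \<longleftrightarrow>
        (\<exists>L. direct_sum_decomposition R M (torsion R M) L \<and>
             dual_self_CS_Baer R (M\<lparr>carrier := torsion R M\<rparr>) \<and>
             (\<exists>I :: 'm set. module_isomorphic R (M\<lparr>carrier := L\<rparr>)
                (direct_sum_copies I (quotient_field_module R)))))
     \<and>
     (dual_self_CS_Baer R M \<longleftrightarrow>
        (\<exists>L. independent_family R M (nonzero_primes R) (primary_part R M) \<and>
             direct_sum_decomposition R M
               (module_sum M (nonzero_primes R) (primary_part R M)) L \<and>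
             (\<forall>p \<in> nonzero_primes R.
                dual_self_CS_Baer (localization_at R p) (primary_part_module R M p)) \<and>
             (\<exists>I :: 'm set. module_isomorphic R (M\<lparr>carrier := L\<rparr>)
                (direct_sum_copies I (quotient_field_module R)))))"
proof -
  interpret dedekind_module R M
    using assms by (intro dedekind_module.intro dedekind_module_axioms.intro)
  \<comment> \<open>For a complement of the torsion part, being a direct sum of copies of
    \<open>K\<close> is the same as being divisible, so the index set can be eliminated once and for
    all.\<close>
  have iso: "(\<exists>I :: 'm set. module_isomorphic R (M\<lparr>carrier := L\<rparr>) (direct_sum_copies I (quotient_field_module R)))
      \<longleftrightarrow> divisible L" if L: "dsum tor L" for L
  proof
    assume "divisible L"
    then have "torsion_free_divisible R M L"
      using dsumD[OF L] dedekind_module_axioms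
      by (intro torsion_free_divisible.intro torsion_free_divisible_axioms.intro)
    then show "\<exists>I :: 'm set. module_isomorphic R (M\<lparr>carrier := L\<rparr>) (direct_sum_copies I (quotient_field_module R))"
      by (rule torsion_free_divisible.isomorphic_copies)
  next
    assume "\<exists>I :: 'm set. module_isomorphic R (M\<lparr>carrier := L\<rparr>) (direct_sum_copies I (quotient_field_module R))"
    then show "divisible L" using copies_divisible dsumD(2)[OF L] by blast
  qed
  have T: "dual_self_CS_Baer R (M\<lparr>carrier := tor\<rparr>) \<longleftrightarrow> CS_Baer R (M\<lparr>carrier := tor\<rparr>)"
    using submodule.submodule_is_module[OF torsion_sub module_axioms]
    by (rule module.dual_self_CS_Baer_iff)
  have loc: "dual_self_CS_Baer (localization_at R p) (primary_part_module R M p) \<longleftrightarrow> CS_Baer R (M\<lparr>carrier := prim p\<rparr>)"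
    if "p \<in> P" for p
  proof -
    have "primary_localization R M p"
      using that dedekind_module_axioms
      by (intro primary_localization.intro primary_localization_axioms.intro)
    then show ?thesis unfolding localization_at_def
      by (rule primary_localization.dual_self_CS_Baer_localization)
  qed
  \<comment> \<open>Both decomposition conditions of the theorem reduce to this right-hand side,
    where \<open>L\<close> is merely a divisible complement.\<close>
  have main: "dual_self_CS_Baer R M \<longleftrightarrow> (\<exists>L. dsum tor L \<and> divisible L \<and> CS_Baer R (M\<lparr>carrier := tor\<rparr>))"
  proof
    assume "dual_self_CS_Baer R M"
    then have B: "CS_Baer R M" using dual_self_CS_Baer_iff by simp
    then obtain L where "dsum tor L" "divisible L" using CS_Baer_torsion_summand by metis
    then show "\<exists>L. dsum tor L \<and> divisible L \<and> CS_Baer R (M\<lparr>carrier := tor\<rparr>)"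
      using CS_Baer_summand[OF B] by auto
  next
    assume "\<exists>L. dsum tor L \<and> divisible L \<and> CS_Baer R (M\<lparr>carrier := tor\<rparr>)"
    then show "dual_self_CS_Baer R M"
      using CS_Baer_from_torsion dual_self_CS_Baer_iff by auto
  qed
  have torsion: "(\<exists>L. dsum tor L \<and> dual_self_CS_Baer R (M\<lparr>carrier := tor\<rparr>) \<and>
             (\<exists>I :: 'm set. module_isomorphic R (M\<lparr>carrier := L\<rparr>)
                (direct_sum_copies I (quotient_field_module R))))
      \<longleftrightarrow> (\<exists>L. dsum tor L \<and> divisible L \<and> CS_Baer R (M\<lparr>carrier := tor\<rparr>))"
    using iso T by metis
  have "(\<forall>p \<in> P. dual_self_CS_Baer (localization_at R p) (primary_part_module R M p))
      \<longleftrightarrow> CS_Baer R (M\<lparr>carrier := tor\<rparr>)"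
    using loc CS_Baer_torsion_iff_primary by simp
  then have primary: "(\<exists>L. independent_family R M P prim \<and> dsum (module_sum M P prim) L \<and>
             (\<forall>p \<in> P. dual_self_CS_Baer (localization_at R p) (primary_part_module R M p)) \<and>
             (\<exists>I :: 'm set. module_isomorphic R (M\<lparr>carrier := L\<rparr>)
                (direct_sum_copies I (quotient_field_module R))))
      \<longleftrightarrow> (\<exists>L. dsum tor L \<and> divisible L \<and> CS_Baer R (M\<lparr>carrier := tor\<rparr>))"
    using iso independent_primary module_sum_primary by metis
  show ?thesis unfolding torsion primary using main by simp
qed

end
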